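(* Let $\Lambda=[\lambda_{\min},\lambda_{\max}]$ with $0<\lambda_{\min}<\lambda_{\max}<\infty$ and $\Delta_\Lambda=\lambda_{\max}-\lambda_{\min}$. There are constants $c_\Lambda,C_\Lambda>0$ depending only on $\Lambda$ such that for every integer $d\ge1$ and every $\alpha>0$, with $$\rho_{\alpha,d}(\Lambda):=\min\left\{\Delta_\Lambda^2,\ \frac{(1+\alpha^{-1})^2}{d}\right\},$$ the following hold. (i) (Lower bound.) $\mathcal R^\star_{\mathrm{SLC}}(d,\alpha;\Lambda)\ge c_\Lambda\,\rho_{\alpha,d}(\Lambda)$. (ii) (Norm estimator.) For every fixed $P\in\mathcal P_{\mathrm{SLC}}(\alpha)$, the $P$-centered norm estimator $\widehat\lambda_{\mathrm{norm},P}$ satisfies $$\sup_{\lambda\in\Lambda}\mathbb E_{\lambda,P}\left[\bigl(\widehat\lambda_{\mathrm{norm},P}(Y)-\lambda\bigr)^2\right]\le\min\left\{\Delta_\Lambda^2,\ \frac{\lambda_{\max}^4}{d}\left(\frac{4}{\alpha^2}+\frac{4}{\alpha\lambda_{\min}}+\frac{2}{\lambda_{\min}^2}\right)\right\}.$$ (iii) (MLE.) For every fixed $P\in\mathcal P_{\mathrm{SLC}}(\alpha)$, the constrained maximum-likelihood estimator satisfies $$\sup_{\lambda^\star\in\Lambda}\mathbb E_{\lambda^\star,P}\left[\bigl(\widehat\lambda_{\mathrm{MLE},P}(Y)-\lambda^\star\bigr)^2\right]\le C_\Lambda\min\left\{\Delta_\Lambda^2,\ \frac{(1+\alpha^{-1})^2\log(2d)}{d}\right\}.$$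 (iv) (Rate.) Hence $c_\Lambda\,\rho_{\alpha,d}(\Lambda)\le\mathcal R^\star_{\mathrm{SLC}}(d,\alpha;\Lambda)\le C_\Lambda\,\rho_{\alpha,d}(\Lambda)$.
   Context: Observation model. Let $P$ be a probability measure on $\mathbb R^d$ (the known signal law). For a precision $\lambda>0$ one observes a single vector $Y=X+\lambda^{-1/2}Z$, where $X\sim P$ and $Z\sim\mathcal N(0,I_d)$ are independent. The law of $Y$ is $P_\lambda=P*\mathcal N(0,\lambda^{-1}I_d)$, with density $$p_\lambda(y)=\left(\frac{\lambda}{2\pi}\right)^{d/2}\int e^{-\frac{\lambda}{2}\|x-y\|^2}\,P(dx).$$ $\mathbb E_{\lambda,P}$ denotes expectation under this model and $\mathbb E_P$ expectation over $X\sim P$. Risk. $\mathcal R(P;\Lambda)=\inf_{\widehat\lambda_P}\sup_{\lambda\in\Lambda}\mathbb E_{\lambda,P}[(\widehat\lambda_P(Y)-\lambda)^2]$, where the infimum is over all (measurable) estimators $\widehat\lambda_P:\mathbb R^d\to\Lambda$; the estimator may depend arbitrarily on $P$. Signal class. For $\alpha>0$, $\mathcal P_{\mathrm{SLC}}(\alpha)$ is the class of probability measures $P(dx)=Z_V^{-1}e^{-V(x)}dx$ on $\mathbb R^d$ with $V\in C^2(\mathbb R^d)$ and $\nabla^2V(x)\succeq\alpha I_d$ for all $x$ ($Z_V$ is the normalizing constant). Put $\mathcal R^\star_{\mathrm{SLC}}(d,\alpha;\Lambda)=\sup_{P\in\mathcal P_{\mathrm{SLC}}(\alpha)}\mathcal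 R(P;\Lambda)$. $P$-centered norm estimator. Let $\mu_P=\mathbb E_PX$ and $$\widetilde a_P(Y)=\frac{\|Y-\mu_P\|^2-\mathbb E_P\|X-\mu_P\|^2}{d}.$$ Let $\widehat a_P(Y)$ be the projection of $\widetilde a_P(Y)$ onto the interval $[\lambda_{\max}^{-1},\lambda_{\min}^{-1}]$, and set $\widehat\lambda_{\mathrm{norm},P}(Y)=\widehat a_P(Y)^{-1}$. MLE. With $\ell(\lambda\mid y)=-\log p_\lambda(y)$, the constrained MLE is any (measurable) choice $\widehat\lambda_{\mathrm{MLE},P}(Y)\in\arg\min_{\lambda\in\Lambda}\ell(\lambda\mid Y)$. *)

theory Defs
  imports "HOL-Probability.Probability"
begin

text \<open>
  The constants of the theorem must not depend on the dimension \<open>d\<close>, so \<open>d\<close> is quantified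
  inside the statement and cannot be a type. A point of Euclidean \<open>d\<close>-space is therefore an
  extensional function on \<open>{..<d}\<close>. On this set the topology of the type \<open>nat \<Rightarrow> real\<close>
  (pointwise convergence) induces the usual Euclidean topology, and the product measure of
  \<open>lborel\<close> is Lebesgue measure on the Borel sets.
\<close>

abbreviation euc :: "nat \<Rightarrow> (nat \<Rightarrow> real) set" where
  "euc d \<equiv> {..<d} \<rightarrow>\<^sub>E UNIV"

abbreviation lborel_euc :: "nat \<Rightarrow> (nat \<Rightarrow> real) measure" where
  "lborel_euc d \<equiv> Pi\<^sub>M {..<d} (\<lambda>_. lborel)"

definition edist :: "nat \<Rightarrow> (nat \<Rightarrow> real) \<Rightarrow> (nat \<Rightarrow> real) \<Rightarrow> real" where
  "edist d x y = L2_set (\<lambda>i. x i - y i) {..<d}"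


definition partial_deriv ::
    "nat \<Rightarrow> ((nat \<Rightarrow> real) \<Rightarrow> real) \<Rightarrow> (nat \<Rightarrow> real) \<Rightarrow> real" where
  "partial_deriv i f x = deriv (\<lambda>t. f (x(i := t))) (x i)"

definition C1_euc :: "nat \<Rightarrow> ((nat \<Rightarrow> real) \<Rightarrow> real) \<Rightarrow> bool" where
  "C1_euc d f \<longleftrightarrow> continuous_on (euc d) f \<and>
     (\<forall>i<d. (\<forall>x\<in>euc d. (\<lambda>t. f (x(i := t))) differentiable at (x i)) \<and>
            continuous_on (euc d) (partial_deriv i f))"

definition C2_euc :: "nat \<Rightarrow> ((nat \<Rightarrow> real) \<Rightarrow> real) \<Rightarrow> bool" where
  "C2_euc d f \<longleftrightarrow> C1_euc d f \<and> (\<forall>i<d. C1_euc d (partial_deriv i f))"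

definition hessian_ge :: "nat \<Rightarrow> ((nat \<Rightarrow> real) \<Rightarrow> real) \<Rightarrow> real \<Rightarrow> bool" where
  "hessian_ge d V \<alpha> \<longleftrightarrow> (\<forall>x\<in>euc d. \<forall>v\<in>euc d.
     (\<Sum>i<d. \<Sum>j<d. v i * partial_deriv i (partial_deriv j V) x * v j) \<ge> \<alpha> * (\<Sum>i<d. (v i)\<^sup>2))"

text \<open>
  If \<open>exp (- V x)\<close> were not integrable, \<open>Z\<close> would be \<open>0\<close> and the density would vanish; this is
  excluded by \<open>prob_space P\<close>.
\<close>

definition SLC :: "nat \<Rightarrow> real \<Rightarrow> (nat \<Rightarrow> real) measure set" where
  "SLC d \<alpha> = {P. prob_space P \<and> (\<exists>V. C2_euc d V \<and> hessian_ge d V \<alpha> \<and>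
     (let Z = (\<integral>x. exp (- V x) \<partial>lborel_euc d) in
      P = density (lborel_euc d) (\<lambda>x. ennreal (exp (- V x) / Z))))}"


definition std_gauss :: "nat \<Rightarrow> (nat \<Rightarrow> real) measure" where
  "std_gauss d = Pi\<^sub>M {..<d} (\<lambda>_. density lborel (\<lambda>t. ennreal (std_normal_density t)))"

definition obs_law :: "nat \<Rightarrow> (nat \<Rightarrow> real) measure \<Rightarrow> real \<Rightarrow> (nat \<Rightarrow> real) measure" where
  "obs_law d P l = distr (P \<Otimes>\<^sub>M std_gauss d) (lborel_euc d)
     (\<lambda>(x, z). \<lambda>i\<in>{..<d}. x i + l powr (- 1 / 2) * z i)"

definition obs_density ::
    "nat \<Rightarrow> (nat \<Rightarrow> real) measure \<Rightarrow> real \<Rightarrow> (nat \<Rightarrow> real) \<Rightarrow> real" where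
  "obs_density d P l y =
     (l / (2 * pi)) powr (real d / 2) * (\<integral>x. exp (- (l / 2) * (edist d x y)\<^sup>2) \<partial>P)"


text \<open>
  Risks are extended nonnegative reals, so expectations, suprema and infima are always defined.
\<close>

definition mse ::
    "nat \<Rightarrow> (nat \<Rightarrow> real) measure \<Rightarrow> real \<Rightarrow> ((nat \<Rightarrow> real) \<Rightarrow> real) \<Rightarrow> ennreal" where
  "mse d P l h = (\<integral>\<^sup>+y. ennreal ((h y - l)\<^sup>2) \<partial>obs_law d P l)"

definition estimators :: "nat \<Rightarrow> real set \<Rightarrow> ((nat \<Rightarrow> real) \<Rightarrow> real) set" where
  "estimators d \<Lambda> = lborel_euc d \<rightarrow>\<^sub>M restrict_space borel \<Lambda>"

definition risk :: "nat \<Rightarrow> (nat \<Rightarrow> real) measure \<Rightarrow> real set \<Rightarrow> ennreal" where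
  "risk d P \<Lambda> = (INF h\<in>estimators d \<Lambda>. SUP l\<in>\<Lambda>. mse d P l h)"

definition risk_SLC :: "nat \<Rightarrow> real \<Rightarrow> real set \<Rightarrow> ennreal" where
  "risk_SLC d \<alpha> \<Lambda> = (SUP P\<in>SLC d \<alpha>. risk d P \<Lambda>)"


definition mean_vec :: "nat \<Rightarrow> (nat \<Rightarrow> real) measure \<Rightarrow> nat \<Rightarrow> real" where
  "mean_vec d P = (\<lambda>i\<in>{..<d}. \<integral>x. x i \<partial>P)"

definition norm_stat :: "nat \<Rightarrow> (nat \<Rightarrow> real) measure \<Rightarrow> (nat \<Rightarrow> real) \<Rightarrow> real" where
  "norm_stat d P y =
     ((edist d y (mean_vec d P))\<^sup>2 - (\<integral>x. (edist d x (mean_vec d P))\<^sup>2 \<partial>P)) / real d"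

definition norm_estimator ::
    "nat \<Rightarrow> (nat \<Rightarrow> real) measure \<Rightarrow> real \<Rightarrow> real \<Rightarrow> (nat \<Rightarrow> real) \<Rightarrow> real" where
  "norm_estimator d P lmin lmax y =
     inverse (closest_point {inverse lmax..inverse lmin} (norm_stat d P y))"

definition is_MLE ::
    "nat \<Rightarrow> (nat \<Rightarrow> real) measure \<Rightarrow> real set \<Rightarrow> ((nat \<Rightarrow> real) \<Rightarrow> real) \<Rightarrow> bool" where
  "is_MLE d P \<Lambda> h \<longleftrightarrow> h \<in> borel_measurable (lborel_euc d) \<and>
     (\<forall>y\<in>euc d. is_arg_min (\<lambda>l. - ln (obs_density d P l y)) (\<lambda>l. l \<in> \<Lambda>) (h y))"

definition rate :: "real \<Rightarrow> nat \<Rightarrow> real \<Rightarrow> real \<Rightarrow> real" where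
  "rate \<alpha> d lmin lmax = min ((lmax - lmin)\<^sup>2) ((1 + inverse \<alpha>)\<^sup>2 / real d)"

end

theory Submission
  imports Defs
begin

text \<open>
  A strongly log-concave signal enters through a single inequality. If \<open>p\<close> is the density of a
  member of the class, the Hessian bound says that
  \<open>(p ((x + y) / 2))\<^sup>2 \<ge> p x * p y * exp (\<alpha> / 4 * \<bar>x - y\<bar>\<^sup>2)\<close>. The Prekopa-Leindler inequality, applied to
  \<open>p * exp \<phi>\<close>, \<open>p * exp (- \<psi>)\<close> and \<open>p\<close>, then gives \<open>E (exp \<phi>) * E (exp (- \<psi>)) \<le> 1\<close> whenever
  \<open>\<phi> x - \<psi> y \<le> \<alpha> / 4 * \<bar>x - y\<bar>\<^sup>2\<close> (Maurey's form of the concentration property; lemma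
  \<open>SLC_exp_inf_convolution\<close>). For linear and for quadratic \<open>\<psi>\<close> the best \<open>\<phi>\<close> is
  explicit. A second order expansion in the size of \<open>\<psi>\<close> then bounds the variance of a coordinate and of the
  squared norm with the constant \<open>1 / \<alpha>\<close> of the Poincare inequality (lemma \<open>variance_le_if_mgf_product\<close>), and
  Markov's inequality yields tails (lemma \<open>tail_bounds_if_mgf_product\<close>). Gaussian noise acts explicitly on the exponential moments of a
  squared norm, hence \<open>T = \<bar>Y - \<mu>\<bar>\<^sup>2\<close> inherits a product bound of the same shape (lemma
  \<open>obs_law_mgf_sq_norm\<close>).

  Norm estimator: the expansion gives \<open>Var T \<le> d * (4 / \<alpha>\<^sup>2 + 4 / (\<alpha> * \<lambda>) + 2 / \<lambda>\<^sup>2)\<close>, and \<open>a \<mapsto> 1 / a\<close> is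
  Lipschitz with constant \<open>\<lambda>\<^sub>m\<^sub>a\<^sub>x\<^sup>2\<close> on the projection interval.

  Maximum likelihood: the likelihood need not be concave in \<open>\<lambda>\<close>, so the argument compares precisions in pairs.
  The tails of \<open>T\<close> give a test between two precisions at distance \<open>\<delta>\<close> with both errors at most \<open>exp (- c * d * \<delta>\<^sup>2 / K\<^sup>2)\<close>, where
  \<open>K = 1 + 1 / \<alpha>\<close>. The existence of any such test bounds the probability that the wrong precision has the
  larger likelihood, even up to a factor \<open>e\<close>. On a grid of mesh \<open>2 * \<lambda>\<^sub>m\<^sub>i\<^sub>n / d\<close> rounding a precision down
  costs no more than this factor, because the Gaussian integral in the density decreases in \<open>\<lambda>\<close> and the
  normalization varies slowly. A union bound over the \<open>O(d)\<close> grid points produces the factor \<open>ln (2 * d)\<close>.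

  Lower bound: for the signal \<open>N(0, I / \<alpha>)\<close> the observation is \<open>N(0, (1 / \<lambda> + 1 / \<alpha>) I)\<close>. Two precisions at
  distance of order \<open>K / sqrt d\<close> give laws with Hellinger affinity at least \<open>3 / 4\<close>, and no estimator separates them.
\<close>

section \<open>The Prekopa-Leindler inequality\<close>

text \<open>
  Only levels below \<open>1\<close> are integrated: above the common supremum of the two lower functions there is
  nothing to compare with, so the largest function has to be cut there.
\<close>

lemma layer_cake_truncated:
  fixes f :: "real \<Rightarrow> ennreal"
  assumes [measurable]: "f \<in> borel_measurable borel"
  shows "(\<integral>\<^sup>+x. min (f x) 1 \<partial>lborel)
    = (\<integral>\<^sup>+c. emeasure lborel {x. ennreal c < f x} * indicator {0<..<1} c \<partial>lborel)"
proof -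
  have slice: "min (f x) 1 = (\<integral>\<^sup>+c. indicator {0<..<1} c * indicator {x. ennreal c < f x} x \<partial>lborel)" for x
  proof -
    obtain r where r: "min (f x) 1 = ennreal r" "0 \<le> r" "r \<le> 1"
      by (cases "min (f x) 1") (auto simp: min_def top_unique split: if_splits)
    have "ennreal c < f x \<longleftrightarrow> c < r" if "0 < c" "c < 1" for c
    proof -
      have "ennreal c < f x \<longleftrightarrow> ennreal c < min (f x) 1"
        using that by (simp add: ennreal_less_one_iff)
      also have "\<dots> \<longleftrightarrow> c < r" using r that by (simp add: ennreal_less_iff)
      finally show ?thesis .
    qed
    then have "(\<lambda>c. indicator {0<..<1} c * indicator {x. ennreal c < f x} x)
      = (indicator {0<..<r} :: real \<Rightarrow> ennreal)"
      using r by (auto simp: fun_eq_iff split: split_indicator)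
    then show ?thesis using r by (simp add: r(1))
  qed
  have "(\<integral>\<^sup>+x. min (f x) 1 \<partial>lborel)
    = (\<integral>\<^sup>+x. (\<integral>\<^sup>+c. indicator {0<..<1} c * indicator {x. ennreal c < f x} x \<partial>lborel) \<partial>lborel)"
    by (subst slice) simp
  also have "\<dots> = (\<integral>\<^sup>+c. (\<integral>\<^sup>+x. indicator {0<..<1} c * indicator {x. ennreal c < f x} x \<partial>lborel) \<partial>lborel)"
    by (rule lborel_pair.Fubini'[symmetric]) measurable
  also have "\<dots> = (\<integral>\<^sup>+c. emeasure lborel {x. ennreal c < f x} * indicator {0<..<1} c \<partial>lborel)"
    by (intro nn_integral_cong) (simp add: nn_integral_cmult mult.commute)
  finally show ?thesis .
qed

text \<open>
  The usual proof translates \<open>A\<close> by the least point of \<open>B\<close> and \<open>B\<close> by the greatest point of \<open>A\<close>; the two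
  translates meet in one point. Without compactness, points that are extremal up to \<open>e / 2\<close> take their place.
  The measurable set \<open>C\<close> stands in for half the Minkowski sum, which can fail to be a Borel set.
\<close>

lemma brunn_minkowski_line:
  fixes A B C :: "real set"
  assumes [measurable]: "A \<in> sets borel" "B \<in> sets borel" "C \<in> sets borel"
    and ne: "A \<noteq> {}" "B \<noteq> {}" and bnd: "bdd_above A" "bdd_below B"
    and mid: "\<And>x y. x \<in> A \<Longrightarrow> y \<in> B \<Longrightarrow> (x + y) / 2 \<in> C"
  shows "emeasure lborel A + emeasure lborel B \<le> 2 * emeasure lborel C"
proof (rule ennreal_le_epsilon)
  fix e :: real assume "0 < e"
  obtain a where a: "a \<in> A" "Sup A - e / 2 < a"
    using less_cSupE[of "Sup A - e/2" A] ne \<open>0 < e\<close> by auto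
  obtain b where b: "b \<in> B" "b < Inf B + e / 2"
    using cInf_lessD[of B "Inf B + e/2"] ne \<open>0 < e\<close> by auto
  have A_le: "emeasure lborel A \<le> emeasure lborel (A \<inter> {..<a}) + ennreal (e / 2)"
  proof -
    have "A \<subseteq> (A \<inter> {..<a}) \<union> {a..a + e / 2}"
    proof
      fix x assume "x \<in> A"
      then have "x \<le> Sup A" using bnd by (intro cSup_upper)
      then show "x \<in> (A \<inter> {..<a}) \<union> {a..a + e / 2}" using a \<open>x \<in> A\<close> by auto
    qed
    then have "emeasure lborel A \<le> emeasure lborel ((A \<inter> {..<a}) \<union> {a..a + e / 2})"
      by (intro emeasure_mono) auto
    also have "\<dots> \<le> emeasure lborel (A \<inter> {..<a}) + emeasure lborel {a..a + e / 2}"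
      by (intro emeasure_subadditive) auto
    finally show ?thesis using \<open>0 < e\<close> by simp
  qed
  have B_le: "emeasure lborel B \<le> emeasure lborel (B \<inter> {b..}) + ennreal (e / 2)"
  proof -
    have "B \<subseteq> (B \<inter> {b..}) \<union> {b - e / 2..b}"
    proof
      fix x assume "x \<in> B"
      then have "Inf B \<le> x" using bnd by (intro cInf_lower)
      then show "x \<in> (B \<inter> {b..}) \<union> {b - e / 2..b}" using b \<open>x \<in> B\<close> by auto
    qed
    then have "emeasure lborel B \<le> emeasure lborel ((B \<inter> {b..}) \<union> {b - e / 2..b})"
      by (intro emeasure_mono) auto
    also have "\<dots> \<le> emeasure lborel (B \<inter> {b..}) + emeasure lborel {b - e / 2..b}"
      by (intro emeasure_subadditive) auto
    finally show ?thesis using \<open>0 < e\<close> by simp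
  qed
  have half: "emeasure lborel S = 2 * (\<integral>\<^sup>+x. indicator S (2 * x - t) \<partial>lborel)"
    if "S \<in> sets borel" for S :: "real set" and t
    using nn_integral_real_affine[of "indicator S" 2 "- t"] that by (simp add: add.commute)
  (* Translated by \<open>b\<close> and by \<open>a\<close> and halved, the two pieces lie on opposite sides of \<open>(a + b) / 2\<close>. *)
  have "emeasure lborel (A \<inter> {..<a}) + emeasure lborel (B \<inter> {b..})
    = 2 * (\<integral>\<^sup>+x. indicator (A \<inter> {..<a}) (2 * x - b) + indicator (B \<inter> {b..}) (2 * x - a) \<partial>lborel)"
    by (subst nn_integral_add) (auto simp: distrib_left half[of _ b, symmetric] half[of _ a, symmetric])
  also have "\<dots> \<le> 2 * (\<integral>\<^sup>+x. indicator C x \<partial>lborel)"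
  proof (intro mult_left_mono nn_integral_mono)
    fix x
    have "x \<in> C" if "2 * x - b \<in> A" using mid[OF that b(1)] by simp
    moreover have "x \<in> C" if "2 * x - a \<in> B" using mid[OF a(1) that] by simp
    ultimately show "indicator (A \<inter> {..<a}) (2 * x - b) + indicator (B \<inter> {b..}) (2 * x - a)
      \<le> (indicator C x :: ennreal)"
      by (auto split: split_indicator)
  qed simp
  finally have *: "emeasure lborel (A \<inter> {..<a}) + emeasure lborel (B \<inter> {b..}) \<le> 2 * emeasure lborel C"
    by simp
  have "emeasure lborel A + emeasure lborel B
    \<le> (emeasure lborel (A \<inter> {..<a}) + ennreal (e/2)) + (emeasure lborel (B \<inter> {b..}) + ennreal (e/2))"
    by (intro add_mono A_le B_le)
  also have "\<dots> = emeasure lborel (A \<inter> {..<a}) + emeasure lborel (B \<inter> {b..}) + (ennreal (e/2) + ennreal (e/2))"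
    by (simp add: ac_simps)
  also have "ennreal (e/2) + ennreal (e/2) = ennreal e"
    using \<open>0 < e\<close> by (subst ennreal_plus[symmetric]) auto
  finally show "emeasure lborel A + emeasure lborel B \<le> 2 * emeasure lborel C + ennreal e"
    using * by (meson add_mono_thms_linordered_semiring(3) order_trans)
qed

text \<open>
  With both suprema equal to \<open>1\<close>, every level set below \<open>1\<close> of \<open>f\<close> and of \<open>g\<close> is nonempty and
  Brunn-Minkowski applies level by level. This gives the arithmetic mean of the integrals, which is stronger
  than the geometric mean of the general inequality.
\<close>

lemma prekopa_leindler_line_normalized:
  fixes f g h :: "real \<Rightarrow> ennreal"
  assumes [measurable]: "f \<in> borel_measurable borel" "g \<in> borel_measurable borel"
      "h \<in> borel_measurable borel"
    and le: "\<And>x y. f x * g y \<le> (h ((x + y) / 2))\<^sup>2"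
    and sup: "(SUP x. f x) = 1" "(SUP x. g x) = 1"
    and supp: "\<And>x. \<bar>x\<bar> > K \<Longrightarrow> f x = 0" "\<And>x. \<bar>x\<bar> > K \<Longrightarrow> g x = 0"
  shows "(\<integral>\<^sup>+x. f x \<partial>lborel) + (\<integral>\<^sup>+x. g x \<partial>lborel) \<le> 2 * (\<integral>\<^sup>+x. h x \<partial>lborel)"
proof -
  let ?L = "\<lambda>u c. emeasure lborel {x. ennreal c < u x} * indicator {0<..<1} c"
  have level: "?L f c + ?L g c \<le> 2 * ?L h c" for c :: real
  proof (cases "c \<in> {0<..<1}")
    case True
    have "emeasure lborel {x. ennreal c < f x} + emeasure lborel {x. ennreal c < g x}
      \<le> 2 * emeasure lborel {x. ennreal c < h x}"
    proof (rule brunn_minkowski_line)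
      have c1: "ennreal c < 1" using True by (simp add: ennreal_less_one_iff)
      show "{x. ennreal c < f x} \<noteq> {}" "{x. ennreal c < g x} \<noteq> {}"
        using sup c1 by (metis (mono_tags, lifting) empty_Collect_eq less_SUP_iff)+
      show "bdd_above {x. ennreal c < f x}"
        by (rule bdd_aboveI[of _ K]) (metis abs_ge_self linorder_not_le mem_Collect_eq not_less_zero order_less_le_trans supp(1))
      show "bdd_below {x. ennreal c < g x}"
        by (rule bdd_belowI[of _ "- K"]) (metis abs_ge_minus_self linorder_not_le mem_Collect_eq minus_le_iff not_less_zero order_trans supp(2))
      fix x y assume "x \<in> {x. ennreal c < f x}" "y \<in> {x. ennreal c < g x}"
      then have "(ennreal c)\<^sup>2 < ennreal c * g y" "ennreal c * g y \<le> f x * g y"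
        using True by (auto simp: power2_eq_square intro!: ennreal_mult_strict_left_mono mult_right_mono)
      then have "(ennreal c)\<^sup>2 < f x * g y" by (rule order.strict_trans2)
      also have "\<dots> \<le> (h ((x + y) / 2))\<^sup>2" by (rule le)
      finally have "ennreal c < h ((x + y) / 2)"
        by (metis linorder_not_le power_mono zero_le)
      then show "(x + y) / 2 \<in> {x. ennreal c < h x}" by simp
    qed measurable
    then show ?thesis using True by simp
  qed simp
  have full: "min (f x) 1 = f x" "min (g x) 1 = g x" for x
    using sup by (metis SUP_upper UNIV_I min_absorb1)+
  have "(\<integral>\<^sup>+x. f x \<partial>lborel) + (\<integral>\<^sup>+x. g x \<partial>lborel)
    = (\<integral>\<^sup>+c. ?L f c \<partial>lborel) + (\<integral>\<^sup>+c. ?L g c \<partial>lborel)"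
    using layer_cake_truncated[of f] layer_cake_truncated[of g] by (simp add: full)
  also have "\<dots> = (\<integral>\<^sup>+c. ?L f c + ?L g c \<partial>lborel)"
    by (rule nn_integral_add[symmetric]) measurable
  also have "\<dots> \<le> (\<integral>\<^sup>+c. 2 * ?L h c \<partial>lborel)"
    by (intro nn_integral_mono level)
  also have "\<dots> = 2 * (\<integral>\<^sup>+x. min (h x) 1 \<partial>lborel)"
    by (subst nn_integral_cmult) (auto simp: layer_cake_truncated)
  also have "\<dots> \<le> 2 * (\<integral>\<^sup>+x. h x \<partial>lborel)"
    by (intro mult_left_mono nn_integral_mono) auto
  finally show ?thesis .
qed

text \<open>
  The step from the arithmetic to the geometric mean.
\<close>

lemma mult_le_power2_if_add_le:
  fixes u v w :: real
  assumes "0 \<le> u + v" "u + v \<le> 2 * w"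
  shows "u * v \<le> w\<^sup>2"
proof -
  have "(u + v)\<^sup>2 \<le> (2 * w)\<^sup>2" using assms by (intro power_mono)
  then show ?thesis using sum_squares_bound[of u v] by (simp add: power2_sum power_mult_distrib)
qed

text \<open>
  Cutting \<open>f\<close> and \<open>g\<close> off in height and in support preserves the hypothesis and makes the suprema finite.
  Dividing by the suprema \<open>\<alpha>\<close> and \<open>\<beta>\<close>, and \<open>h\<close> by \<open>sqrt (\<alpha> * \<beta>)\<close>, reduces to the normalized case.
\<close>

lemma prekopa_leindler_line:
  fixes f g h :: "real \<Rightarrow> ennreal"
  assumes [measurable]: "f \<in> borel_measurable borel" "g \<in> borel_measurable borel"
      "h \<in> borel_measurable borel"
    and le: "\<And>x y. f x * g y \<le> (h ((x + y) / 2))\<^sup>2"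
  shows "(\<integral>\<^sup>+x. f x \<partial>lborel) * (\<integral>\<^sup>+x. g x \<partial>lborel) \<le> (\<integral>\<^sup>+x. h x \<partial>lborel)\<^sup>2"
proof -
  define cut :: "(real \<Rightarrow> ennreal) \<Rightarrow> nat \<Rightarrow> real \<Rightarrow> ennreal"
    where "cut u n x = min (u x) (of_nat n) * indicator {-real n..real n} x" for u n x
  have [measurable]: "cut u n \<in> borel_measurable borel" if "u \<in> borel_measurable borel" for u n
    using that unfolding cut_def by measurable
  have cut_le: "cut u n x \<le> u x" "cut u n x \<le> of_nat n" for u n x
    by (auto simp: cut_def split: split_indicator)
  have bounded: "(\<integral>\<^sup>+x. cut f n x \<partial>lborel) * (\<integral>\<^sup>+x. cut g n x \<partial>lborel) \<le> (\<integral>\<^sup>+x. h x \<partial>lborel)\<^sup>2" for n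
  proof -
    have "(SUP x. cut u n x) \<le> of_nat n" for u by (intro SUP_least cut_le)
    then have "\<exists>r\<ge>0. (SUP x. cut u n x) = ennreal r" for u
      by (metis ennreal_cases ennreal_of_nat_eq_real_of_nat ennreal_neq_top top_unique)
    then obtain \<alpha> \<beta> where \<alpha>: "0 \<le> \<alpha>" "(SUP x. cut f n x) = ennreal \<alpha>"
      and \<beta>: "0 \<le> \<beta>" "(SUP x. cut g n x) = ennreal \<beta>" by metis
    have zero: "cut u n x = 0" if "(SUP x. cut u n x) = 0" for u x
      using that by (metis SUP_upper UNIV_I le_zero_eq)
    show ?thesis
    proof (cases "\<alpha> = 0 \<or> \<beta> = 0")
      case True
      then have "(\<forall>x. cut f n x = 0) \<or> (\<forall>x. cut g n x = 0)"
        using \<alpha> \<beta> zero by auto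
      then show ?thesis by auto
    next
      case False
      then have pos: "0 < \<alpha>" "0 < \<beta>" using \<alpha> \<beta> by auto
      define s where "s = 1 / sqrt (\<alpha> * \<beta>)"
      have "0 < s" and s2: "s\<^sup>2 = (1/\<alpha>) * (1/\<beta>)"
        using pos by (auto simp: s_def power_divide)
      let ?f = "\<lambda>x. cut f n x * ennreal (1/\<alpha>)" and ?g = "\<lambda>x. cut g n x * ennreal (1/\<beta>)"
      let ?h = "\<lambda>x. h x * ennreal s"
      have "(\<integral>\<^sup>+x. ?f x \<partial>lborel) + (\<integral>\<^sup>+x. ?g x \<partial>lborel) \<le> 2 * (\<integral>\<^sup>+x. ?h x \<partial>lborel)"
      proof (rule prekopa_leindler_line_normalized[where K = "real n"])
        show "(SUP x. ?f x) = 1" "(SUP x. ?g x) = 1"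
          using \<alpha> \<beta> pos by (simp_all add: SUP_mult_right_ennreal[symmetric] ennreal_mult[symmetric])
        show "?f x = 0" "?g x = 0" if "real n < \<bar>x\<bar>" for x
          using that by (auto simp: cut_def split: split_indicator)
        fix x y
        have "?f x * ?g y \<le> f x * g y * (ennreal (1/\<alpha>) * ennreal (1/\<beta>))"
          using mult_right_mono[OF mult_mono[OF cut_le(1)[of f n x] cut_le(1)[of g n y]],
              of "ennreal (1/\<alpha>) * ennreal (1/\<beta>)"]
          by (simp add: ac_simps)
        also have "ennreal (1/\<alpha>) * ennreal (1/\<beta>) = (ennreal s)\<^sup>2"
          using pos \<open>0 < s\<close> by (simp add: s2 ennreal_power ennreal_mult[symmetric])
        also have "f x * g y * (ennreal s)\<^sup>2 \<le> (?h ((x + y) / 2))\<^sup>2"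
          using le[of x y] by (simp add: power_mult_distrib mult_right_mono)
        finally show "?f x * ?g y \<le> (?h ((x + y) / 2))\<^sup>2" .
      qed measurable
      then have sum_le: "(\<integral>\<^sup>+x. cut f n x \<partial>lborel) * ennreal (1/\<alpha>)
          + (\<integral>\<^sup>+x. cut g n x \<partial>lborel) * ennreal (1/\<beta>) \<le> 2 * ((\<integral>\<^sup>+x. h x \<partial>lborel) * ennreal s)"
        by (simp add: nn_integral_multc)
      show ?thesis
      proof (cases "(\<integral>\<^sup>+x. h x \<partial>lborel) = \<top>")
        case True then show ?thesis by simp
      next
        case False
        have fin: "u = \<top> \<Longrightarrow> 0 < r \<Longrightarrow> u * ennreal (1 / r) = \<top>" for u :: ennreal and r :: real
          by (simp add: ennreal_top_mult)
        from False have rhs: "2 * ((\<integral>\<^sup>+x. h x \<partial>lborel) * ennreal s) < \<top>"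
          by (auto simp: ennreal_mult_less_top less_top)
        have "(\<integral>\<^sup>+x. cut f n x \<partial>lborel) \<noteq> \<top>" "(\<integral>\<^sup>+x. cut g n x \<partial>lborel) \<noteq> \<top>"
          using sum_le rhs fin pos by (metis ennreal_add_eq_top leD top.not_eq_extremum)+
        with False obtain p q r where pqr: "0 \<le> p" "0 \<le> q" "0 \<le> r"
          "(\<integral>\<^sup>+x. cut f n x \<partial>lborel) = ennreal p" "(\<integral>\<^sup>+x. cut g n x \<partial>lborel) = ennreal q"
          "(\<integral>\<^sup>+x. h x \<partial>lborel) = ennreal r"
          by (metis ennreal_cases)
        have "ennreal (p * (1/\<alpha>) + q * (1/\<beta>)) \<le> 2 * ennreal (r * s)"
          using sum_le pqr pos \<open>0 < s\<close> by (simp add: ennreal_mult[symmetric] ennreal_plus[symmetric] del: ennreal_plus)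
        also have "\<dots> = ennreal (2 * (r * s))"
          using pqr \<open>0 < s\<close> by (simp add: ennreal_mult)
        finally have "ennreal (p * (1/\<alpha>) + q * (1/\<beta>)) \<le> ennreal (2 * (r * s))" .
        moreover have "0 \<le> 2 * (r * s)" using pqr \<open>0 < s\<close> by simp
        ultimately have "p * (1/\<alpha>) + q * (1/\<beta>) \<le> 2 * (r * s)"
          by (metis ennreal_le_iff)
        moreover have "0 \<le> p * (1/\<alpha>) + q * (1/\<beta>)"
          using pqr pos by (intro add_nonneg_nonneg mult_nonneg_nonneg) auto
        ultimately have "(p * (1/\<alpha>)) * (q * (1/\<beta>)) \<le> (r * s)\<^sup>2"
          by (intro mult_le_power2_if_add_le)
        then have "(p * q) * s\<^sup>2 \<le> r\<^sup>2 * s\<^sup>2" by (simp add: power_mult_distrib s2)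
        then have "p * q \<le> r\<^sup>2" using \<open>0 < s\<close> by simp
        then show ?thesis using pqr by (simp add: ennreal_mult[symmetric] ennreal_power)
      qed
    qed
  qed
  have mono: "cut u m x \<le> cut u n x" if "m \<le> n" for u m n x
    using that unfolding cut_def by (intro mult_mono min.mono) (auto split: split_indicator)
  have lim: "(\<integral>\<^sup>+x. u x \<partial>lborel) = (SUP n. \<integral>\<^sup>+x. cut u n x \<partial>lborel)"
    if [measurable]: "u \<in> borel_measurable borel" for u
  proof -
    have "u x = (SUP n. cut u n x)" for x
    proof -
      have "(\<lambda>n. min (u x) (of_nat n)) \<longlonglongrightarrow> min (u x) \<top>"
        by (intro tendsto_min tendsto_const of_nat_tendsto_top_ennreal)
      moreover have "\<forall>\<^sub>F n in sequentially. min (u x) (of_nat n) = cut u n x"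
        using eventually_ge_at_top[of "nat \<lceil>\<bar>x\<bar>\<rceil>"]
        by eventually_elim (auto simp: cut_def nat_le_iff ceiling_le_iff split: split_indicator)
      ultimately have "(\<lambda>n. cut u n x) \<longlonglongrightarrow> u x" by (simp add: tendsto_cong)
      moreover have "(\<lambda>n. cut u n x) \<longlonglongrightarrow> (SUP n. cut u n x)"
        using mono by (intro LIMSEQ_SUP) (auto simp: incseq_def)
      ultimately show ?thesis by (rule LIMSEQ_unique)
    qed
    then have "(\<integral>\<^sup>+x. u x \<partial>lborel) = (\<integral>\<^sup>+x. (SUP n. cut u n x) \<partial>lborel)" by simp
    also have "\<dots> = (SUP n. \<integral>\<^sup>+x. cut u n x \<partial>lborel)"
      using mono by (intro nn_integral_monotone_convergence_SUP) (auto simp: incseq_def le_fun_def)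
    finally show ?thesis .
  qed
  have "(\<integral>\<^sup>+x. cut f m x \<partial>lborel) * (\<integral>\<^sup>+x. cut g n x \<partial>lborel) \<le> (\<integral>\<^sup>+x. h x \<partial>lborel)\<^sup>2" for m n
  proof -
    have "(\<integral>\<^sup>+x. cut f m x \<partial>lborel) * (\<integral>\<^sup>+x. cut g n x \<partial>lborel)
      \<le> (\<integral>\<^sup>+x. cut f (max m n) x \<partial>lborel) * (\<integral>\<^sup>+x. cut g (max m n) x \<partial>lborel)"
      by (intro mult_mono nn_integral_mono mono) auto
    then show ?thesis using bounded order_trans by blast
  qed
  then show ?thesis
    unfolding lim[OF assms(1)] lim[OF assms(2)]
    by (simp add: SUP_mult_left_ennreal SUP_mult_right_ennreal SUP_le_iff)
qed

lemma nn_integral_euc_Suc: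
  assumes [measurable]: "f \<in> borel_measurable (lborel_euc (Suc d))"
  shows "(\<integral>\<^sup>+x. f x \<partial>lborel_euc (Suc d)) = (\<integral>\<^sup>+t. (\<integral>\<^sup>+x. f (x(d := t)) \<partial>lborel_euc d) \<partial>lborel)"
proof -
  interpret product_sigma_finite "\<lambda>_::nat. lborel :: real measure" ..
  have "{..<Suc d} = insert d {..<d}" by auto
  then show ?thesis using product_nn_integral_insert_rev[of "{..<d}" d f] assms by simp
qed

lemma measurable_fun_upd_euc:
  "(\<lambda>(t, x). x(d := t)) \<in> lborel \<Otimes>\<^sub>M lborel_euc d \<rightarrow>\<^sub>M lborel_euc (Suc d)"
proof -
  have *: "{..<Suc d} = insert d {..<d}" by auto
  show ?thesis unfolding * split_beta' by measurable
qed

text \<open>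
  The inequality tensorizes: for fixed last coordinates \<open>s\<close>, \<open>t\<close> and \<open>(s + t) / 2\<close> the sections satisfy the
  hypothesis in dimension \<open>d\<close>, so their integrals satisfy it on the line.
\<close>

theorem prekopa_leindler:
  fixes f g h :: "(nat \<Rightarrow> real) \<Rightarrow> ennreal"
  assumes "f \<in> borel_measurable (lborel_euc d)" "g \<in> borel_measurable (lborel_euc d)"
      "h \<in> borel_measurable (lborel_euc d)"
    and "\<And>x y. x \<in> euc d \<Longrightarrow> y \<in> euc d \<Longrightarrow> f x * g y \<le> (h (\<lambda>i\<in>{..<d}. (x i + y i) / 2))\<^sup>2"
  shows "(\<integral>\<^sup>+x. f x \<partial>lborel_euc d) * (\<integral>\<^sup>+x. g x \<partial>lborel_euc d) \<le> (\<integral>\<^sup>+x. h x \<partial>lborel_euc d)\<^sup>2"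
  using assms
proof (induction d arbitrary: f g h)
  case 0
  have "f (\<lambda>_. undefined) * g (\<lambda>_. undefined) \<le> (h (\<lambda>_. undefined))\<^sup>2"
    using "0.prems"(4)[of "\<lambda>_. undefined" "\<lambda>_. undefined"] by (simp add: restrict_def)
  then show ?case
    by (simp add: PiM_empty nn_integral_count_space_finite)
next
  case (Suc d)
  interpret product_sigma_finite "\<lambda>_::nat. lborel :: real measure" ..
  interpret D: finite_product_sigma_finite "\<lambda>_::nat. lborel :: real measure" "{..<d}" by standard simp
  have upd [measurable]: "(\<lambda>x. x(d := t)) \<in> lborel_euc d \<rightarrow>\<^sub>M lborel_euc (Suc d)" for t
    using measurable_compose[OF measurable_Pair1' measurable_fun_upd_euc, of t] by simp
  have joint: "(\<lambda>(t, x). u (x(d := t))) \<in> borel_measurable (lborel \<Otimes>\<^sub>M lborel_euc d)"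
    if "u \<in> borel_measurable (lborel_euc (Suc d))" for u :: "_ \<Rightarrow> ennreal"
    using measurable_compose[OF measurable_fun_upd_euc that] by (simp add: split_beta')
  note [measurable] = Suc.prems(1-3)
  show ?case
    unfolding nn_integral_euc_Suc[OF Suc.prems(1)] nn_integral_euc_Suc[OF Suc.prems(2)]
      nn_integral_euc_Suc[OF Suc.prems(3)]
  proof (rule prekopa_leindler_line)
    have slice: "(\<lambda>t. \<integral>\<^sup>+x. u (x(d := t)) \<partial>lborel_euc d) \<in> borel_measurable borel"
      if "u \<in> borel_measurable (lborel_euc (Suc d))" for u :: "_ \<Rightarrow> ennreal"
      using D.borel_measurable_nn_integral[OF joint[OF that]] by simp
    show "(\<lambda>t. \<integral>\<^sup>+x. f (x(d := t)) \<partial>lborel_euc d) \<in> borel_measurable borel"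
      "(\<lambda>t. \<integral>\<^sup>+x. g (x(d := t)) \<partial>lborel_euc d) \<in> borel_measurable borel"
      "(\<lambda>t. \<integral>\<^sup>+x. h (x(d := t)) \<partial>lborel_euc d) \<in> borel_measurable borel"
      by (rule slice, fact)+
    fix s t :: real
    show "(\<integral>\<^sup>+x. f (x(d := s)) \<partial>lborel_euc d) * (\<integral>\<^sup>+x. g (x(d := t)) \<partial>lborel_euc d)
      \<le> (\<integral>\<^sup>+x. h (x(d := (s + t) / 2)) \<partial>lborel_euc d)\<^sup>2"
    proof (rule Suc.IH)
      fix x y :: "nat \<Rightarrow> real" assume xy: "x \<in> euc d" "y \<in> euc d"
      have "f (x(d := s)) * g (y(d := t))
        \<le> (h (\<lambda>i\<in>{..<Suc d}. ((x(d := s)) i + (y(d := t)) i) / 2))\<^sup>2"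
        using xy by (intro Suc.prems(4)) (auto simp: PiE_iff extensional_def)
      also have "(\<lambda>i\<in>{..<Suc d}. ((x(d := s)) i + (y(d := t)) i) / 2)
        = (\<lambda>i\<in>{..<d}. (x i + y i) / 2)(d := (s + t) / 2)"
        by (auto simp: fun_eq_iff restrict_def)
      finally show "f (x(d := s)) * g (y(d := t))
        \<le> (h ((\<lambda>i\<in>{..<d}. (x i + y i) / 2)(d := (s + t) / 2)))\<^sup>2" .
    qed measurable
  qed
qed

section \<open>Strong midpoint convexity from the Hessian\<close>

text \<open>
  The topology of pointwise convergence has the product sigma-algebra as its Borel sets because the index
  type is countable; outside \<open>{..<d}\<close> the coordinates are the constant \<open>undefined\<close>.
\<close>

lemma continuous_on_euc_measurable:
  fixes f :: "(nat \<Rightarrow> real) \<Rightarrow> real"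
  assumes "continuous_on (euc d) f"
  shows "f \<in> borel_measurable (lborel_euc d)"
proof -
  have "(\<lambda>x. x) \<in> lborel_euc d \<rightarrow>\<^sub>M Pi\<^sub>M UNIV (\<lambda>_. borel)"
  proof (rule measurable_PiM_single')
    fix i :: nat
    show "(\<lambda>x. x i) \<in> lborel_euc d \<rightarrow>\<^sub>M borel"
    proof (cases "i < d")
      case True
      then have "(\<lambda>x. x i) \<in> lborel_euc d \<rightarrow>\<^sub>M lborel" by (intro measurable_component_singleton) simp
      then show ?thesis by simp
    next
      case False
      then have "\<And>x. x \<in> space (lborel_euc d) \<Longrightarrow> x i = undefined"
        by (auto simp: space_PiM PiE_iff extensional_def)
      then show ?thesis using measurable_cong[of "lborel_euc d" "\<lambda>x. x i" "\<lambda>_. undefined" borel] by simp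
    qed
  qed (auto simp: space_PiM)
  then have "(\<lambda>x. x) \<in> lborel_euc d \<rightarrow>\<^sub>M restrict_space borel (euc d)"
    by (intro measurable_restrict_space2)
      (auto simp: space_PiM measurable_cong_sets[OF refl sets_PiM_equal_borel])
  from measurable_compose[OF this borel_measurable_continuous_on_restrict[OF assms]]
  show ?thesis .
qed

lemma C1_euc_has_derivative_partial:
  assumes "C1_euc d f" "i < d" "x \<in> euc d"
  shows "((\<lambda>t. f (x(i := t))) has_real_derivative partial_deriv i f x) (at (x i))"
  using assms unfolding C1_euc_def partial_deriv_def
  by (simp add: DERIV_deriv_iff_real_differentiable)

text \<open>
  Partial derivatives only control moves along the axes. The coordinates are switched on one at a time
  (\<open>\<phi> y k\<close> moves the first \<open>k\<close> of them); each step is a function of two real variables, the common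
  time of the earlier coordinates and the time of the new one, and continuity of the new partial derivative
  makes it differentiable on the diagonal.
\<close>

lemma C1_euc_has_derivative_line:
  assumes f: "C1_euc d f" and x: "x \<in> euc d"
  shows "((\<lambda>t. f (\<lambda>i\<in>{..<d}. x i + t * v i)) has_real_derivative
    (\<Sum>i<d. v i * partial_deriv i f (\<lambda>i\<in>{..<d}. x i + t * v i))) (at t)"
proof -
  define \<phi> where "\<phi> y k t = (\<lambda>i\<in>{..<d}. if i < k then y i + t * v i else y i)" for y :: "nat \<Rightarrow> real" and k t
  have euc: "\<phi> y k t \<in> euc d" for y k t by (simp add: \<phi>_def)
  have "((\<lambda>t. f (\<phi> y k t)) has_real_derivative (\<Sum>i<k. v i * partial_deriv i f (\<phi> y k t))) (at t)"
    if "k \<le> d" "y \<in> euc d" for k y t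
    using that
  proof (induction k arbitrary: y t)
    case 0
    then show ?case by (simp add: \<phi>_def)
  next
    case (Suc k)
    then have k: "k < d" by simp
    define p where "p s u = \<phi> (y(k := y k + u * v k)) k s" for s u
    have p_euc: "p s u \<in> euc d" for s u by (simp add: p_def euc)
    have p_upd: "(p s u)(k := r) = (p s w)(k := r)" for s u w r
      by (auto simp: p_def \<phi>_def fun_eq_iff)
    have p_k: "p s u k = y k + u * v k" for s u using k by (simp add: p_def \<phi>_def)
    have diag: "\<phi> y (Suc k) t = p t t" for t
      using k by (auto simp: p_def \<phi>_def fun_eq_iff less_Suc_eq)
    have joint: "((\<lambda>(s, u). f (p s u)) has_derivative
        (\<lambda>(a, b). (\<Sum>i<k. v i * partial_deriv i f (p t t)) * a
          + blinfun_mult_right (v k * partial_deriv k f (p t t)) b)) (at (t, t) within UNIV \<times> UNIV)"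
    proof (rule has_derivative_partialsI[where fy = "\<lambda>s u. blinfun_mult_right (v k * partial_deriv k f (p s u))"])
      show "((\<lambda>s. f (p s t)) has_derivative (*) (\<Sum>i<k. v i * partial_deriv i f (p t t))) (at t within UNIV)"
        using Suc.IH[of "y(k := y k + t * v k)" t] Suc.prems k
        unfolding p_def has_field_derivative_def by (auto simp: PiE_iff extensional_def)
      show "((\<lambda>u. f (p s u)) has_derivative blinfun_mult_right (v k * partial_deriv k f (p s u))) (at u within UNIV)" if "s \<in> UNIV" "u \<in> UNIV" for s u
      proof -
        have "((\<lambda>r. f ((p s u)(k := r))) has_real_derivative partial_deriv k f (p s u)) (at (y k + u * v k))"
          using C1_euc_has_derivative_partial[OF f k p_euc, of s u] by (simp add: p_k)
        moreover have "((\<lambda>w. y k + w * v k) has_real_derivative v k) (at u)"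
          by (auto intro!: derivative_eq_intros)
        ultimately have "((\<lambda>w. f ((p s u)(k := y k + w * v k))) has_real_derivative
            partial_deriv k f (p s u) * v k) (at u)"
          by (rule DERIV_chain2)
        moreover have "(p s u)(k := y k + w * v k) = p s w" for w
          using p_upd[of s u "y k + w * v k" w] p_k[of s w] by (metis fun_upd_triv)
        ultimately show ?thesis
          by (simp add: has_field_derivative_def mult.commute)
      qed
      have p_cont: "continuous_on UNIV (\<lambda>z :: real \<times> real. p (fst z) (snd z))"
      proof (rule continuous_on_coordinatewise_then_product)
        fix i
        consider "i < k" | "i = k" | "k < i" "i < d" | "\<not> i < d" using k by linarith
        then show "continuous_on UNIV (\<lambda>z :: real \<times> real. p (fst z) (snd z) i)"
        proof cases
          case 1
          then have eq: "p (fst z) (snd z) i = y i + fst z * v i" for z :: "real \<times> real"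
            using k by (simp add: p_def \<phi>_def)
          show ?thesis unfolding eq by (intro continuous_intros)
        next
          case 2
          then have eq: "p (fst z) (snd z) i = y k + snd z * v k" for z :: "real \<times> real"
            using k by (simp add: p_def \<phi>_def)
          show ?thesis unfolding eq by (intro continuous_intros)
        qed (simp_all add: p_def \<phi>_def)
      qed
      have "continuous_on (euc d) (partial_deriv k f)"
        using f k by (simp add: C1_euc_def)
      from continuous_on_compose2[OF this p_cont] have "continuous_on UNIV (\<lambda>z :: real \<times> real. partial_deriv k f (p (fst z) (snd z)))"
        using p_euc by blast
      then have "continuous_on UNIV (\<lambda>z :: real \<times> real. blinfun_mult_right (v k * partial_deriv k f (p (fst z) (snd z))))"
        by (intro bounded_linear.continuous_on[OF bounded_linear_blinfun_mult_right] continuous_on_mult_left)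
      then show "continuous (at (t, t) within UNIV \<times> UNIV)
          (\<lambda>(s, u). blinfun_mult_right (v k * partial_deriv k f (p s u)))"
        by (simp add: split_beta' continuous_on_eq_continuous_at)
    qed auto
    have "((\<lambda>t. (t, t)) has_derivative (\<lambda>a. (a, a))) (at t)"
      by (intro derivative_intros)
    from has_derivative_compose[OF this, of "\<lambda>(s, u). f (p s u)"] joint
    have "((\<lambda>t. f (p t t)) has_derivative (\<lambda>a. (\<Sum>i<k. v i * partial_deriv i f (p t t)) * a
        + v k * partial_deriv k f (p t t) * a)) (at t)"
      by fastforce
    also have "(\<lambda>a. (\<Sum>i<k. v i * partial_deriv i f (p t t)) * a + v k * partial_deriv k f (p t t) * a)
      = (*) (\<Sum>i<Suc k. v i * partial_deriv i f (p t t))"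
      by (simp add: fun_eq_iff distrib_right)
    finally show ?case
      unfolding diag has_field_derivative_def .
  qed
  from this[OF order_refl x] show ?thesis
    by (simp add: \<phi>_def cong: restrict_cong)
qed

lemma edist_power2: "(edist d x y)\<^sup>2 = (\<Sum>i<d. (x i - y i)\<^sup>2)"
  by (simp add: edist_def L2_set_def sum_nonneg)

text \<open>
  Along the segment from \<open>x\<close> to \<open>y\<close> the second derivative of \<open>V\<close> is at least \<open>\<alpha> * \<bar>y - x\<bar>\<^sup>2\<close>, so
  subtracting the corresponding parabola leaves a convex function of one variable.
\<close>

lemma hessian_ge_midpoint:
  assumes V: "C2_euc d V" "hessian_ge d V \<alpha>" and x: "x \<in> euc d" "y \<in> euc d"
  shows "2 * V (\<lambda>i\<in>{..<d}. (x i + y i) / 2) \<le> V x + V y - \<alpha> / 4 * (edist d x y)\<^sup>2"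
proof -
  define v where "v = (\<lambda>i\<in>{..<d}. y i - x i)"
  define p where "p t = (\<lambda>i\<in>{..<d}. x i + t * v i)" for t
  define q where "q = (\<Sum>i<d. (v i)\<^sup>2)"
  define g where "g t = V (p t) - \<alpha> * q / 2 * t\<^sup>2" for t
  have p_euc: "p t \<in> euc d" for t by (simp add: p_def)
  have v_euc: "v \<in> euc d" by (simp add: v_def)
  have d1: "((\<lambda>t. V (p t)) has_real_derivative (\<Sum>i<d. v i * partial_deriv i V (p t))) (at t)" for t
    unfolding p_def using V x by (intro C1_euc_has_derivative_line) (auto simp: C2_euc_def)
  have d2: "((\<lambda>t. \<Sum>i<d. v i * partial_deriv i V (p t)) has_real_derivative
      (\<Sum>i<d. v i * (\<Sum>j<d. v j * partial_deriv j (partial_deriv i V) (p t)))) (at t)" for t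
    unfolding p_def using V x
    by (intro DERIV_sum DERIV_cmult C1_euc_has_derivative_line) (auto simp: C2_euc_def)
  have "convex_on UNIV g"
  proof (rule f''_ge0_imp_convex)
    show "(g has_real_derivative (\<Sum>i<d. v i * partial_deriv i V (p t)) - \<alpha> * q * t) (at t)" for t
      unfolding g_def by (rule derivative_eq_intros d1 refl | simp)+
    show "((\<lambda>t. (\<Sum>i<d. v i * partial_deriv i V (p t)) - \<alpha> * q * t) has_real_derivative
      (\<Sum>i<d. v i * (\<Sum>j<d. v j * partial_deriv j (partial_deriv i V) (p t))) - \<alpha> * q) (at t)" for t
      by (rule derivative_eq_intros d2 refl | simp)+
    fix t
    have "\<alpha> * q \<le> (\<Sum>i<d. \<Sum>j<d. v i * partial_deriv i (partial_deriv j V) (p t) * v j)"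
      using V(2) p_euc[of t] v_euc unfolding hessian_ge_def q_def by blast
    also have "\<dots> = (\<Sum>j<d. \<Sum>i<d. v i * partial_deriv i (partial_deriv j V) (p t) * v j)"
      by (rule sum.swap)
    finally show "0 \<le> (\<Sum>i<d. v i * (\<Sum>j<d. v j * partial_deriv j (partial_deriv i V) (p t))) - \<alpha> * q"
      by (simp add: sum_distrib_left ac_simps)
  qed simp
  from convex_onD[OF this, of "1/2" 0 1] have "2 * g (1/2) \<le> g 0 + g 1" by simp
  moreover have "p 0 = x" "p 1 = y" "p (1/2) = (\<lambda>i\<in>{..<d}. (x i + y i) / 2)"
    using x by (auto simp: p_def v_def fun_eq_iff PiE_iff extensional_def field_simps)
  moreover have "q = (edist d x y)\<^sup>2"
    by (simp add: q_def v_def edist_power2 power2_commute)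
  ultimately show ?thesis by (simp add: g_def power2_eq_square field_simps)
qed

section \<open>Variance and tails from a product of exponential moments\<close>

text \<open>
  Valid for all real \<open>t\<close> since the next Taylor term has even order. The quadratic bound would fail for negative
  \<open>t\<close>, which is why third moments appear below.
\<close>

lemma exp_ge_cubic:
  fixes t :: real
  shows "1 + t + t\<^sup>2 / 2 + t ^ 3 / 6 \<le> exp t"
proof -
  have "\<exists>u. \<bar>u\<bar> \<le> \<bar>t\<bar> \<and> exp t = (\<Sum>m<4. t ^ m / fact m) + (exp u / fact 4) * t ^ 4"
    by (rule Maclaurin_exp_le)
  then obtain u where u: "exp t = (\<Sum>m<4. t ^ m / fact m) + (exp u / fact 4) * t ^ 4" by blast
  have "0 \<le> (exp u / fact 4) * t ^ 4" by (intro mult_nonneg_nonneg) auto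
  with u show ?thesis by (simp add: eval_nat_numeral)
qed

context prob_space
begin

lemma mgf_product_finite:
  assumes [measurable]: "T \<in> borel_measurable M"
    and prod: "(\<integral>\<^sup>+x. ennreal (exp (a * T x)) \<partial>M) * (\<integral>\<^sup>+x. ennreal (exp (- s * T x)) \<partial>M) \<le> ennreal B"
  shows "integrable M (\<lambda>x. exp (a * T x))" "integrable M (\<lambda>x. exp (- s * T x))"
    "(\<integral>x. exp (a * T x) \<partial>M) * (\<integral>x. exp (- s * T x) \<partial>M) \<le> max 0 B"
proof -
  have pos: "(\<integral>\<^sup>+x. ennreal (exp (c * T x)) \<partial>M) \<noteq> 0" for c
  proof
    assume "(\<integral>\<^sup>+x. ennreal (exp (c * T x)) \<partial>M) = 0"
    then have "AE x in M. False" by (subst (asm) nn_integral_0_iff_AE) (auto simp: ennreal_eq_0_iff not_le)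
    then show False by simp
  qed
  have "(\<integral>\<^sup>+x. ennreal (exp (a * T x)) \<partial>M) * (\<integral>\<^sup>+x. ennreal (exp (- s * T x)) \<partial>M) < \<top>"
    using prod by (rule order.strict_trans1) simp
  then have fin: "(\<integral>\<^sup>+x. ennreal (exp (a * T x)) \<partial>M) < \<top>" "(\<integral>\<^sup>+x. ennreal (exp (- s * T x)) \<partial>M) < \<top>"
    using pos[of a] pos[of "- s"] by (auto simp: ennreal_mult_less_top)
  show int: "integrable M (\<lambda>x. exp (a * T x))" "integrable M (\<lambda>x. exp (- s * T x))"
    using fin by (auto intro!: integrableI_nonneg)
  have "ennreal ((\<integral>x. exp (a * T x) \<partial>M) * (\<integral>x. exp (- s * T x) \<partial>M)) \<le> ennreal B"
    using prod int by (subst ennreal_mult) (auto simp: nn_integral_eq_integral)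
  then show "(\<integral>x. exp (a * T x) \<partial>M) * (\<integral>x. exp (- s * T x) \<partial>M) \<le> max 0 B"
    by (cases "0 \<le> B") (auto simp: ennreal_le_iff ennreal_neg)
qed

lemma integrable_power_if_mgf_product:
  fixes T :: "'a \<Rightarrow> real"
  assumes [measurable]: "T \<in> borel_measurable M" and "0 < a" "0 < s" "k \<le> 3"
    and prod: "(\<integral>\<^sup>+x. ennreal (exp (a * T x)) \<partial>M) * (\<integral>\<^sup>+x. ennreal (exp (- s * T x)) \<partial>M) \<le> ennreal B"
  shows "integrable M (\<lambda>x. T x ^ k)"
proof (rule Bochner_Integration.integrable_bound)
  define c where "c = min a s"
  have "0 < c" using assms by (simp add: c_def)
  show "integrable M (\<lambda>x. 1 + 6 / c ^ 3 * (exp (a * T x) + exp (- s * T x)))"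
    using mgf_product_finite[OF assms(1) prod] by (intro Bochner_Integration.integrable_add integrable_mult_right) auto
  show "AE x in M. norm (T x ^ k) \<le> norm (1 + 6 / c ^ 3 * (exp (a * T x) + exp (- s * T x)))"
  proof (intro AE_I2)
    fix x
    have "c ^ 3 / 6 * \<bar>T x\<bar> ^ 3 \<le> exp (c * \<bar>T x\<bar>)"
    proof -
      have "0 \<le> c * \<bar>T x\<bar>" using \<open>0 < c\<close> by simp
      then have "(c * \<bar>T x\<bar>) ^ 3 / 6 \<le> exp (c * \<bar>T x\<bar>)"
        using exp_ge_cubic[of "c * \<bar>T x\<bar>"] zero_le_power2[of "c * \<bar>T x\<bar>"] by linarith
      then show ?thesis by (simp add: power_mult_distrib)
    qed
    also have "exp (c * \<bar>T x\<bar>) \<le> exp (a * T x) + exp (- s * T x)"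
    proof (cases "0 \<le> T x")
      case True
      then have "exp (c * \<bar>T x\<bar>) \<le> exp (a * T x)" by (auto simp: c_def intro!: mult_right_mono)
      then show ?thesis using exp_gt_zero[of "- s * T x"] by linarith
    next
      case False
      then have "exp (c * \<bar>T x\<bar>) \<le> exp (- s * T x)"
        using mult_right_mono[of c s "- T x"] by (auto simp: c_def)
      then show ?thesis using exp_gt_zero[of "a * T x"] by linarith
    qed
    finally have "\<bar>T x\<bar> ^ 3 \<le> 6 / c ^ 3 * (exp (a * T x) + exp (- s * T x))"
      using \<open>0 < c\<close> by (simp add: field_simps)
    moreover have "\<bar>T x\<bar> ^ k \<le> 1 + \<bar>T x\<bar> ^ 3"
    proof (cases "\<bar>T x\<bar> \<le> 1")
      case True then show ?thesis using power_le_one[of "\<bar>T x\<bar>" k] by (smt (verit) zero_le_power abs_ge_zero)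
    next
      case False then show ?thesis using power_increasing[OF \<open>k \<le> 3\<close>, of "\<bar>T x\<bar>"] by linarith
    qed
    ultimately have "\<bar>T x\<bar> ^ k \<le> 1 + 6 / c ^ 3 * (exp (a * T x) + exp (- s * T x))" by linarith
    then show "norm (T x ^ k) \<le> norm (1 + 6 / c ^ 3 * (exp (a * T x) + exp (- s * T x)))"
      by (simp add: power_abs)
  qed
qed measurable

lemma expectation_exp_ge_cubic:
  fixes T :: "'a \<Rightarrow> real"
  assumes "integrable M T" "integrable M (\<lambda>x. T x ^ 2)" "integrable M (\<lambda>x. T x ^ 3)"
    "integrable M (\<lambda>x. exp (c * T x))"
  shows "1 + c * (\<integral>x. T x \<partial>M) + c\<^sup>2 / 2 * (\<integral>x. (T x)\<^sup>2 \<partial>M) + c ^ 3 / 6 * (\<integral>x. T x ^ 3 \<partial>M)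
    \<le> (\<integral>x. exp (c * T x) \<partial>M)"
proof -
  have "1 + c * (\<integral>x. T x \<partial>M) + c\<^sup>2 / 2 * (\<integral>x. (T x)\<^sup>2 \<partial>M) + c ^ 3 / 6 * (\<integral>x. T x ^ 3 \<partial>M)
    = (\<integral>x. 1 + c * T x + c\<^sup>2 / 2 * (T x)\<^sup>2 + c ^ 3 / 6 * T x ^ 3 \<partial>M)"
    using assms by (simp add: prob_space)
  also have "\<dots> \<le> (\<integral>x. exp (c * T x) \<partial>M)"
    using assms exp_ge_cubic[of "c * T _"]
    by (intro integral_mono) (auto simp: power_mult_distrib)
  finally show ?thesis .
qed

text \<open>
  Both factors are bounded below by their cubic expansions. In the product the first order terms cancel
  except for \<open>s / (1 + \<kappa> * s) - s = - \<kappa> * s\<^sup>2 + O(s\<^sup>3)\<close>, which contributes \<open>- \<kappa> * E T\<close> at second order, and the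
  remaining second order term is the full variance. Using one factor alone would lose a factor of two.
\<close>

lemma variance_le_if_mgf_product:
  fixes T :: "'a \<Rightarrow> real" and B :: "real \<Rightarrow> real"
  assumes T [measurable]: "T \<in> borel_measurable M" and "0 \<le> \<kappa>"
    and prod: "\<And>s. 0 < s \<Longrightarrow> (\<integral>\<^sup>+x. ennreal (exp (s / (1 + \<kappa> * s) * T x)) \<partial>M)
        * (\<integral>\<^sup>+x. ennreal (exp (- s * T x)) \<partial>M) \<le> ennreal (B s)"
    and B: "((\<lambda>s. (B s - 1) / s\<^sup>2) \<longlongrightarrow> b) (at_right 0)"
  shows "integrable M T" "integrable M (\<lambda>x. (T x)\<^sup>2)"
    "(\<integral>x. (T x)\<^sup>2 \<partial>M) - (\<integral>x. T x \<partial>M)\<^sup>2 \<le> \<kappa> * (\<integral>x. T x \<partial>M) + b"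
proof -
  have int: "integrable M (\<lambda>x. T x ^ k)" if "k \<le> 3" for k
    using \<open>0 \<le> \<kappa>\<close> that by (intro integrable_power_if_mgf_product[OF T _ _ _ prod[of 1]]) auto
  show int1: "integrable M T" and int2: "integrable M (\<lambda>x. (T x)\<^sup>2)"
    using int[of 1] int[of 2] by simp_all
  define m1 m2 m3 where "m1 = (\<integral>x. T x \<partial>M)" and "m2 = (\<integral>x. (T x)\<^sup>2 \<partial>M)" and "m3 = (\<integral>x. T x ^ 3 \<partial>M)"
  define r where "r s = 1 / (1 + \<kappa> * s)" for s
  define u where "u s = 1 + (s * r s) * m1 + (s * r s)\<^sup>2 / 2 * m2 + (s * r s) ^ 3 / 6 * m3" for s
  define v where "v s = 1 + (- s) * m1 + (- s)\<^sup>2 / 2 * m2 + (- s) ^ 3 / 6 * m3" for s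
  have r: "(r \<longlongrightarrow> 1) (at_right 0)"
    unfolding r_def by (rule tendsto_eq_intros refl | simp)+
  have "(u \<longlongrightarrow> 1) (at_right 0)" "(v \<longlongrightarrow> 1) (at_right 0)"
    unfolding u_def v_def by (rule tendsto_eq_intros r refl | simp)+
  then have "\<forall>\<^sub>F s in at_right 0. u s > 0" "\<forall>\<^sub>F s in at_right 0. v s > 0"
    by (auto dest: order_tendstoD(1)[where a = 0])
  then have ev: "\<forall>\<^sub>F s in at_right 0. (u s * v s - 1) / s\<^sup>2 \<le> (B s - 1) / s\<^sup>2"
    using eventually_at_right_less[of 0]
  proof eventually_elim
    case (elim s)
    have eq: "s / (1 + \<kappa> * s) = s * r s" by (simp add: r_def)
    note P = prod[OF \<open>0 < s\<close>, unfolded eq]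
    note fin = mgf_product_finite[OF T P]
    have "u s \<le> (\<integral>x. exp (s * r s * T x) \<partial>M)"
      unfolding u_def m1_def m2_def m3_def using int1 int2 int[of 3] fin by (intro expectation_exp_ge_cubic) auto
    moreover have "v s \<le> (\<integral>x. exp (- s * T x) \<partial>M)"
      unfolding v_def m1_def m2_def m3_def using int1 int2 int[of 3] fin by (intro expectation_exp_ge_cubic) auto
    ultimately have "u s * v s \<le> (\<integral>x. exp (s * r s * T x) \<partial>M) * (\<integral>x. exp (- s * T x) \<partial>M)"
      using elim by (intro mult_mono) auto
    also have "\<dots> \<le> max 0 (B s)" by (rule fin)
    finally have "u s * v s \<le> max 0 (B s)" .
    moreover have "0 < u s * v s" using elim by simp
    ultimately have "u s * v s \<le> B s" by linarith
    then show ?case by (intro divide_right_mono) auto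
  qed
  have lim: "((\<lambda>s. (u s * v s - 1) / s\<^sup>2) \<longlongrightarrow> m2 - m1\<^sup>2 - \<kappa> * m1) (at_right 0)"
  proof (rule Lim_transform_eventually)
    (* The quotient written as a polynomial in \<open>s\<close> and \<open>r s\<close>, using \<open>r s - 1 = - \<kappa> s r s\<close>. *)
    let ?q = "\<lambda>s. - \<kappa> * r s * m1 + (r s)\<^sup>2 / 2 * m2 + s * (r s) ^ 3 / 6 * m3
      + m2 / 2 - s * m3 / 6 + r s * m1 * (- m1 + s * m2 / 2 - s\<^sup>2 * m3 / 6)
      + ((r s)\<^sup>2 / 2 * m2 + s * (r s) ^ 3 / 6 * m3) * (- s * m1 + s\<^sup>2 * m2 / 2 - s ^ 3 * m3 / 6)"
    show "(?q \<longlongrightarrow> m2 - m1\<^sup>2 - \<kappa> * m1) (at_right 0)"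
      by (rule tendsto_eq_intros r refl | simp add: power2_eq_square)+
    show "\<forall>\<^sub>F s in at_right 0. ?q s = (u s * v s - 1) / s\<^sup>2"
      using eventually_at_right_less[of 0]
    proof eventually_elim
      case (elim s)
      have "r s * (1 + \<kappa> * s) = 1" using elim \<open>0 \<le> \<kappa>\<close> by (simp add: r_def add_nonneg_eq_0_iff)
      then have rs: "r s = 1 - \<kappa> * s * r s" by (simp add: algebra_simps)
      have "u s * v s - 1 = s * (r s - 1) * m1 + s\<^sup>2 * (?q s + \<kappa> * r s * m1)"
        unfolding u_def v_def by (simp add: power2_eq_square power3_eq_cube field_simps)
      also have "s * (r s - 1) * m1 = s\<^sup>2 * (- \<kappa> * r s * m1)"
        by (subst (1) rs) (simp add: power2_eq_square)
      finally show ?case using elim by (simp add: field_simps)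
    qed
  qed
  show "m2 - m1\<^sup>2 \<le> \<kappa> * m1 + b"
    using tendsto_le[OF _ B lim ev] by simp
qed

text \<open>
  Jensen's inequality, through the tangent of the exponential at the mean.
\<close>

lemma expectation_exp_ge_exp_expectation:
  fixes T :: "'a \<Rightarrow> real"
  assumes "integrable M T" "integrable M (\<lambda>x. exp (c * T x))"
  shows "exp (c * (\<integral>x. T x \<partial>M)) \<le> (\<integral>x. exp (c * T x) \<partial>M)"
proof -
  let ?m = "\<integral>x. T x \<partial>M"
  have "exp (c * ?m) = (\<integral>x. exp (c * ?m) * (1 + c * (T x - ?m)) \<partial>M)"
    using assms by (simp add: prob_space)
  also have "\<dots> \<le> (\<integral>x. exp (c * T x) \<partial>M)"
  proof (rule integral_mono)
    show "exp (c * ?m) * (1 + c * (T x - ?m)) \<le> exp (c * T x)" for x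
    proof -
      have "exp (c * ?m) * (1 + c * (T x - ?m)) \<le> exp (c * ?m) * exp (c * (T x - ?m))"
        by (intro mult_left_mono exp_ge_add_one_self) auto
      then show ?thesis by (simp add: exp_add[symmetric] algebra_simps)
    qed
  qed (use assms in auto)
  finally show ?thesis .
qed

text \<open>
  Jensen's inequality bounds one factor of the product from below, hence the other factor from above by the
  exponential of the mean up to the second order term \<open>\<kappa> * s\<^sup>2 * E T\<close>. Here \<open>w\<close> plays the role of the dimension.
\<close>

lemma tail_bounds_if_mgf_product:
  fixes T :: "'a \<Rightarrow> real"
  assumes T [measurable]: "T \<in> borel_measurable M" and int: "integrable M T"
    and "0 < \<kappa>" and "0 < r" and "0 < w"
    and prod: "\<And>s. 0 < s \<Longrightarrow> (\<integral>\<^sup>+x. ennreal (exp (s / (1 + \<kappa> * s) * T x)) \<partial>M)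
        * (\<integral>\<^sup>+x. ennreal (exp (- s * T x)) \<partial>M) \<le> 1"
    and mean: "4 * (\<integral>x. T x \<partial>M) \<le> w * \<kappa>"
  defines "E \<equiv> exp (- (r\<^sup>2 / (w * \<kappa>\<^sup>2)) / (1 + 2 * r / (w * \<kappa>)))"
  shows "\<P>(x in M. T x \<ge> (\<integral>x. T x \<partial>M) + r) \<le> E"
    and "\<P>(x in M. T x \<le> (\<integral>x. T x \<partial>M) - r) \<le> E"
proof -
  define m where "m = (\<integral>x. T x \<partial>M)"
  (* The value of \<open>s\<close> that makes the mean term \<open>\<kappa> m s\<close> at most half of the deviation. *)
  define s where "s = 2 * r / (w * \<kappa>\<^sup>2)"
  define t where "t = s / (1 + \<kappa> * s)"
  have pos: "0 < s" "0 < t" using assms by (auto simp: s_def t_def intro!: divide_pos_pos mult_pos_pos add_pos_pos)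
  have "1 + \<kappa> * s > 0" using pos \<open>0 < \<kappa>\<close> by (simp add: add_pos_pos)
  then have diff: "s - t = \<kappa> * s * t" by (simp add: t_def field_simps)
  then have t_le: "t \<le> s" using mult_pos_pos[OF mult_pos_pos[OF \<open>0 < \<kappa>\<close> pos(1)] pos(2)] by linarith
  have half: "\<kappa> * s * m \<le> r / 2"
  proof -
    have "\<kappa> * s * m = (r / (w * \<kappa>)) * (2 * m)"
      using assms by (simp add: s_def power2_eq_square)
    also have "\<dots> \<le> (r / (w * \<kappa>)) * (w * \<kappa> / 2)"
      using assms by (intro mult_left_mono) (auto simp: m_def)
    also have "\<dots> = r / 2" using assms by simp
    finally show ?thesis .
  qed
  have E: "E = exp (- (t * r / 2))"
  proof -
    have "\<kappa> * s = 2 * r / (w * \<kappa>)" using assms by (simp add: s_def power2_eq_square)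
    moreover have "s * r / 2 = r\<^sup>2 / (w * \<kappa>\<^sup>2)" by (simp add: s_def power2_eq_square)
    ultimately show ?thesis unfolding E_def t_def by (metis minus_divide_left times_divide_eq_left divide_divide_eq_left mult.commute)
  qed
  have P: "(\<integral>\<^sup>+x. ennreal (exp (t * T x)) \<partial>M) * (\<integral>\<^sup>+x. ennreal (exp (- s * T x)) \<partial>M) \<le> ennreal 1"
    using prod[OF pos(1)] by (simp add: t_def)
  note fin = mgf_product_finite[OF T P]
  have up: "(\<integral>x. exp (t * T x) \<partial>M) \<le> exp (s * m)"
  proof -
    have "(\<integral>x. exp (t * T x) \<partial>M) * exp (- s * m) \<le> (\<integral>x. exp (t * T x) \<partial>M) * (\<integral>x. exp (- s * T x) \<partial>M)"
      unfolding m_def using int fin by (intro mult_left_mono expectation_exp_ge_exp_expectation) auto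
    also have "\<dots> \<le> 1" using fin(3) by simp
    finally show ?thesis by (simp add: exp_minus field_simps)
  qed
  have lo: "(\<integral>x. exp (- s * T x) \<partial>M) \<le> exp (- t * m)"
  proof -
    have "exp (t * m) * (\<integral>x. exp (- s * T x) \<partial>M) \<le> (\<integral>x. exp (t * T x) \<partial>M) * (\<integral>x. exp (- s * T x) \<partial>M)"
      unfolding m_def using int fin by (intro mult_right_mono expectation_exp_ge_exp_expectation) auto
    also have "\<dots> \<le> 1" using fin(3) by simp
    finally show ?thesis by (simp add: exp_minus field_simps)
  qed
  have "\<P>(x in M. T x \<ge> m + r) \<le> \<P>(x in M. exp (t * T x) \<ge> exp (t * (m + r)))"
    using pos by (intro finite_measure_mono) auto
  also have "\<dots> \<le> (\<integral>x. exp (t * T x) \<partial>M) / exp (t * (m + r))"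
    using fin by (intro integral_Markov_inequality_measure[where A = "{}"]) auto
  also have "\<dots> \<le> exp (s * m) / exp (t * (m + r))"
    using up by (intro divide_right_mono) auto
  also have "\<dots> = exp (t * (\<kappa> * s * m - r))"
  proof -
    have "s * m - t * (m + r) = t * (\<kappa> * s * m - r)" using diff by algebra
    then show ?thesis by (simp only: exp_diff[symmetric])
  qed
  also have "\<dots> \<le> exp (- (t * r / 2))"
  proof -
    have "t * (\<kappa> * s * m - r) \<le> t * (- r / 2)" using half pos by (intro mult_left_mono) auto
    then show ?thesis by simp
  qed
  finally show "\<P>(x in M. T x \<ge> m + r) \<le> E" unfolding E .
  have "\<P>(x in M. T x \<le> m - r) \<le> \<P>(x in M. exp (- s * T x) \<ge> exp (- s * (m - r)))"
    using pos by (intro finite_measure_mono) auto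
  also have "\<dots> \<le> (\<integral>x. exp (- s * T x) \<partial>M) / exp (- s * (m - r))"
    using fin by (intro integral_Markov_inequality_measure[where A = "{}"]) auto
  also have "\<dots> \<le> exp (- t * m) / exp (- s * (m - r))"
    using lo by (intro divide_right_mono) auto
  also have "\<dots> = exp (t * (\<kappa> * s * m) - s * r)"
  proof -
    have "- t * m - - s * (m - r) = t * (\<kappa> * s * m) - s * r" using diff by algebra
    then show ?thesis by (simp only: exp_diff[symmetric])
  qed
  also have "\<dots> \<le> exp (- (t * r / 2))"
  proof -
    have "t * (\<kappa> * s * m) \<le> t * (r / 2)" using half pos by (intro mult_left_mono) auto
    moreover have "t * r \<le> s * r" using t_le \<open>0 < r\<close> by (intro mult_right_mono) auto
    ultimately show ?thesis by (simp add: algebra_simps)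
  qed
  finally show "\<P>(x in M. T x \<le> m - r) \<le> E" unfolding E .
qed

end

text \<open>
  Supplies the limit hypothesis of \<open>variance_le_if_mgf_product\<close> for bounds of the form \<open>G (s\<^sup>2 / (1 + \<kappa> * s))\<close>.
\<close>

lemma tendsto_second_order_quotient:
  fixes G :: "real \<Rightarrow> real"
  assumes "(G has_real_derivative D) (at 0)" "G 0 = 1" "0 \<le> \<kappa>"
  shows "((\<lambda>s. (G (s\<^sup>2 / (1 + \<kappa> * s)) - 1) / s\<^sup>2) \<longlongrightarrow> D) (at_right 0)"
proof -
  let ?h = "\<lambda>s. s\<^sup>2 / (1 + \<kappa> * s)"
  have pos: "\<forall>\<^sub>F s in at_right 0. 0 < ?h s"
    using eventually_at_right_less[of 0]
    by eventually_elim (use \<open>0 \<le> \<kappa>\<close> in \<open>auto intro!: divide_pos_pos add_pos_nonneg\<close>)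
  have "(?h \<longlongrightarrow> 0) (at_right 0)"
    by (rule tendsto_eq_intros refl | simp)+
  then have h: "filterlim ?h (at 0) (at_right 0)"
    unfolding filterlim_at using pos by (auto elim!: eventually_mono)
  have "((\<lambda>h. (G (0 + h) - G 0) / h) \<longlongrightarrow> D) (at 0)"
    using assms(1) by (simp add: DERIV_def)
  from filterlim_compose[OF this h]
  have lim: "((\<lambda>s. (G (?h s) - 1) / ?h s) \<longlongrightarrow> D) (at_right 0)" by (simp add: \<open>G 0 = 1\<close>)
  have "((\<lambda>s. 1 / (1 + \<kappa> * s)) \<longlongrightarrow> 1) (at_right 0)"
    by (rule tendsto_eq_intros refl | simp)+
  from tendsto_mult[OF lim this] have "((\<lambda>s. (G (?h s) - 1) / ?h s * (1 / (1 + \<kappa> * s))) \<longlongrightarrow> D) (at_right 0)"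
    by simp
  then show ?thesis
  proof (rule Lim_transform_eventually)
    show "\<forall>\<^sub>F s in at_right 0. (G (?h s) - 1) / ?h s * (1 / (1 + \<kappa> * s)) = (G (?h s) - 1) / s\<^sup>2"
      using eventually_at_right_less[of 0]
    proof eventually_elim
      case (elim s)
      have "0 < 1 + \<kappa> * s" using elim \<open>0 \<le> \<kappa>\<close> by (intro add_pos_nonneg) auto
      then show ?case by simp
    qed
  qed
qed

section \<open>Strongly log-concave signals\<close>

lemma edist_measurable [measurable]: "(\<lambda>x. edist d x c) \<in> borel_measurable (lborel_euc d)"
  unfolding edist_def L2_set_def by measurable

lemma SLC_densityE:
  assumes "P \<in> SLC d \<alpha>"
  obtains V where "C2_euc d V" "hessian_ge d V \<alpha>"
    "P = density (lborel_euc d) (\<lambda>x. ennreal (exp (- V x) / (\<integral>x. exp (- V x) \<partial>lborel_euc d)))"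
  using assms unfolding SLC_def Let_def by blast

lemma prob_space_SLC: "P \<in> SLC d \<alpha> \<Longrightarrow> prob_space P"
  unfolding SLC_def by blast

lemma sets_SLC: "P \<in> SLC d \<alpha> \<Longrightarrow> sets P = sets (lborel_euc d)"
  by (metis SLC_densityE sets_density)

text \<open>
  Prekopa-Leindler for \<open>p * exp \<phi>\<close>, \<open>p * exp (- \<psi>)\<close> and \<open>p\<close>: the strong midpoint convexity of the potential
  leaves room for the gain \<open>\<alpha> / 4 * \<bar>x - y\<bar>\<^sup>2\<close>, and the right-hand side is the squared total mass.
\<close>

lemma SLC_exp_inf_convolution:
  assumes P: "P \<in> SLC d \<alpha>"
    and [measurable]: "\<phi> \<in> borel_measurable (lborel_euc d)" "\<psi> \<in> borel_measurable (lborel_euc d)"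
    and le: "\<And>x y. x \<in> euc d \<Longrightarrow> y \<in> euc d \<Longrightarrow> \<phi> x - \<psi> y \<le> \<alpha> / 4 * (edist d x y)\<^sup>2"
  shows "(\<integral>\<^sup>+x. ennreal (exp (\<phi> x)) \<partial>P) * (\<integral>\<^sup>+x. ennreal (exp (- \<psi> x)) \<partial>P) \<le> 1"
proof -
  obtain V where V: "C2_euc d V" "hessian_ge d V \<alpha>"
    and dens: "P = density (lborel_euc d) (\<lambda>x. ennreal (exp (- V x) / (\<integral>x. exp (- V x) \<partial>lborel_euc d)))"
    using P by (rule SLC_densityE)
  define Z where "Z = (\<integral>x. exp (- V x) \<partial>lborel_euc d)"
  have "0 \<le> Z" by (simp add: Z_def)
  have [measurable]: "V \<in> borel_measurable (lborel_euc d)"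
    using V(1) by (intro continuous_on_euc_measurable) (simp add: C2_euc_def C1_euc_def)
  define p where "p x = ennreal (exp (- V x) / Z)" for x
  have [measurable]: "p \<in> borel_measurable (lborel_euc d)" unfolding p_def by measurable
  have P_eq: "P = density (lborel_euc d) p" unfolding p_def[abs_def] Z_def by (rule dens)
  interpret prob_space P by (rule prob_space_SLC[OF P])
  have int: "(\<integral>\<^sup>+x. f x \<partial>P) = (\<integral>\<^sup>+x. p x * f x \<partial>lborel_euc d)"
    if "f \<in> borel_measurable (lborel_euc d)" for f
    unfolding P_eq using that by (intro nn_integral_density) auto
  have mass: "(\<integral>\<^sup>+x. p x \<partial>lborel_euc d) = 1"
    using int[of "\<lambda>_. 1"] emeasure_space_1 by simp
  have "(\<integral>\<^sup>+x. p x * ennreal (exp (\<phi> x)) \<partial>lborel_euc d) * (\<integral>\<^sup>+x. p x * ennreal (exp (- \<psi> x)) \<partial>lborel_euc d)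
    \<le> (\<integral>\<^sup>+x. p x \<partial>lborel_euc d)\<^sup>2"
  proof (rule prekopa_leindler)
    fix x y assume xy: "x \<in> euc d" "y \<in> euc d"
    let ?m = "\<lambda>i\<in>{..<d}. (x i + y i) / 2"
    have "(p x * ennreal (exp (\<phi> x))) * (p y * ennreal (exp (- \<psi> y)))
      = ennreal (exp (\<phi> x - \<psi> y - V x - V y) / Z\<^sup>2)"
    proof -
      have "exp (- V x) / Z * exp (\<phi> x) * (exp (- V y) / Z * exp (- \<psi> y))
        = (exp (- V x) * exp (\<phi> x) * exp (- V y) * exp (- \<psi> y)) / Z\<^sup>2"
        by (simp add: power2_eq_square)
      also have "exp (- V x) * exp (\<phi> x) * exp (- V y) * exp (- \<psi> y) = exp (\<phi> x - \<psi> y - V x - V y)"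
        unfolding exp_add[symmetric] by (rule arg_cong[where f = exp]) simp
      finally show ?thesis using \<open>0 \<le> Z\<close> by (simp add: p_def ennreal_mult[symmetric])
    qed
    also have "\<dots> \<le> ennreal (exp (2 * - V ?m) / Z\<^sup>2)"
      using hessian_ge_midpoint[OF V xy] le[OF xy]
      by (intro ennreal_leI divide_right_mono) auto
    also have "exp (2 * - V ?m) / Z\<^sup>2 = (exp (- V ?m) / Z)\<^sup>2"
      by (simp only: exp_double power_divide)
    also have "ennreal \<dots> = (p ?m)\<^sup>2"
      using \<open>0 \<le> Z\<close> by (simp add: p_def ennreal_power)
    finally show "(p x * ennreal (exp (\<phi> x))) * (p y * ennreal (exp (- \<psi> y))) \<le> (p ?m)\<^sup>2" .
  qed measurable
  then show ?thesis by (simp add: int mass)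
qed

text \<open>
  The inf-convolution of a quadratic with the quadratic cost is again quadratic, with an explicit coefficient.
\<close>

lemma SLC_mgf_sq_norm:
  assumes P: "P \<in> SLC d \<alpha>" and "0 < \<alpha>" "0 < s"
  shows "(\<integral>\<^sup>+x. ennreal (exp (s / (1 + 4 / \<alpha> * s) * (edist d x c)\<^sup>2)) \<partial>P)
    * (\<integral>\<^sup>+x. ennreal (exp (- s * (edist d x c)\<^sup>2)) \<partial>P) \<le> 1"
proof -
  define t where "t = s / (1 + 4 / \<alpha> * s)"
  have pos: "0 < 4 * s + \<alpha>" using assms by simp
  have t: "t = s * \<alpha> / (4 * s + \<alpha>)" using assms by (simp add: t_def field_simps)
  (* Up to a positive factor the difference of the two sides is a square, which vanishes at the
     minimizer \<open>b = \<alpha> * a / (4 * s + \<alpha>)\<close>. *)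
  have coord: "t * a\<^sup>2 - s * b\<^sup>2 \<le> \<alpha> / 4 * (a - b)\<^sup>2" for a b :: real
  proof -
    have "(4 * s + \<alpha>) * (\<alpha> / 4 * (a - b)\<^sup>2 + s * b\<^sup>2 - t * a\<^sup>2) = (4 * s + \<alpha>) * (\<alpha> / 4 * (a - b)\<^sup>2 + s * b\<^sup>2) - s * \<alpha> * a\<^sup>2"
      using pos by (simp add: t right_diff_distrib)
    also have "\<dots> = ((4 * s + \<alpha>) * b - \<alpha> * a)\<^sup>2 / 4"
      by (simp add: power2_eq_square field_simps)
    finally have "(4 * s + \<alpha>) * (\<alpha> / 4 * (a - b)\<^sup>2 + s * b\<^sup>2 - t * a\<^sup>2) \<ge> 0"
      by (metis divide_nonneg_pos zero_le_power2 zero_less_numeral)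
    then have "\<alpha> / 4 * (a - b)\<^sup>2 + s * b\<^sup>2 - t * a\<^sup>2 \<ge> 0" using pos by (metis not_less zero_le_mult_iff)
    then show ?thesis by simp
  qed
  have "t * (edist d x c)\<^sup>2 - s * (edist d y c)\<^sup>2 \<le> \<alpha> / 4 * (edist d x y)\<^sup>2" for x y
  proof -
    have "t * (edist d x c)\<^sup>2 - s * (edist d y c)\<^sup>2 = (\<Sum>i<d. t * (x i - c i)\<^sup>2 - s * (y i - c i)\<^sup>2)"
      by (simp add: edist_power2 sum_subtractf sum_distrib_left)
    also have "\<dots> \<le> (\<Sum>i<d. \<alpha> / 4 * ((x i - c i) - (y i - c i))\<^sup>2)"
      by (intro sum_mono coord)
    finally show ?thesis by (simp add: edist_power2 sum_distrib_left)
  qed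
  from SLC_exp_inf_convolution[OF P _ _ this] show ?thesis by (simp add: t_def)
qed

text \<open>
  The inf-convolution of a linear function with the quadratic cost is the function shifted by \<open>s\<^sup>2 / \<alpha>\<close>.
\<close>

lemma SLC_mgf_coordinate:
  assumes P: "P \<in> SLC d \<alpha>" and "0 < \<alpha>" "i < d"
  shows "(\<integral>\<^sup>+x. ennreal (exp (s * x i)) \<partial>P) * (\<integral>\<^sup>+x. ennreal (exp (- s * x i)) \<partial>P) \<le> ennreal (exp (1 / \<alpha> * s\<^sup>2))"
proof -
  have [measurable]: "(\<lambda>x. x i) \<in> borel_measurable (lborel_euc d)"
    using measurable_component_singleton[of i "{..<d}" "\<lambda>_. lborel :: real measure"] \<open>i < d\<close> by simp
  have coord: "s * a - s\<^sup>2 / \<alpha> \<le> \<alpha> / 4 * a\<^sup>2" for a :: real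
  proof -
    have "0 \<le> (\<alpha> * a / 2 - s)\<^sup>2 / \<alpha>" using \<open>0 < \<alpha>\<close> by simp
    also have "\<dots> = \<alpha> / 4 * a\<^sup>2 - s * a + s\<^sup>2 / \<alpha>"
      using \<open>0 < \<alpha>\<close> by (simp add: power2_eq_square field_simps)
    finally show ?thesis by simp
  qed
  have "s * x i - s\<^sup>2 / \<alpha> - s * y i \<le> \<alpha> / 4 * (edist d x y)\<^sup>2" for x y
  proof -
    have "(x i - y i)\<^sup>2 \<le> (edist d x y)\<^sup>2"
      unfolding edist_power2 using \<open>i < d\<close> member_le_sum[of i "{..<d}" "\<lambda>i. (x i - y i)\<^sup>2"] by simp
    then have "\<alpha> / 4 * (x i - y i)\<^sup>2 \<le> \<alpha> / 4 * (edist d x y)\<^sup>2"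
      using \<open>0 < \<alpha>\<close> by (intro mult_left_mono) auto
    then show ?thesis using coord[of "x i - y i"] by (simp add: algebra_simps)
  qed
  from SLC_exp_inf_convolution[OF P _ _ this]
  have "(\<integral>\<^sup>+x. ennreal (exp (s * x i - s\<^sup>2 / \<alpha>)) \<partial>P) * (\<integral>\<^sup>+x. ennreal (exp (- s * x i)) \<partial>P) \<le> 1"
    by simp
  then have "ennreal (exp (s\<^sup>2 / \<alpha>)) * ((\<integral>\<^sup>+x. ennreal (exp (s * x i - s\<^sup>2 / \<alpha>)) \<partial>P) * (\<integral>\<^sup>+x. ennreal (exp (- s * x i)) \<partial>P))
    \<le> ennreal (exp (s\<^sup>2 / \<alpha>)) * 1"
    by (rule mult_left_mono) simp
  also have "ennreal (exp (s\<^sup>2 / \<alpha>)) * ((\<integral>\<^sup>+x. ennreal (exp (s * x i - s\<^sup>2 / \<alpha>)) \<partial>P) * (\<integral>\<^sup>+x. ennreal (exp (- s * x i)) \<partial>P))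
    = (\<integral>\<^sup>+x. ennreal (exp (s\<^sup>2 / \<alpha>)) * ennreal (exp (s * x i - s\<^sup>2 / \<alpha>)) \<partial>P) * (\<integral>\<^sup>+x. ennreal (exp (- s * x i)) \<partial>P)"
    by (subst nn_integral_cmult) (auto simp: mult.assoc measurable_cong_sets[OF sets_SLC[OF P] refl])
  also have "(\<lambda>x. ennreal (exp (s\<^sup>2 / \<alpha>)) * ennreal (exp (s * x i - s\<^sup>2 / \<alpha>))) = (\<lambda>x. ennreal (exp (s * x i)))"
    by (simp add: ennreal_mult[symmetric] exp_add[symmetric])
  finally show ?thesis by simp
qed

text \<open>
  The case \<open>\<kappa> = 0\<close> of \<open>variance_le_if_mgf_product\<close>.
\<close>

lemma SLC_coordinate_variance:
  assumes P: "P \<in> SLC d \<alpha>" and "0 < \<alpha>" "i < d"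
  shows "integrable P (\<lambda>x. (x i - mean_vec d P i)\<^sup>2)"
    and "(\<integral>x. (x i - mean_vec d P i)\<^sup>2 \<partial>P) \<le> 1 / \<alpha>"
proof -
  interpret prob_space P by (rule prob_space_SLC[OF P])
  have meas: "(\<lambda>x. x i) \<in> borel_measurable P"
    using measurable_component_singleton[of i "{..<d}" "\<lambda>_. lborel :: real measure"] \<open>i < d\<close>
    by (simp add: measurable_cong_sets[OF sets_SLC[OF P] refl])
  have "((\<lambda>h. exp (1 / \<alpha> * h)) has_real_derivative 1 / \<alpha>) (at 0)"
    by (rule derivative_eq_intros refl | simp)+
  from tendsto_second_order_quotient[OF this, of 0]
  have lim: "((\<lambda>s. (exp (1 / \<alpha> * s\<^sup>2) - 1) / s\<^sup>2) \<longlongrightarrow> 1 / \<alpha>) (at_right 0)" by simp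
  have bound: "(\<integral>\<^sup>+x. ennreal (exp (s / (1 + 0 * s) * x i)) \<partial>P) * (\<integral>\<^sup>+x. ennreal (exp (- s * x i)) \<partial>P)
    \<le> ennreal (exp (1 / \<alpha> * s\<^sup>2))" for s
    using SLC_mgf_coordinate[OF assms, of s] by simp
  note var = variance_le_if_mgf_product[OF meas order_refl bound lim]
  have mu: "mean_vec d P i = expectation (\<lambda>x. x i)" using \<open>i < d\<close> by (simp add: mean_vec_def)
  show "integrable P (\<lambda>x. (x i - mean_vec d P i)\<^sup>2)"
    using var(1,2) by (simp add: power2_diff)
  show "(\<integral>x. (x i - mean_vec d P i)\<^sup>2 \<partial>P) \<le> 1 / \<alpha>"
    unfolding mu using var by (subst variance_eq) auto
qed

lemma SLC_centered_second_moment: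
  assumes P: "P \<in> SLC d \<alpha>" and "0 < \<alpha>"
  shows "integrable P (\<lambda>x. (edist d x (mean_vec d P))\<^sup>2)"
    and "(\<integral>x. (edist d x (mean_vec d P))\<^sup>2 \<partial>P) \<le> real d / \<alpha>"
proof -
  note var = SLC_coordinate_variance[OF assms]
  show "integrable P (\<lambda>x. (edist d x (mean_vec d P))\<^sup>2)"
    unfolding edist_power2 using var(1) by (intro Bochner_Integration.integrable_sum) auto
  have "(\<integral>x. (edist d x (mean_vec d P))\<^sup>2 \<partial>P) = (\<Sum>i<d. \<integral>x. (x i - mean_vec d P i)\<^sup>2 \<partial>P)"
    unfolding edist_power2 using var(1) by (intro Bochner_Integration.integral_sum) auto
  also have "\<dots> \<le> (\<Sum>i<d. 1 / \<alpha>)" using var(2) by (intro sum_mono) auto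
  finally show "(\<integral>x. (edist d x (mean_vec d P))\<^sup>2 \<partial>P) \<le> real d / \<alpha>" by simp
qed

section \<open>The law of the observation\<close>

text \<open>
  Both measures agree on boxes.
\<close>

lemma density_prod_eq_PiM:
  fixes g :: "nat \<Rightarrow> real \<Rightarrow> real"
  assumes g [measurable]: "\<And>i. g i \<in> borel_measurable borel" and pos: "\<And>i t. 0 \<le> g i t"
    and prob: "\<And>i. prob_space (density lborel (g i))"
  shows "density (lborel_euc d) (\<lambda>y. ennreal (\<Prod>i<d. g i (y i))) = Pi\<^sub>M {..<d} (\<lambda>i. density lborel (g i))"
proof -
  interpret L: product_sigma_finite "\<lambda>_::nat. lborel :: real measure" ..
  interpret G: product_sigma_finite "\<lambda>i. density lborel (g i)"
    using prob by (auto simp: product_sigma_finite_def intro: prob_space_imp_sigma_finite)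
  show ?thesis
  proof (rule G.PiM_eqI)
    show "sets (density (lborel_euc d) (\<lambda>y. ennreal (\<Prod>i<d. g i (y i)))) = sets (Pi\<^sub>M {..<d} (\<lambda>i. density lborel (g i)))"
      by (simp cong: sets_PiM_cong)
    fix A :: "nat \<Rightarrow> real set" assume A: "\<And>i. i \<in> {..<d} \<Longrightarrow> A i \<in> sets (density lborel (g i))"
    then have [measurable]: "A i \<in> sets borel" if "i < d" for i using that by simp
    have box: "Pi\<^sub>E {..<d} A \<in> sets (lborel_euc d)" by (intro sets_PiM_I_finite) auto
    have "emeasure (density (lborel_euc d) (\<lambda>y. ennreal (\<Prod>i<d. g i (y i)))) (Pi\<^sub>E {..<d} A)
      = (\<integral>\<^sup>+y. ennreal (\<Prod>i<d. g i (y i)) * indicator (Pi\<^sub>E {..<d} A) y \<partial>lborel_euc d)"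
      using box by (intro emeasure_density) auto
    also have "\<dots> = (\<integral>\<^sup>+y. (\<Prod>i<d. ennreal (g i (y i)) * indicator (A i) (y i)) \<partial>lborel_euc d)"
    proof (intro nn_integral_cong)
      fix y assume "y \<in> space (lborel_euc d)"
      then have "indicator (Pi\<^sub>E {..<d} A) y = (\<Prod>i<d. indicator (A i) (y i) :: ennreal)"
        by (cases "y \<in> Pi\<^sub>E {..<d} A") (auto simp: space_PiM PiE_iff intro!: prod_zero bexI)
      then show "ennreal (\<Prod>i<d. g i (y i)) * indicator (Pi\<^sub>E {..<d} A) y
        = (\<Prod>i<d. ennreal (g i (y i)) * indicator (A i) (y i))"
        by (simp add: prod.distrib prod_ennreal pos)
    qed
    also have "\<dots> = (\<Prod>i<d. \<integral>\<^sup>+t. ennreal (g i t) * indicator (A i) t \<partial>lborel)"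
      by (intro L.product_nn_integral_prod) auto
    also have "\<dots> = (\<Prod>i<d. emeasure (density lborel (g i)) (A i))"
      by (intro prod.cong refl emeasure_density[symmetric]) auto
    finally show "emeasure (density (lborel_euc d) (\<lambda>y. ennreal (\<Prod>i<d. g i (y i)))) (Pi\<^sub>E {..<d} A)
      = (\<Prod>i\<in>{..<d}. emeasure (density lborel (g i)) (A i))" .
  qed simp
qed

abbreviation gauss1 :: "real measure" where
  "gauss1 \<equiv> density lborel (\<lambda>t. ennreal (std_normal_density t))"

lemma prob_space_gauss1: "prob_space gauss1"
  using prob_space_normal_density[of 1 0] by simp

lemma product_sigma_finite_gauss1: "product_sigma_finite (\<lambda>_::nat. gauss1)"
  by (simp add: product_sigma_finite_def prob_space_imp_sigma_finite prob_space_gauss1)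

lemma prob_space_std_gauss: "prob_space (std_gauss d)"
  unfolding std_gauss_def by (intro prob_space_PiM prob_space_gauss1)

lemma sets_std_gauss: "sets (std_gauss d) = sets (lborel_euc d)"
  unfolding std_gauss_def by (intro sets_PiM_cong) auto

lemma space_std_gauss: "space (std_gauss d) = euc d"
  by (simp add: std_gauss_def space_PiM)

lemma obs_map_measurable:
  assumes "sets P = sets (lborel_euc d)"
  shows "(\<lambda>(x, z). \<lambda>i\<in>{..<d}. x i + \<sigma> * z i) \<in> P \<Otimes>\<^sub>M std_gauss d \<rightarrow>\<^sub>M lborel_euc d"
proof -
  have [measurable_cong]: "sets P = sets (lborel_euc d)" "sets (std_gauss d) = sets (lborel_euc d)"
    using assms sets_std_gauss by auto
  show ?thesis unfolding split_beta' by measurable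
qed

lemma sets_obs_law [simp]: "sets (obs_law d P l) = sets (lborel_euc d)"
  and space_obs_law [simp]: "space (obs_law d P l) = euc d"
  by (simp_all add: obs_law_def space_PiM)

lemma prob_space_obs_law:
  assumes "prob_space P" "sets P = sets (lborel_euc d)"
  shows "prob_space (obs_law d P l)"
proof -
  interpret X: prob_space P by fact
  interpret G: prob_space "std_gauss d" by (rule prob_space_std_gauss)
  interpret XG: pair_prob_space P "std_gauss d" ..
  show ?thesis unfolding obs_law_def
    by (rule XG.prob_space_distr[OF obs_map_measurable[OF assms(2)]])
qed

lemma nn_integral_obs_law:
  assumes "prob_space P" "sets P = sets (lborel_euc d)" and f: "f \<in> borel_measurable (lborel_euc d)"
  shows "(\<integral>\<^sup>+y. f y \<partial>obs_law d P l)
    = (\<integral>\<^sup>+x. (\<integral>\<^sup>+z. f (\<lambda>i\<in>{..<d}. x i + l powr (- 1 / 2) * z i) \<partial>std_gauss d) \<partial>P)"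
proof -
  interpret G: prob_space "std_gauss d" by (rule prob_space_std_gauss)
  note m = obs_map_measurable[OF assms(2), of "l powr (- 1 / 2)"]
  show ?thesis
    unfolding obs_law_def
    by (subst nn_integral_distr[OF m], use f in simp, subst G.nn_integral_fst[symmetric]) (use measurable_compose[OF m f] in \<open>auto simp: split_beta'\<close>)
qed

lemma nn_integral_shifted_std_gauss:
  assumes "0 < \<sigma>" and f: "f \<in> borel_measurable (lborel_euc d)"
  shows "(\<integral>\<^sup>+z. f (\<lambda>i\<in>{..<d}. x i + \<sigma> * z i) \<partial>std_gauss d)
    = (\<integral>\<^sup>+y. ennreal (\<Prod>i<d. normal_density (x i) \<sigma> (y i)) * f y \<partial>lborel_euc d)"
proof -
  let ?T = "\<lambda>z. \<lambda>i\<in>{..<d}. x i + \<sigma> * z i"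
  let ?N = "\<lambda>i. density lborel (\<lambda>t. ennreal (normal_density (x i) \<sigma> t))"
  interpret g: prob_space gauss1 by (rule prob_space_gauss1)
  interpret G: product_sigma_finite "\<lambda>_::nat. gauss1" by (rule product_sigma_finite_gauss1)
  interpret N: product_sigma_finite ?N
    using \<open>0 < \<sigma>\<close> by (auto simp: product_sigma_finite_def intro: prob_space_imp_sigma_finite prob_space_normal_density)
  have T: "?T \<in> std_gauss d \<rightarrow>\<^sub>M lborel_euc d"
  proof -
    have [measurable_cong]: "sets (std_gauss d) = sets (lborel_euc d)" by (rule sets_std_gauss)
    show ?thesis by measurable
  qed
  have one: "distr gauss1 lborel (\<lambda>t. x i + \<sigma> * t) = ?N i" for i
  proof -
    have "distributed gauss1 lborel (\<lambda>t. t) std_normal_density"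
      by (auto simp: distributed_def distr_id2)
    from g.normal_density_affine[OF this, of \<sigma> "x i"]
    have "distributed gauss1 lborel (\<lambda>t. x i + \<sigma> * t) (normal_density (x i) \<sigma>)"
      using \<open>0 < \<sigma>\<close> by simp
    then show ?thesis by (simp add: distributed_def)
  qed
  have "distr (std_gauss d) (lborel_euc d) ?T = Pi\<^sub>M {..<d} ?N"
  proof (rule N.PiM_eqI)
    show "sets (distr (std_gauss d) (lborel_euc d) ?T) = sets (Pi\<^sub>M {..<d} ?N)"
      by (simp cong: sets_PiM_cong)
    fix A :: "nat \<Rightarrow> real set" assume *: "\<And>i. i \<in> {..<d} \<Longrightarrow> A i \<in> sets (?N i)"
    have A: "A i \<in> sets borel" if "i < d" for i using *[of i] that by simp
    have box: "Pi\<^sub>E {..<d} A \<in> sets (lborel_euc d)" using A by (intro sets_PiM_I_finite) auto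
    have "emeasure (distr (std_gauss d) (lborel_euc d) ?T) (Pi\<^sub>E {..<d} A)
      = emeasure (std_gauss d) (?T -` Pi\<^sub>E {..<d} A \<inter> space (std_gauss d))"
      using T box by (rule emeasure_distr)
    also have "?T -` Pi\<^sub>E {..<d} A \<inter> space (std_gauss d)
      = Pi\<^sub>E {..<d} (\<lambda>i. (\<lambda>t. x i + \<sigma> * t) -` A i)"
      by (auto simp: space_std_gauss PiE_iff)
    also have "emeasure (std_gauss d) \<dots> = (\<Prod>i<d. emeasure gauss1 ((\<lambda>t. x i + \<sigma> * t) -` A i))"
      unfolding std_gauss_def
    proof (intro G.emeasure_PiM)
      fix i assume "i \<in> {..<d}"
      then have "A i \<in> sets borel" using A by simp
      then have "(\<lambda>t. x i + \<sigma> * t) -` A i \<inter> space borel \<in> sets borel"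
        by (rule measurable_sets[rotated]) simp
      then show "(\<lambda>t. x i + \<sigma> * t) -` A i \<in> sets gauss1" by simp
    qed simp
    also have "\<dots> = (\<Prod>i<d. emeasure (distr gauss1 lborel (\<lambda>t. x i + \<sigma> * t)) (A i))"
    proof (intro prod.cong refl)
      fix i assume "i \<in> {..<d}"
      then have "A i \<in> sets lborel" using A by simp
      then show "emeasure gauss1 ((\<lambda>t. x i + \<sigma> * t) -` A i) = emeasure (distr gauss1 lborel (\<lambda>t. x i + \<sigma> * t)) (A i)"
        by (subst emeasure_distr) auto
    qed
    finally show "emeasure (distr (std_gauss d) (lborel_euc d) ?T) (Pi\<^sub>E {..<d} A)
      = (\<Prod>i\<in>{..<d}. emeasure (?N i) (A i))" by (simp only: one)
  qed simp
  also have "\<dots> = density (lborel_euc d) (\<lambda>y. ennreal (\<Prod>i<d. normal_density (x i) \<sigma> (y i)))"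
    using \<open>0 < \<sigma>\<close> by (intro density_prod_eq_PiM[symmetric] prob_space_normal_density) (auto simp: normal_density_nonneg)
  finally have law: "distr (std_gauss d) (lborel_euc d) ?T
    = density (lborel_euc d) (\<lambda>y. ennreal (\<Prod>i<d. normal_density (x i) \<sigma> (y i)))" .
  have "(\<integral>\<^sup>+z. f (?T z) \<partial>std_gauss d) = (\<integral>\<^sup>+y. f y \<partial>distr (std_gauss d) (lborel_euc d) ?T)"
    using f by (subst nn_integral_distr[OF T]) auto
  also have "\<dots> = (\<integral>\<^sup>+y. ennreal (\<Prod>i<d. normal_density (x i) \<sigma> (y i)) * f y \<partial>lborel_euc d)"
    unfolding law using f by (intro nn_integral_density) auto
  finally show ?thesis .
qed

lemma prod_normal_density:
  assumes "0 < l"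
  shows "(\<Prod>i<d. normal_density (x i) (l powr (- 1 / 2)) (y i))
    = (l / (2 * pi)) powr (real d / 2) * exp (- (l / 2) * (edist d x y)\<^sup>2)"
proof -
  have sq: "(l powr (- 1 / 2))\<^sup>2 = 1 / l"
    using assms by (simp add: powr_minus_divide powr_half_sqrt power_divide)
  have one: "normal_density (x i) (l powr (- 1 / 2)) (y i)
    = (l / (2 * pi)) powr (1 / 2) * exp (- (l / 2) * (x i - y i)\<^sup>2)" for i
    unfolding normal_density_def sq using assms
    by (simp add: powr_half_sqrt real_sqrt_divide power2_commute field_simps)
  have "(\<Prod>i<d. normal_density (x i) (l powr (- 1 / 2)) (y i))
    = ((l / (2 * pi)) powr (1 / 2)) ^ d * exp (\<Sum>i<d. - (l / 2) * (x i - y i)\<^sup>2)"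
    unfolding one prod.distrib by (simp add: exp_sum)
  also have "((l / (2 * pi)) powr (1 / 2)) ^ d = (l / (2 * pi)) powr (real d / 2)"
    using assms by (simp add: powr_power)
  finally show ?thesis by (simp add: edist_power2 sum_distrib_left)
qed

text \<open>
  The density of the model as a mixture of normal densities, the form in which Fubini's theorem applies.
\<close>

lemma obs_density_eq_nn_integral:
  assumes "prob_space P" "sets P = sets (lborel_euc d)" "0 < l"
  shows "ennreal (obs_density d P l y) = (\<integral>\<^sup>+x. ennreal (\<Prod>i<d. normal_density (x i) (l powr (- 1 / 2)) (y i)) \<partial>P)"
proof -
  interpret prob_space P by fact
  have [measurable_cong]: "sets P = sets (lborel_euc d)" by fact
  have int: "integrable P (\<lambda>x. exp (- (l / 2) * (edist d x y)\<^sup>2))"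
    using \<open>0 < l\<close> by (intro integrable_const_bound[where B = 1]) auto
  have "(\<integral>\<^sup>+x. ennreal (\<Prod>i<d. normal_density (x i) (l powr (- 1 / 2)) (y i)) \<partial>P)
    = ennreal (\<integral>x. (l / (2 * pi)) powr (real d / 2) * exp (- (l / 2) * (edist d x y)\<^sup>2) \<partial>P)"
    unfolding prod_normal_density[OF \<open>0 < l\<close>] using int by (intro nn_integral_eq_integral) auto
  then show ?thesis by (simp add: obs_density_def)
qed

lemma obs_density_pos:
  assumes "prob_space P" "sets P = sets (lborel_euc d)" "0 < l"
  shows "0 < obs_density d P l y"
proof -
  interpret prob_space P by fact
  have [measurable_cong]: "sets P = sets (lborel_euc d)" by fact
  have int: "integrable P (\<lambda>x. exp (- (l / 2) * (edist d x y)\<^sup>2))"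
    using \<open>0 < l\<close> by (intro integrable_const_bound[where B = 1]) auto
  have "(\<integral>x. 0 \<partial>P) < (\<integral>x. exp (- (l / 2) * (edist d x y)\<^sup>2) \<partial>P)"
    by (intro integral_less_AE_space) (use int in \<open>auto simp: emeasure_space_1\<close>)
  then show ?thesis using \<open>0 < l\<close> by (simp add: obs_density_def)
qed

lemma obs_density_measurable:
  assumes "prob_space P" "sets P = sets (lborel_euc d)"
  shows "obs_density d P l \<in> borel_measurable (lborel_euc d)"
proof -
  interpret prob_space P by fact
  have [measurable_cong]: "sets P = sets (lborel_euc d)" by fact
  have [measurable]: "(\<lambda>(y, x). edist d x y) \<in> borel_measurable (lborel_euc d \<Otimes>\<^sub>M P)"
    unfolding edist_def L2_set_def split_beta' by measurable
  show ?thesis unfolding obs_density_def[abs_def] by measurable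
qed

lemma obs_law_eq_density:
  assumes P: "prob_space P" "sets P = sets (lborel_euc d)" and "0 < l"
  shows "obs_law d P l = density (lborel_euc d) (\<lambda>y. ennreal (obs_density d P l y))"
proof (rule measure_eqI)
  interpret prob_space P by fact
  interpret L: finite_product_sigma_finite "\<lambda>_::nat. lborel :: real measure" "{..<d}" by standard simp
  interpret pair_sigma_finite P "lborel_euc d" ..
  have [measurable_cong]: "sets P = sets (lborel_euc d)" by fact
  note [measurable] = obs_density_measurable[OF P]
  fix A assume "A \<in> sets (obs_law d P l)"
  then have A [measurable]: "A \<in> sets (lborel_euc d)" by simp
  let ?n = "\<lambda>x y. ennreal (\<Prod>i<d. normal_density (x i) (l powr (- 1 / 2)) (y i))"
  have joint [measurable]: "(\<lambda>(x, y). ?n x y) \<in> borel_measurable (P \<Otimes>\<^sub>M lborel_euc d)"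
    unfolding normal_density_def split_beta' by measurable
  have "emeasure (obs_law d P l) A = (\<integral>\<^sup>+y. indicator A y \<partial>obs_law d P l)" by simp
  also have "\<dots> = (\<integral>\<^sup>+x. (\<integral>\<^sup>+z. indicator A (\<lambda>i\<in>{..<d}. x i + l powr (- 1 / 2) * z i) \<partial>std_gauss d) \<partial>P)"
    by (rule nn_integral_obs_law[OF P]) measurable
  also have "\<dots> = (\<integral>\<^sup>+x. (\<integral>\<^sup>+y. ?n x y * indicator A y \<partial>lborel_euc d) \<partial>P)"
    by (intro nn_integral_cong nn_integral_shifted_std_gauss) (use \<open>0 < l\<close> in auto)
  also have "\<dots> = (\<integral>\<^sup>+y. (\<integral>\<^sup>+x. ?n x y * indicator A y \<partial>P) \<partial>lborel_euc d)"
    by (rule Fubini'[symmetric]) measurable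
  also have "\<dots> = (\<integral>\<^sup>+y. ennreal (obs_density d P l y) * indicator A y \<partial>lborel_euc d)"
  proof (intro nn_integral_cong)
    fix y
    have "(\<lambda>x. ?n x y) \<in> borel_measurable P" unfolding normal_density_def by measurable
    then show "(\<integral>\<^sup>+x. ?n x y * indicator A y \<partial>P) = ennreal (obs_density d P l y) * indicator A y"
      by (simp add: nn_integral_multc obs_density_eq_nn_integral[OF P \<open>0 < l\<close>])
  qed
  also have "\<dots> = emeasure (density (lborel_euc d) (\<lambda>y. ennreal (obs_density d P l y))) A"
    by (rule emeasure_density[symmetric]) auto
  finally show "emeasure (obs_law d P l) A = emeasure (density (lborel_euc d) (\<lambda>y. ennreal (obs_density d P l y))) A" .
qed simp

section \<open>The centered squared norm of the observation\<close>

text \<open>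
  Completing the square: the integrand is a multiple of a normal density of variance \<open>1 / (1 - 2 * c * \<sigma>\<^sup>2)\<close>.
\<close>

lemma gauss1_exp_square:
  assumes D: "0 < 1 - 2 * c * \<sigma>\<^sup>2"
  shows "(\<integral>\<^sup>+t. ennreal (exp (c * (u + \<sigma> * t)\<^sup>2)) \<partial>gauss1)
    = ennreal ((1 - 2 * c * \<sigma>\<^sup>2) powr (- 1 / 2) * exp (c / (1 - 2 * c * \<sigma>\<^sup>2) * u\<^sup>2))"
proof -
  define D where "D = 1 - 2 * c * \<sigma>\<^sup>2"
  have "0 < D" using assms by (simp add: D_def)
  let ?s = "1 / sqrt D" and ?m = "2 * c * \<sigma> * u / D"
  have expo: "- t\<^sup>2 / 2 + c * (u + \<sigma> * t)\<^sup>2 = c / D * u\<^sup>2 - (t - ?m)\<^sup>2 * D / 2" for t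
  proof -
    have "D * (- t\<^sup>2 / 2 + c * (u + \<sigma> * t)\<^sup>2 - c / D * u\<^sup>2 + (t - ?m)\<^sup>2 * D / 2)
      = D * (- t\<^sup>2 / 2 + c * (u + \<sigma> * t)\<^sup>2) - c * u\<^sup>2 + (D * t - 2 * c * \<sigma> * u)\<^sup>2 / 2"
      using \<open>0 < D\<close> by (simp add: power2_eq_square field_simps)
    also have "\<dots> = 0" by (simp add: D_def power2_eq_square field_simps)
    finally show ?thesis using \<open>0 < D\<close> by simp
  qed
  have "std_normal_density t * exp (c * (u + \<sigma> * t)\<^sup>2)
    = D powr (- 1 / 2) * exp (c / D * u\<^sup>2) * normal_density ?m ?s t" for t
  proof -
    have "std_normal_density t * exp (c * (u + \<sigma> * t)\<^sup>2) = exp (- t\<^sup>2 / 2 + c * (u + \<sigma> * t)\<^sup>2) / sqrt (2 * pi)"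
      unfolding exp_add by (simp add: std_normal_density_def)
    also have "\<dots> = exp (c / D * u\<^sup>2) * exp (- (t - ?m)\<^sup>2 * D / 2) / sqrt (2 * pi)"
      unfolding expo by (simp add: exp_add[symmetric])
    also have "\<dots> = D powr (- 1 / 2) * exp (c / D * u\<^sup>2) * normal_density ?m ?s t"
      using \<open>0 < D\<close> unfolding normal_density_def
      by (simp add: power_divide powr_minus_divide powr_half_sqrt real_sqrt_divide)
    finally show ?thesis .
  qed
  note eq = this
  have "(\<integral>\<^sup>+t. ennreal (exp (c * (u + \<sigma> * t)\<^sup>2)) \<partial>gauss1)
    = (\<integral>\<^sup>+t. ennreal (D powr (- 1 / 2) * exp (c / D * u\<^sup>2)) * ennreal (normal_density ?m ?s t) \<partial>lborel)"
    by (simp add: nn_integral_density normal_density_nonneg ennreal_mult[symmetric] eq)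
  also have "\<dots> = ennreal (D powr (- 1 / 2) * exp (c / D * u\<^sup>2)) * (\<integral>\<^sup>+t. ennreal (normal_density ?m ?s t) \<partial>lborel)"
    by (rule nn_integral_cmult) simp
  also have "(\<integral>\<^sup>+t. ennreal (normal_density ?m ?s t) \<partial>lborel) = 1"
    using prob_space.emeasure_space_1[OF prob_space_normal_density[of ?s ?m]] \<open>0 < D\<close>
    by (simp add: emeasure_density)
  finally show ?thesis by (simp add: D_def)
qed

lemma std_gauss_exp_sq_norm:
  assumes D: "0 < 1 - 2 * c * \<sigma>\<^sup>2"
  shows "(\<integral>\<^sup>+z. ennreal (exp (c * (edist d (\<lambda>i\<in>{..<d}. x i + \<sigma> * z i) m)\<^sup>2)) \<partial>std_gauss d)
    = ennreal ((1 - 2 * c * \<sigma>\<^sup>2) powr (- real d / 2) * exp (c / (1 - 2 * c * \<sigma>\<^sup>2) * (edist d x m)\<^sup>2))"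
proof -
  interpret G: product_sigma_finite "\<lambda>_::nat. gauss1" by (rule product_sigma_finite_gauss1)
  have "(\<integral>\<^sup>+z. ennreal (exp (c * (edist d (\<lambda>i\<in>{..<d}. x i + \<sigma> * z i) m)\<^sup>2)) \<partial>std_gauss d)
    = (\<integral>\<^sup>+z. (\<Prod>i<d. ennreal (exp (c * ((x i - m i) + \<sigma> * z i)\<^sup>2))) \<partial>std_gauss d)"
    by (intro nn_integral_cong)
      (simp add: edist_power2 sum_distrib_left exp_sum prod_ennreal algebra_simps)
  also have "\<dots> = (\<Prod>i<d. \<integral>\<^sup>+t. ennreal (exp (c * ((x i - m i) + \<sigma> * t)\<^sup>2)) \<partial>gauss1)"
    unfolding std_gauss_def by (intro G.product_nn_integral_prod) auto
  also have "\<dots> = (\<Prod>i<d. ennreal ((1 - 2 * c * \<sigma>\<^sup>2) powr (- 1 / 2) * exp (c / (1 - 2 * c * \<sigma>\<^sup>2) * (x i - m i)\<^sup>2)))"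
    by (intro prod.cong refl gauss1_exp_square[OF D])
  also have "\<dots> = ennreal (\<Prod>i<d. (1 - 2 * c * \<sigma>\<^sup>2) powr (- 1 / 2) * exp (c / (1 - 2 * c * \<sigma>\<^sup>2) * (x i - m i)\<^sup>2))"
    by (intro prod_ennreal) simp
  also have "(\<Prod>i<d. (1 - 2 * c * \<sigma>\<^sup>2) powr (- 1 / 2) * exp (c / (1 - 2 * c * \<sigma>\<^sup>2) * (x i - m i)\<^sup>2))
    = ((1 - 2 * c * \<sigma>\<^sup>2) powr (- 1 / 2)) ^ d * exp (c / (1 - 2 * c * \<sigma>\<^sup>2) * (edist d x m)\<^sup>2)"
    unfolding prod.distrib edist_power2 sum_distrib_left exp_sum[OF finite_lessThan] by simp
  also have "((1 - 2 * c * \<sigma>\<^sup>2) powr (- 1 / 2)) ^ d = (1 - 2 * c * \<sigma>\<^sup>2) powr (- real d / 2)"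
    using D by (simp add: powr_power)
  finally show ?thesis .
qed

lemma std_gauss_sq_norm:
  "(\<integral>\<^sup>+z. ennreal ((edist d (\<lambda>i\<in>{..<d}. x i + \<sigma> * z i) m)\<^sup>2) \<partial>std_gauss d)
    = ennreal ((edist d x m)\<^sup>2 + real d * \<sigma>\<^sup>2)"
proof -
  have one: "(\<integral>\<^sup>+t. ennreal ((u + \<sigma> * t)\<^sup>2) \<partial>gauss1) = ennreal (u\<^sup>2 + \<sigma>\<^sup>2)" for u
  proof -
    have m: "has_bochner_integral lborel (\<lambda>t. std_normal_density t) 1"
      "has_bochner_integral lborel (\<lambda>t. std_normal_density t * t) 0"
      "has_bochner_integral lborel (\<lambda>t. std_normal_density t * t\<^sup>2) 1"
      using std_normal_moment_even[of 0] std_normal_moment_odd[of 0] std_normal_moment_even[of 1] by simp_all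
    have "has_bochner_integral lborel
      (\<lambda>t. u\<^sup>2 * std_normal_density t + 2 * u * \<sigma> * (std_normal_density t * t) + \<sigma>\<^sup>2 * (std_normal_density t * t\<^sup>2))
      (u\<^sup>2 * 1 + 2 * u * \<sigma> * 0 + \<sigma>\<^sup>2 * 1)"
      by (intro has_bochner_integral_add has_bochner_integral_mult_right m)
    then have "has_bochner_integral lborel (\<lambda>t. std_normal_density t * (u + \<sigma> * t)\<^sup>2) (u\<^sup>2 + \<sigma>\<^sup>2)"
      by (simp add: power2_eq_square algebra_simps)
    then have "(\<integral>\<^sup>+t. ennreal (std_normal_density t * (u + \<sigma> * t)\<^sup>2) \<partial>lborel) = ennreal (u\<^sup>2 + \<sigma>\<^sup>2)"
      by (subst nn_integral_eq_integral) (auto simp: has_bochner_integral_iff normal_density_nonneg)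
    then show ?thesis
      by (simp add: nn_integral_density normal_density_nonneg ennreal_mult[symmetric])
  qed
  have proj: "(\<lambda>z. z i) \<in> std_gauss d \<rightarrow>\<^sub>M gauss1" if "i < d" for i
    using that unfolding std_gauss_def by (intro measurable_component_singleton) simp
  have comp: "(\<integral>\<^sup>+z. f (z i) \<partial>std_gauss d) = (\<integral>\<^sup>+t. f t \<partial>gauss1)"
    if "i < d" "f \<in> borel_measurable borel" for i f
  proof -
    have "(\<integral>\<^sup>+t. f t \<partial>gauss1) = (\<integral>\<^sup>+t. f t \<partial>distr (std_gauss d) gauss1 (\<lambda>z. z i))"
      using distr_PiM_component[of "{..<d}" "\<lambda>_. gauss1" i] that(1) prob_space_gauss1
      by (simp add: std_gauss_def)
    also have "\<dots> = (\<integral>\<^sup>+z. f (z i) \<partial>std_gauss d)"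
      using proj[OF that(1)] that(2) by (intro nn_integral_distr) auto
    finally show ?thesis by simp
  qed
  have "(\<integral>\<^sup>+z. ennreal ((edist d (\<lambda>i\<in>{..<d}. x i + \<sigma> * z i) m)\<^sup>2) \<partial>std_gauss d)
    = (\<integral>\<^sup>+z. (\<Sum>i<d. ennreal (((x i - m i) + \<sigma> * z i)\<^sup>2)) \<partial>std_gauss d)"
    by (intro nn_integral_cong) (simp add: edist_power2 sum_ennreal algebra_simps)
  also have "\<dots> = (\<Sum>i<d. \<integral>\<^sup>+z. ennreal (((x i - m i) + \<sigma> * z i)\<^sup>2) \<partial>std_gauss d)"
  proof (intro nn_integral_sum)
    fix i assume "i \<in> {..<d}"
    then have "(\<lambda>z. z i) \<in> borel_measurable (std_gauss d)" using proj[of i] by simp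
    then show "(\<lambda>z. ennreal (((x i - m i) + \<sigma> * z i)\<^sup>2)) \<in> borel_measurable (std_gauss d)" by measurable
  qed
  also have "\<dots> = (\<Sum>i<d. ennreal ((x i - m i)\<^sup>2 + \<sigma>\<^sup>2))"
    by (intro sum.cong refl) (subst comp; simp add: one)
  also have "\<dots> = ennreal ((edist d x m)\<^sup>2 + real d * \<sigma>\<^sup>2)"
    by (subst sum_ennreal) (auto simp: edist_power2 sum.distrib)
  finally show ?thesis .
qed

text \<open>
  Noise of variance \<open>1 / l\<close> changes the exponent \<open>c\<close> of the squared norm into \<open>c / (1 - 2 * c / l)\<close>, that is, it
  shifts \<open>1 / c\<close> by \<open>- 2 / l\<close>. The exponents \<open>s / (1 + \<kappa> * s)\<close> and \<open>- s\<close> become exactly a pair to which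
  \<open>SLC_mgf_sq_norm\<close> applies, so only the two determinant factors remain; their product is the right-hand side.
  Bounding it by \<open>1\<close> would double the terms \<open>4 / (\<alpha> * l)\<close> and \<open>2 / l\<^sup>2\<close> in the variance.
\<close>

lemma obs_law_mgf_sq_norm:
  assumes P: "P \<in> SLC d \<alpha>" and "0 < \<alpha>" "0 < l" "0 < s"
  defines "\<kappa> \<equiv> 4 / l + 4 / \<alpha>"
  shows "(\<integral>\<^sup>+y. ennreal (exp (s / (1 + \<kappa> * s) * (edist d y m)\<^sup>2)) \<partial>obs_law d P l)
      * (\<integral>\<^sup>+y. ennreal (exp (- s * (edist d y m)\<^sup>2)) \<partial>obs_law d P l)
    \<le> ennreal ((1 + (4 / l\<^sup>2 + 8 / (l * \<alpha>)) * (s\<^sup>2 / (1 + \<kappa> * s))) powr (- real d / 2))"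
proof -
  have [measurable_cong]: "sets P = sets (lborel_euc d)" by (rule sets_SLC[OF P])
  define t where "t = s / (1 + \<kappa> * s)"
  define A where "A = 1 + \<kappa> * s"
  define B where "B = 1 + (2 / l + 4 / \<alpha>) * s"
  define C where "C = 1 + 2 / l * s"
  have "0 < \<kappa>" using assms by (simp add: \<kappa>_def add_pos_pos)
  have pos: "0 < A" "0 < B" "0 < C"
    using assms \<open>0 < \<kappa>\<close> by (auto simp: A_def B_def C_def intro!: add_pos_pos mult_pos_pos)
  have sq: "(l powr (- 1 / 2))\<^sup>2 = 1 / l"
    using \<open>0 < l\<close> by (simp add: powr_minus_divide powr_half_sqrt power_divide)
  have law: "(\<integral>\<^sup>+y. ennreal (exp (c * (edist d y m)\<^sup>2)) \<partial>obs_law d P l)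
    = ennreal ((1 - 2 * c / l) powr (- real d / 2)) * (\<integral>\<^sup>+x. ennreal (exp (c / (1 - 2 * c / l) * (edist d x m)\<^sup>2)) \<partial>P)"
    if "0 < 1 - 2 * c / l" for c
  proof -
    have "(\<integral>\<^sup>+y. ennreal (exp (c * (edist d y m)\<^sup>2)) \<partial>obs_law d P l)
      = (\<integral>\<^sup>+x. (\<integral>\<^sup>+z. ennreal (exp (c * (edist d (\<lambda>i\<in>{..<d}. x i + l powr (- 1 / 2) * z i) m)\<^sup>2)) \<partial>std_gauss d) \<partial>P)"
      by (rule nn_integral_obs_law[OF prob_space_SLC[OF P] sets_SLC[OF P]]) measurable
    also have "\<dots> = (\<integral>\<^sup>+x. ennreal ((1 - 2 * c / l) powr (- real d / 2)) * ennreal (exp (c / (1 - 2 * c / l) * (edist d x m)\<^sup>2)) \<partial>P)"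
      using std_gauss_exp_sq_norm[of c "l powr (- 1 / 2)" d _ m] that unfolding sq
      by (simp add: ennreal_mult)
    finally show ?thesis by (subst (asm) nn_integral_cmult) auto
  qed
  have t1: "1 - 2 * t / l = B / A"
    using pos by (simp add: t_def A_def[symmetric] field_simps) (simp add: A_def B_def \<kappa>_def field_simps \<open>0 < l\<close>)
  have t2: "t / (B / A) = s / B" using pos by (simp add: t_def A_def[symmetric])
  have c1: "1 - 2 * - s / l = C" by (simp add: C_def)
  have law_t: "(\<integral>\<^sup>+y. ennreal (exp (t * (edist d y m)\<^sup>2)) \<partial>obs_law d P l)
    = ennreal ((B / A) powr (- real d / 2)) * (\<integral>\<^sup>+x. ennreal (exp (s / B * (edist d x m)\<^sup>2)) \<partial>P)"
    using law[of t] pos unfolding t1 t2 by simp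
  have law_s: "(\<integral>\<^sup>+y. ennreal (exp (- s * (edist d y m)\<^sup>2)) \<partial>obs_law d P l)
    = ennreal (C powr (- real d / 2)) * (\<integral>\<^sup>+x. ennreal (exp (- s / C * (edist d x m)\<^sup>2)) \<partial>P)"
    using law[of "- s"] pos unfolding c1 by simp
  define r where "r = s / C"
  have "0 < r" using pos \<open>0 < s\<close> by (simp add: r_def)
  have r: "r / (1 + 4 / \<alpha> * r) = s / B"
  proof -
    have "C * (1 + 4 / \<alpha> * r) = C + 4 / \<alpha> * (C * r)" by (simp add: algebra_simps)
    also have "C * r = s" using pos by (simp add: r_def)
    also have "C + 4 / \<alpha> * s = B" by (simp add: B_def C_def algebra_simps)
    finally have "C * (1 + 4 / \<alpha> * r) = B" .
    then show ?thesis using pos unfolding r_def by (metis divide_divide_eq_left)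
  qed
  have signal: "(\<integral>\<^sup>+x. ennreal (exp (s / B * (edist d x m)\<^sup>2)) \<partial>P) * (\<integral>\<^sup>+x. ennreal (exp (- s / C * (edist d x m)\<^sup>2)) \<partial>P) \<le> 1"
    using SLC_mgf_sq_norm[OF P \<open>0 < \<alpha>\<close> \<open>0 < r\<close>, of m] unfolding r by (simp add: r_def)
  have "(\<integral>\<^sup>+y. ennreal (exp (t * (edist d y m)\<^sup>2)) \<partial>obs_law d P l) * (\<integral>\<^sup>+y. ennreal (exp (- s * (edist d y m)\<^sup>2)) \<partial>obs_law d P l)
    = ennreal ((B / A) powr (- real d / 2) * C powr (- real d / 2))
      * ((\<integral>\<^sup>+x. ennreal (exp (s / B * (edist d x m)\<^sup>2)) \<partial>P) * (\<integral>\<^sup>+x. ennreal (exp (- s / C * (edist d x m)\<^sup>2)) \<partial>P))"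
    unfolding law_t law_s by (simp add: ennreal_mult ac_simps)
  also have "\<dots> \<le> ennreal ((B / A) powr (- real d / 2) * C powr (- real d / 2)) * 1"
    by (intro mult_left_mono signal) simp
  also have "(B / A) powr (- real d / 2) * C powr (- real d / 2) = (B / A * C) powr (- real d / 2)"
    by (subst powr_mult) (use pos in auto)
  also have "B / A * C = 1 + (4 / l\<^sup>2 + 8 / (l * \<alpha>)) * (s\<^sup>2 / A)"
  proof -
    have "B * C = A + (4 / l\<^sup>2 + 8 / (l * \<alpha>)) * s\<^sup>2"
      using \<open>0 < l\<close> \<open>0 < \<alpha>\<close> by (simp add: A_def B_def C_def \<kappa>_def power2_eq_square field_simps)
    then show ?thesis using pos by (simp add: field_simps)
  qed
  finally show ?thesis by (simp add: t_def A_def)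
qed

lemma obs_law_sq_norm_mean:
  assumes P: "P \<in> SLC d \<alpha>" and "0 < \<alpha>" "0 < l"
  defines "m \<equiv> mean_vec d P"
  shows "(\<integral>\<^sup>+y. ennreal ((edist d y m)\<^sup>2) \<partial>obs_law d P l)
    = ennreal ((\<integral>x. (edist d x m)\<^sup>2 \<partial>P) + real d / l)"
proof -
  interpret prob_space P by (rule prob_space_SLC[OF P])
  have [measurable_cong]: "sets P = sets (lborel_euc d)" by (rule sets_SLC[OF P])
  have sq: "(l powr (- 1 / 2))\<^sup>2 = 1 / l"
    using \<open>0 < l\<close> by (simp add: powr_minus_divide powr_half_sqrt power_divide)
  have int: "integrable P (\<lambda>x. (edist d x m)\<^sup>2)"
    unfolding m_def by (rule SLC_centered_second_moment[OF P \<open>0 < \<alpha>\<close>])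
  have "(\<integral>\<^sup>+y. ennreal ((edist d y m)\<^sup>2) \<partial>obs_law d P l)
    = (\<integral>\<^sup>+x. (\<integral>\<^sup>+z. ennreal ((edist d (\<lambda>i\<in>{..<d}. x i + l powr (- 1 / 2) * z i) m)\<^sup>2) \<partial>std_gauss d) \<partial>P)"
    by (rule nn_integral_obs_law[OF prob_space_SLC[OF P] sets_SLC[OF P]]) measurable
  also have "\<dots> = (\<integral>\<^sup>+x. ennreal ((edist d x m)\<^sup>2 + real d / l) \<partial>P)"
    unfolding std_gauss_sq_norm sq by simp
  also have "\<dots> = ennreal (\<integral>x. (edist d x m)\<^sup>2 + real d / l \<partial>P)"
    using int \<open>0 < l\<close> by (intro nn_integral_eq_integral) auto
  finally show ?thesis using int by (simp add: prob_space)
qed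

lemma obs_law_sq_norm_variance:
  assumes P: "P \<in> SLC d \<alpha>" and "0 < \<alpha>" "0 < l"
  defines "T \<equiv> \<lambda>y. (edist d y (mean_vec d P))\<^sup>2"
  shows "integrable (obs_law d P l) T" "integrable (obs_law d P l) (\<lambda>y. (T y)\<^sup>2)"
    and "(\<integral>y. T y \<partial>obs_law d P l) = (\<integral>x. T x \<partial>P) + real d / l"
    and "(\<integral>y. (T y)\<^sup>2 \<partial>obs_law d P l) - (\<integral>y. T y \<partial>obs_law d P l)\<^sup>2
      \<le> real d * (4 / \<alpha>\<^sup>2 + 4 / (\<alpha> * l) + 2 / l\<^sup>2)"
proof -
  interpret prob_space "obs_law d P l"
    by (intro prob_space_obs_law prob_space_SLC[OF P] sets_SLC[OF P])
  have T [measurable]: "T \<in> borel_measurable (obs_law d P l)"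
    unfolding T_def by (simp add: measurable_cong_sets[OF sets_obs_law refl])
  define \<kappa> where "\<kappa> = 4 / l + 4 / \<alpha>"
  define a where "a = 4 / l\<^sup>2 + 8 / (l * \<alpha>)"
  have "0 \<le> \<kappa>" using assms by (simp add: \<kappa>_def)
  have "((\<lambda>h. (1 + a * h) powr (- real d / 2)) has_real_derivative - (real d / 2 * a)) (at 0)"
    by (rule derivative_eq_intros refl | simp)+
  from tendsto_second_order_quotient[OF this _ \<open>0 \<le> \<kappa>\<close>]
  have lim: "((\<lambda>s. ((1 + a * (s\<^sup>2 / (1 + \<kappa> * s))) powr (- real d / 2) - 1) / s\<^sup>2) \<longlongrightarrow> - (real d / 2 * a)) (at_right 0)"
    by simp
  have "(\<integral>\<^sup>+y. ennreal (exp (s / (1 + \<kappa> * s) * T y)) \<partial>obs_law d P l)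
      * (\<integral>\<^sup>+y. ennreal (exp (- s * T y)) \<partial>obs_law d P l)
    \<le> ennreal ((1 + a * (s\<^sup>2 / (1 + \<kappa> * s))) powr (- real d / 2))" if "0 < s" for s
    unfolding T_def \<kappa>_def a_def by (rule obs_law_mgf_sq_norm[OF P \<open>0 < \<alpha>\<close> \<open>0 < l\<close> that])
  note var = variance_le_if_mgf_product[OF T \<open>0 \<le> \<kappa>\<close> this lim]
  show int: "integrable (obs_law d P l) T" "integrable (obs_law d P l) (\<lambda>y. (T y)\<^sup>2)"
    using var by auto
  show mean: "(\<integral>y. T y \<partial>obs_law d P l) = (\<integral>x. T x \<partial>P) + real d / l"
  proof -
    have "ennreal (expectation T) = (\<integral>\<^sup>+y. ennreal (T y) \<partial>obs_law d P l)"
      using int(1) by (intro nn_integral_eq_integral[symmetric]) (auto simp: T_def)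
    also have "\<dots> = ennreal ((\<integral>x. T x \<partial>P) + real d / l)"
      unfolding T_def by (rule obs_law_sq_norm_mean[OF P \<open>0 < \<alpha>\<close> \<open>0 < l\<close>])
    finally have "ennreal (expectation T) = ennreal ((\<integral>x. T x \<partial>P) + real d / l)" .
    moreover have "0 \<le> expectation T" "0 \<le> (\<integral>x. T x \<partial>P)" by (simp_all add: T_def)
    ultimately show ?thesis using \<open>0 < l\<close> by (metis ennreal_inj add_nonneg_nonneg divide_nonneg_pos of_nat_0_le_iff)
  qed
  have "\<kappa> * expectation T + - (real d / 2 * a) \<le> \<kappa> * (real d / \<alpha> + real d / l) - real d / 2 * a"
  proof -
    have "expectation T \<le> real d / \<alpha> + real d / l"
      using SLC_centered_second_moment(2)[OF P \<open>0 < \<alpha>\<close>] unfolding mean by (simp add: T_def)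
    from mult_left_mono[OF this \<open>0 \<le> \<kappa>\<close>] show ?thesis by simp
  qed
  also have "\<dots> = real d * (4 / \<alpha>\<^sup>2 + 4 / (\<alpha> * l) + 2 / l\<^sup>2)"
    using assms(2,3) by (simp add: \<kappa>_def a_def power2_eq_square field_simps)
  finally show "expectation (\<lambda>y. (T y)\<^sup>2) - (expectation T)\<^sup>2 \<le> real d * (4 / \<alpha>\<^sup>2 + 4 / (\<alpha> * l) + 2 / l\<^sup>2)"
    using var(3) by linarith
qed

text \<open>
  For tails the determinant factor is at most \<open>1\<close> and can be dropped, and the mean is at most \<open>d * \<kappa> / 4\<close>.
\<close>

lemma obs_law_sq_norm_tails:
  assumes P: "P \<in> SLC d \<alpha>" and "0 < \<alpha>" "0 < l" "0 < d" "0 < r"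
  defines "T \<equiv> \<lambda>y. (edist d y (mean_vec d P))\<^sup>2" and "\<kappa> \<equiv> 4 / l + 4 / \<alpha>"
  defines "E \<equiv> exp (- (r\<^sup>2 / (real d * \<kappa>\<^sup>2)) / (1 + 2 * r / (real d * \<kappa>)))"
  shows "measure (obs_law d P l) {y \<in> euc d. T y \<ge> (\<integral>x. T x \<partial>P) + real d / l + r} \<le> E"
    and "measure (obs_law d P l) {y \<in> euc d. T y \<le> (\<integral>x. T x \<partial>P) + real d / l - r} \<le> E"
proof -
  interpret prob_space "obs_law d P l"
    by (intro prob_space_obs_law prob_space_SLC[OF P] sets_SLC[OF P])
  have T [measurable]: "T \<in> borel_measurable (obs_law d P l)"
    unfolding T_def by (simp add: measurable_cong_sets[OF sets_obs_law refl])
  note moments = obs_law_sq_norm_variance[OF P \<open>0 < \<alpha>\<close> \<open>0 < l\<close>, folded T_def]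
  have \<kappa>: "0 < \<kappa>" using assms by (simp add: \<kappa>_def add_pos_pos)
  have prod: "(\<integral>\<^sup>+y. ennreal (exp (s / (1 + \<kappa> * s) * T y)) \<partial>obs_law d P l)
      * (\<integral>\<^sup>+y. ennreal (exp (- s * T y)) \<partial>obs_law d P l) \<le> 1" if "0 < s" for s
  proof -
    have "1 \<le> 1 + (4 / l\<^sup>2 + 8 / (l * \<alpha>)) * (s\<^sup>2 / (1 + \<kappa> * s))"
      using \<kappa> that assms(2,3) by simp
    then have "(1 + (4 / l\<^sup>2 + 8 / (l * \<alpha>)) * (s\<^sup>2 / (1 + \<kappa> * s))) powr (- real d / 2)
      \<le> (1 + (4 / l\<^sup>2 + 8 / (l * \<alpha>)) * (s\<^sup>2 / (1 + \<kappa> * s))) powr 0"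
      by (intro powr_mono) auto
    also have "\<dots> \<le> 1" by simp
    finally have le1: "(1 + (4 / l\<^sup>2 + 8 / (l * \<alpha>)) * (s\<^sup>2 / (1 + \<kappa> * s))) powr (- real d / 2) \<le> 1" .
    have "(\<integral>\<^sup>+y. ennreal (exp (s / (1 + \<kappa> * s) * T y)) \<partial>obs_law d P l)
        * (\<integral>\<^sup>+y. ennreal (exp (- s * T y)) \<partial>obs_law d P l)
      \<le> ennreal ((1 + (4 / l\<^sup>2 + 8 / (l * \<alpha>)) * (s\<^sup>2 / (1 + \<kappa> * s))) powr (- real d / 2))"
      unfolding T_def \<kappa>_def by (rule obs_law_mgf_sq_norm[OF P \<open>0 < \<alpha>\<close> \<open>0 < l\<close> that])
    also have "\<dots> \<le> ennreal 1" by (rule ennreal_leI[OF le1])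
    finally show ?thesis by simp
  qed
  have "4 * expectation T \<le> real d * \<kappa>"
    using mult_left_mono[OF SLC_centered_second_moment(2)[OF P \<open>0 < \<alpha>\<close>], of 4] unfolding moments(3)
    by (simp add: T_def \<kappa>_def algebra_simps)
  have "0 < real d" using \<open>0 < d\<close> by simp
  note tails = tail_bounds_if_mgf_product[OF T moments(1) \<kappa> \<open>0 < r\<close> _ prod]
  show "measure (obs_law d P l) {y \<in> euc d. T y \<ge> (\<integral>x. T x \<partial>P) + real d / l + r} \<le> E"
    "measure (obs_law d P l) {y \<in> euc d. T y \<le> (\<integral>x. T x \<partial>P) + real d / l - r} \<le> E"
    using tails[OF \<open>0 < real d\<close> _ \<open>4 * expectation T \<le> real d * \<kappa>\<close>]
    unfolding E_def moments(3) space_obs_law by simp_all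
qed

section \<open>The norm estimator\<close>

lemma mse_le_range:
  assumes "prob_space P" "sets P = sets (lborel_euc d)"
    and "\<And>y. y \<in> euc d \<Longrightarrow> h y \<in> {lmin..lmax}" "l \<in> {lmin..lmax}"
  shows "mse d P l h \<le> ennreal ((lmax - lmin)\<^sup>2)"
proof -
  interpret prob_space "obs_law d P l" by (intro prob_space_obs_law assms)
  have "mse d P l h \<le> (\<integral>\<^sup>+y. ennreal ((lmax - lmin)\<^sup>2) \<partial>obs_law d P l)"
    unfolding mse_def
  proof (intro nn_integral_mono ennreal_leI)
    fix y assume "y \<in> space (obs_law d P l)"
    then have "h y \<in> {lmin..lmax}" using assms(3) by simp
    then have "\<bar>h y - l\<bar> \<le> \<bar>lmax - lmin\<bar>" using assms(4) by auto
    then show "(h y - l)\<^sup>2 \<le> (lmax - lmin)\<^sup>2" by (rule abs_le_square_iff[THEN iffD1])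
  qed
  then show ?thesis using emeasure_space_1 by simp
qed

lemma norm_estimator_range:
  assumes "0 < lmin" "lmin < lmax"
  shows "norm_estimator d P lmin lmax y \<in> {lmin..lmax}"
proof -
  let ?a = "closest_point {inverse lmax..inverse lmin} (norm_stat d P y)"
  have "?a \<in> {inverse lmax..inverse lmin}"
    using assms by (intro closest_point_in_set) auto
  then have "inverse lmax \<le> ?a" "?a \<le> inverse lmin" by auto
  moreover have "0 < inverse lmax" using assms by simp
  ultimately have "inverse (inverse lmin) \<le> inverse ?a" "inverse ?a \<le> inverse (inverse lmax)"
    by (intro le_imp_inverse_le; linarith)+
  then show ?thesis by (simp add: norm_estimator_def)
qed

lemma norm_estimator_in_estimators:
  assumes "0 < lmin" "lmin < lmax"
  shows "norm_estimator d P lmin lmax \<in> estimators d {lmin..lmax}"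
proof -
  have "norm_stat d P \<in> borel_measurable (lborel_euc d)"
    unfolding norm_stat_def[abs_def] by measurable
  moreover have "closest_point {inverse lmax..inverse lmin} \<in> borel_measurable borel"
    using assms by (intro borel_measurable_continuous_onI continuous_on_closest_point) auto
  ultimately have "norm_estimator d P lmin lmax \<in> borel_measurable (lborel_euc d)"
    unfolding norm_estimator_def[abs_def] by measurable
  then show ?thesis
    unfolding estimators_def using norm_estimator_range[OF assms] by (intro measurable_restrict_space2) auto
qed

text \<open>
  Clipping is a contraction that fixes \<open>1 / l\<close>, and \<open>\<bar>1 / a - l\<bar> = l * \<bar>1 / l - a\<bar> / a \<le> lmax\<^sup>2 * \<bar>a - 1 / l\<bar>\<close>, so the
  error is controlled by the variance of the unclipped statistic, which is unbiased for \<open>1 / l\<close>.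
\<close>

lemma norm_estimator_mse:
  assumes P: "P \<in> SLC d \<alpha>" and "0 < \<alpha>" "1 \<le> d" and lim: "0 < lmin" "lmin < lmax" and l: "l \<in> {lmin..lmax}"
  shows "mse d P l (norm_estimator d P lmin lmax)
    \<le> ennreal (lmax ^ 4 / real d * (4 / \<alpha>\<^sup>2 + 4 / (\<alpha> * lmin) + 2 / lmin\<^sup>2))"
proof -
  interpret prob_space "obs_law d P l"
    by (intro prob_space_obs_law prob_space_SLC[OF P] sets_SLC[OF P])
  have "0 < l" using l lim by simp
  define T where "T y = (edist d y (mean_vec d P))\<^sup>2" for y
  note moments = obs_law_sq_norm_variance[OF P \<open>0 < \<alpha>\<close> \<open>0 < l\<close>, folded T_def]
  let ?I = "{inverse lmax..inverse lmin}"
  have pointwise: "(norm_estimator d P lmin lmax y - l)\<^sup>2 \<le> lmax ^ 4 / (real d)\<^sup>2 * (T y - expectation T)\<^sup>2" for y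
  proof -
    let ?a = "closest_point ?I (norm_stat d P y)"
    have linv: "inverse l \<in> ?I" using l lim by (auto intro!: le_imp_inverse_le)
    have "?a \<in> ?I" using lim by (intro closest_point_in_set) auto
    then have "inverse lmax \<le> ?a" by simp
    moreover have "0 < inverse lmax" using lim by simp
    ultimately have a: "0 < ?a" by linarith
    have "dist ?a (closest_point ?I (inverse l)) \<le> dist (norm_stat d P y) (inverse l)"
      using linv by (intro closest_point_lipschitz) auto
    then have clip: "\<bar>?a - inverse l\<bar> \<le> \<bar>norm_stat d P y - inverse l\<bar>"
      using linv by (simp add: closest_point_self dist_real_def)
    have est: "inverse ?a \<le> lmax" "0 < inverse ?a"
      using norm_estimator_range[OF lim, of d P y] a by (auto simp: norm_estimator_def)
    have "\<bar>inverse ?a - l\<bar> = inverse ?a * l * \<bar>?a - inverse l\<bar>"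
    proof -
      have "inverse ?a - l = inverse ?a * l * (inverse l - ?a)"
        using a \<open>0 < l\<close> by (simp add: field_simps)
      then show ?thesis using est \<open>0 < l\<close> by (simp add: abs_mult abs_minus_commute)
    qed
    also have "\<dots> \<le> lmax * lmax * \<bar>norm_stat d P y - inverse l\<bar>"
      using est l \<open>0 < l\<close> clip by (intro mult_mono) auto
    also have "norm_stat d P y - inverse l = (T y - expectation T) / real d"
      using \<open>1 \<le> d\<close> \<open>0 < l\<close> unfolding moments(3)
      by (simp add: norm_stat_def T_def[abs_def] field_simps)
    finally have "\<bar>inverse ?a - l\<bar> \<le> lmax\<^sup>2 * \<bar>(T y - expectation T) / real d\<bar>"
      by (simp add: power2_eq_square)
    then have "\<bar>inverse ?a - l\<bar>\<^sup>2 \<le> (lmax\<^sup>2 * \<bar>(T y - expectation T) / real d\<bar>)\<^sup>2"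
      by (rule power_mono) simp
    then show ?thesis
      by (simp add: norm_estimator_def power_mult_distrib power_divide power_mult[symmetric])
  qed
  have int: "integrable (obs_law d P l) (\<lambda>y. (T y - expectation T)\<^sup>2)"
    using moments(1,2) by (simp add: power2_diff)
  have "mse d P l (norm_estimator d P lmin lmax)
    \<le> (\<integral>\<^sup>+y. ennreal (lmax ^ 4 / (real d)\<^sup>2 * (T y - expectation T)\<^sup>2) \<partial>obs_law d P l)"
    unfolding mse_def by (intro nn_integral_mono ennreal_leI pointwise)
  also have "\<dots> = ennreal (lmax ^ 4 / (real d)\<^sup>2 * variance T)"
    using int lim by (subst nn_integral_eq_integral) auto
  also have "\<dots> \<le> ennreal (lmax ^ 4 / real d * (4 / \<alpha>\<^sup>2 + 4 / (\<alpha> * lmin) + 2 / lmin\<^sup>2))"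
  proof (rule ennreal_leI)
    have "variance T \<le> real d * (4 / \<alpha>\<^sup>2 + 4 / (\<alpha> * l) + 2 / l\<^sup>2)"
      using moments(4) by (subst variance_eq[OF moments(1,2)])
    also have "\<dots> \<le> real d * (4 / \<alpha>\<^sup>2 + 4 / (\<alpha> * lmin) + 2 / lmin\<^sup>2)"
      using l lim \<open>0 < \<alpha>\<close>
      by (intro mult_left_mono add_mono divide_left_mono power_mono mult_pos_pos) auto
    finally have "lmax ^ 4 / (real d)\<^sup>2 * variance T
      \<le> lmax ^ 4 / (real d)\<^sup>2 * (real d * (4 / \<alpha>\<^sup>2 + 4 / (\<alpha> * lmin) + 2 / lmin\<^sup>2))"
      by (intro mult_left_mono) auto
    then show "lmax ^ 4 / (real d)\<^sup>2 * variance T \<le> lmax ^ 4 / real d * (4 / \<alpha>\<^sup>2 + 4 / (\<alpha> * lmin) + 2 / lmin\<^sup>2)"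
      using \<open>1 \<le> d\<close> by (simp add: power2_eq_square)
  qed
  finally show ?thesis .
qed

section \<open>The maximum likelihood estimator\<close>

text \<open>
  Any event \<open>A\<close> serves as a test. Let \<open>p\<close> and \<open>p'\<close> be the two densities. The part of \<open>A\<close> where
  \<open>p \<le> c * p'\<close> has mass under \<open>p\<close> at most \<open>c\<close> times the mass of \<open>A\<close> under \<open>p'\<close>, and the rest of the event lies off \<open>A\<close>.
\<close>

lemma obs_law_likelihood_le_test:
  assumes P: "prob_space P" "sets P = sets (lborel_euc d)" and "0 < l" "0 < l'" "0 \<le> c"
    and A [measurable]: "A \<in> sets (lborel_euc d)"
  shows "measure (obs_law d P l) {y \<in> euc d. obs_density d P l y \<le> c * obs_density d P l' y}
    \<le> measure (obs_law d P l) (euc d - A) + c * measure (obs_law d P l') A"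
proof -
  interpret L: prob_space "obs_law d P l" by (rule prob_space_obs_law[OF P])
  interpret L': prob_space "obs_law d P l'" by (rule prob_space_obs_law[OF P])
  note [measurable] = obs_density_measurable[OF P]
  have euc_set [measurable]: "euc d \<in> sets (lborel_euc d)"
    using sets.top[of "lborel_euc d"] by (simp add: space_PiM)
  define G where "G = {y \<in> euc d. obs_density d P l y \<le> c * obs_density d P l' y}"
  have G [measurable]: "G \<in> sets (lborel_euc d)"
  proof -
    have "{y \<in> space (lborel_euc d). obs_density d P l y \<le> c * obs_density d P l' y} \<in> sets (lborel_euc d)"
      by measurable
    then show ?thesis by (simp add: G_def space_PiM)
  qed
  have "emeasure (obs_law d P l) (A \<inter> G) = (\<integral>\<^sup>+y. ennreal (obs_density d P l y) * indicator (A \<inter> G) y \<partial>lborel_euc d)"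
    unfolding obs_law_eq_density[OF P \<open>0 < l\<close>] by (rule emeasure_density) auto
  also have "\<dots> \<le> (\<integral>\<^sup>+y. ennreal c * (ennreal (obs_density d P l' y) * indicator A y) \<partial>lborel_euc d)"
    using \<open>0 \<le> c\<close> by (intro nn_integral_mono)
      (auto simp: G_def ennreal_mult'[symmetric] intro!: ennreal_leI split: split_indicator)
  also have "\<dots> = ennreal c * (\<integral>\<^sup>+y. ennreal (obs_density d P l' y) * indicator A y \<partial>lborel_euc d)"
    by (rule nn_integral_cmult) auto
  also have "(\<integral>\<^sup>+y. ennreal (obs_density d P l' y) * indicator A y \<partial>lborel_euc d) = emeasure (obs_law d P l') A"
    unfolding obs_law_eq_density[OF P \<open>0 < l'\<close>] by (rule emeasure_density[symmetric]) auto
  finally have "ennreal (measure (obs_law d P l) (A \<inter> G)) \<le> ennreal (c * measure (obs_law d P l') A)"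
    using \<open>0 \<le> c\<close> by (simp add: L.emeasure_eq_measure L'.emeasure_eq_measure ennreal_mult)
  then have AG: "measure (obs_law d P l) (A \<inter> G) \<le> c * measure (obs_law d P l') A"
    using \<open>0 \<le> c\<close> by (subst (asm) ennreal_le_iff) auto
  have "measure (obs_law d P l) G \<le> measure (obs_law d P l) ((euc d - A) \<union> (A \<inter> G))"
  proof (rule L.finite_measure_mono)
    show "G \<subseteq> (euc d - A) \<union> (A \<inter> G)" by (auto simp: G_def)
    show "(euc d - A) \<union> (A \<inter> G) \<in> sets (obs_law d P l)" unfolding sets_obs_law by measurable
  qed
  also have "\<dots> \<le> measure (obs_law d P l) (euc d - A) + measure (obs_law d P l) (A \<inter> G)"
    by (intro measure_Un_le) auto
  finally show ?thesis using AG by (simp add: G_def)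
qed

text \<open>
  Two precisions of the interval at distance \<open>\<delta>\<close> are told apart by the squared norm with errors at most
  \<open>exp (- (sep_const lmin lmax * d * \<delta>\<^sup>2 / (1 + 1 / \<alpha>)\<^sup>2))\<close>.
\<close>

definition sep_const :: "real \<Rightarrow> real \<Rightarrow> real" where
  "sep_const lmin lmax = 1 / (4 * lmax ^ 4 * (4 / lmin + 4)\<^sup>2) / (1 + lmax / (4 * lmin))"

lemma sep_const_pos: "0 < lmin \<Longrightarrow> lmin < lmax \<Longrightarrow> 0 < sep_const lmin lmax"
proof -
  assume "0 < lmin" "lmin < lmax"
  moreover from this have "0 < 4 / lmin + 4" "0 < 1 + lmax / (4 * lmin)"
    by (simp_all add: add_pos_pos)
  ultimately show ?thesis unfolding sep_const_def
    by (intro divide_pos_pos mult_pos_pos zero_less_power) auto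
qed

text \<open>
  Here \<open>r\<close> is half of the distance between the means of the squared norm at \<open>l1\<close> and \<open>l2\<close>. Since \<open>r / (d * \<kappa>)\<close> is bounded in terms
  of the interval, the tails are in their Gaussian regime.
\<close>

lemma tail_exponent_le:
  fixes \<alpha> :: real
  assumes "0 < \<alpha>" "0 < lmin" "lmin < lmax" "0 < d"
    and l: "l \<in> {lmin..lmax}" "l1 \<in> {lmin..lmax}" "l2 \<in> {lmin..lmax}"
  defines "r \<equiv> real d * \<bar>l1 - l2\<bar> / (2 * (l1 * l2))" and "\<kappa> \<equiv> 4 / l + 4 / \<alpha>"
  shows "exp (- (r\<^sup>2 / (real d * \<kappa>\<^sup>2)) / (1 + 2 * r / (real d * \<kappa>)))
    \<le> exp (- (sep_const lmin lmax * (real d * (l1 - l2)\<^sup>2 / (1 + inverse \<alpha>)\<^sup>2)))"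
proof -
  define K where "K = 1 + inverse \<alpha>"
  define B where "B = 4 / lmin + 4"
  have pos: "0 < l" "0 < l1" "0 < l2" "0 < lmax" "0 < real d" "0 < K" "0 < B" "0 < \<kappa>"
    using assms by (auto simp: K_def B_def \<kappa>_def add_pos_pos)
  have "4 / l \<le> 4 / lmin" using l assms by (intro divide_left_mono) auto
  moreover have "0 \<le> 4 / lmin * inverse \<alpha>" using assms by simp
  ultimately have "\<kappa> \<le> B * K"
    by (simp add: \<kappa>_def B_def K_def divide_inverse algebra_simps)
  then have \<kappa>2: "\<kappa>\<^sup>2 \<le> (B * K)\<^sup>2" using pos by (intro power_mono) auto
  have "4 / lmax \<le> 4 / l" using l pos by (intro divide_left_mono) auto
  then have \<kappa>_ge: "4 / lmax \<le> \<kappa>" using \<open>0 < \<alpha>\<close> by (simp add: \<kappa>_def add_increasing2)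
  have "l1 * l2 \<le> lmax * lmax" using l pos by (intro mult_mono) auto
  then have r_ge: "real d * \<bar>l1 - l2\<bar> / (2 * lmax\<^sup>2) \<le> r"
    unfolding r_def power2_eq_square using pos by (intro divide_left_mono mult_pos_pos) auto
  have r_le: "2 * r \<le> real d / lmin"
  proof -
    have "lmin * \<bar>l1 - l2\<bar> \<le> l1 * l2"
    proof (cases "l1 \<le> l2")
      case True
      have "lmin * (l2 - l1) \<le> l1 * l2" using l pos True by (intro mult_mono) auto
      with True show ?thesis by simp
    next
      case False
      have "lmin * (l1 - l2) \<le> l2 * l1" using l pos False by (intro mult_mono) auto
      with False show ?thesis by (simp add: mult.commute)
    qed
    then have "\<bar>l1 - l2\<bar> / (l1 * l2) \<le> 1 / lmin" using pos assms by (simp add: field_simps)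
    from mult_left_mono[OF this, of "real d"] show ?thesis by (simp add: r_def)
  qed
  have r0: "0 \<le> r" using pos by (simp add: r_def)
  have denom: "1 + 2 * r / (real d * \<kappa>) \<le> 1 + lmax / (4 * lmin)"
  proof -
    have "2 * r / (real d * \<kappa>) \<le> (real d / lmin) / (real d * (4 / lmax))"
      using r_le r0 \<kappa>_ge pos assms by (intro frac_le mult_left_mono) auto
    also have "\<dots> = lmax / (4 * lmin)" using pos by simp
    finally show ?thesis by simp
  qed
  have numer: "1 / (4 * lmax ^ 4 * B\<^sup>2) * (real d * (l1 - l2)\<^sup>2 / K\<^sup>2) \<le> r\<^sup>2 / (real d * \<kappa>\<^sup>2)"
  proof -
    have "(real d * \<bar>l1 - l2\<bar> / (2 * lmax\<^sup>2))\<^sup>2 \<le> r\<^sup>2" using r_ge by (intro power_mono) auto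
    then have "(real d * \<bar>l1 - l2\<bar> / (2 * lmax\<^sup>2))\<^sup>2 / (real d * (B * K)\<^sup>2) \<le> r\<^sup>2 / (real d * \<kappa>\<^sup>2)"
      using \<kappa>2 pos by (intro frac_le mult_left_mono) auto
    also have "(real d * \<bar>l1 - l2\<bar> / (2 * lmax\<^sup>2))\<^sup>2 = real d * (real d * (l1 - l2)\<^sup>2 / (4 * lmax ^ 4))"
      by (simp add: power_divide power_mult_distrib power_mult[symmetric] power2_eq_square[of "real d"])
    also have "\<dots> / (real d * (B * K)\<^sup>2) = 1 / (4 * lmax ^ 4 * B\<^sup>2) * (real d * (l1 - l2)\<^sup>2 / K\<^sup>2)"
      using pos by (simp add: power_mult_distrib)
    finally show ?thesis .
  qed
  have "sep_const lmin lmax * (real d * (l1 - l2)\<^sup>2 / K\<^sup>2)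
    = 1 / (4 * lmax ^ 4 * B\<^sup>2) * (real d * (l1 - l2)\<^sup>2 / K\<^sup>2) / (1 + lmax / (4 * lmin))"
    by (simp add: sep_const_def B_def)
  also have "\<dots> \<le> r\<^sup>2 / (real d * \<kappa>\<^sup>2) / (1 + 2 * r / (real d * \<kappa>))"
    using numer denom r0 pos by (intro frac_le) (auto intro!: add_pos_nonneg)
  finally show ?thesis by (simp add: K_def)
qed

text \<open>
  The test compares the squared norm with the midpoint of its two means; the mean is decreasing in
  the precision, which fixes the direction of the test in each case.
\<close>

lemma likelihood_comparison_error:
  assumes P: "P \<in> SLC d \<alpha>" and "0 < \<alpha>" "0 < d" "0 < lmin" "lmin < lmax"
    and l: "l \<in> {lmin..lmax}" "l' \<in> {lmin..lmax}" "l \<noteq> l'"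
  shows "measure (obs_law d P l) {y \<in> euc d. obs_density d P l y \<le> exp 1 * obs_density d P l' y}
    \<le> 4 * exp (- (sep_const lmin lmax * (real d * (l - l')\<^sup>2 / (1 + inverse \<alpha>)\<^sup>2)))"
proof -
  define T where "T y = (edist d y (mean_vec d P))\<^sup>2" for y
  define b where "b = (\<integral>x. T x \<partial>P)"
  define r where "r = real d * \<bar>l - l'\<bar> / (2 * (l * l'))"
  define E where "E = exp (- (sep_const lmin lmax * (real d * (l - l')\<^sup>2 / (1 + inverse \<alpha>)\<^sup>2)))"
  have pos: "0 < l" "0 < l'" using l assms by auto
  have "0 < r" using pos \<open>0 < d\<close> \<open>l \<noteq> l'\<close> by (simp add: r_def)
  note P' = prob_space_SLC[OF P] sets_SLC[OF P]
  have [measurable]: "T \<in> borel_measurable (lborel_euc d)" unfolding T_def by measurable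
  have exponent: "exp (- (r\<^sup>2 / (real d * (4 / k + 4 / \<alpha>)\<^sup>2)) / (1 + 2 * r / (real d * (4 / k + 4 / \<alpha>)))) \<le> E"
    if "k \<in> {lmin..lmax}" for k
    unfolding r_def E_def using assms that by (intro tail_exponent_le) auto
  have upper: "measure (obs_law d P k) {y \<in> euc d. T y \<ge> b + real d / k + r} \<le> E"
    and lower: "measure (obs_law d P k) {y \<in> euc d. T y \<le> b + real d / k - r} \<le> E"
    if "k \<in> {lmin..lmax}" for k
  proof -
    have "0 < k" using that \<open>0 < lmin\<close> by auto
    note tails = obs_law_sq_norm_tails[OF P \<open>0 < \<alpha>\<close> this \<open>0 < d\<close> \<open>0 < r\<close>]
    show "measure (obs_law d P k) {y \<in> euc d. T y \<ge> b + real d / k + r} \<le> E"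
      unfolding T_def b_def by (rule order_trans[OF tails(1) exponent[OF that]])
    show "measure (obs_law d P k) {y \<in> euc d. T y \<le> b + real d / k - r} \<le> E"
      unfolding T_def b_def by (rule order_trans[OF tails(2) exponent[OF that]])
  qed
  have Tset: "{y \<in> euc d. T y < c} \<in> sets (lborel_euc d)" "{y \<in> euc d. T y \<le> c} \<in> sets (lborel_euc d)"
     "{y \<in> euc d. T y > c} \<in> sets (lborel_euc d)" "{y \<in> euc d. T y \<ge> c} \<in> sets (lborel_euc d)" for c
  proof -
    have "{y \<in> space (lborel_euc d). T y < c} \<in> sets (lborel_euc d)" "{y \<in> space (lborel_euc d). T y \<le> c} \<in> sets (lborel_euc d)"
      "{y \<in> space (lborel_euc d). T y > c} \<in> sets (lborel_euc d)" "{y \<in> space (lborel_euc d). T y \<ge> c} \<in> sets (lborel_euc d)"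
      by measurable
    then show "{y \<in> euc d. T y < c} \<in> sets (lborel_euc d)" "{y \<in> euc d. T y \<le> c} \<in> sets (lborel_euc d)"
     "{y \<in> euc d. T y > c} \<in> sets (lborel_euc d)" "{y \<in> euc d. T y \<ge> c} \<in> sets (lborel_euc d)"
      by (simp_all add: space_PiM)
  qed
  interpret L': prob_space "obs_law d P l'" by (rule prob_space_obs_law[OF P'])
  have compl_less: "S - {y \<in> S. T y < c} = {y \<in> S. T y \<ge> c}"
    and compl_greater: "S - {y \<in> S. T y > c} = {y \<in> S. T y \<le> c}" for S c by auto
  have "\<exists>A. A \<in> sets (lborel_euc d) \<and> measure (obs_law d P l) (euc d - A) \<le> E \<and> measure (obs_law d P l') A \<le> E"
  proof (cases "l' < l")
    case True
    have "real d / l' - real d / l = real d * (l - l') / (l * l')" using pos by (simp add: field_simps)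
    then have gap: "real d / l' - r = real d / l + r" using True by (simp add: r_def)
    let ?A = "{y \<in> euc d. T y < b + real d / l + r}"
    have compl: "euc d - ?A = {y \<in> euc d. T y \<ge> b + real d / l + r}" by (rule compl_less)
    have "measure (obs_law d P l') ?A \<le> measure (obs_law d P l') {y \<in> euc d. T y \<le> b + real d / l' - r}"
    proof (rule L'.finite_measure_mono)
      show "?A \<subseteq> {y \<in> euc d. T y \<le> b + real d / l' - r}" using gap by (intro Collect_mono) linarith
    qed (simp add: Tset)
    then have "measure (obs_law d P l') ?A \<le> E" by (rule order_trans[OF _ lower[OF l(2)]])
    moreover have "measure (obs_law d P l) (euc d - ?A) \<le> E" unfolding compl by (rule upper[OF l(1)])
    ultimately show ?thesis by (intro exI[of _ ?A] conjI Tset(1))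
  next
    case False
    have "real d / l - real d / l' = real d * (l' - l) / (l * l')" using pos by (simp add: field_simps)
    then have gap: "real d / l' + r = real d / l - r" using False by (simp add: r_def)
    let ?A = "{y \<in> euc d. T y > b + real d / l - r}"
    have compl: "euc d - ?A = {y \<in> euc d. T y \<le> b + real d / l - r}" by (rule compl_greater)
    have "measure (obs_law d P l') ?A \<le> measure (obs_law d P l') {y \<in> euc d. T y \<ge> b + real d / l' + r}"
    proof (rule L'.finite_measure_mono)
      show "?A \<subseteq> {y \<in> euc d. T y \<ge> b + real d / l' + r}" using gap by (intro Collect_mono) linarith
    qed (simp add: Tset)
    then have "measure (obs_law d P l') ?A \<le> E" by (rule order_trans[OF _ upper[OF l(2)]])
    moreover have "measure (obs_law d P l) (euc d - ?A) \<le> E" unfolding compl by (rule lower[OF l(1)])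
    ultimately show ?thesis by (intro exI[of _ ?A] conjI Tset(3))
  qed
  then obtain A where A: "A \<in> sets (lborel_euc d)" "measure (obs_law d P l) (euc d - A) \<le> E"
    "measure (obs_law d P l') A \<le> E" by blast
  have "measure (obs_law d P l) {y \<in> euc d. obs_density d P l y \<le> exp 1 * obs_density d P l' y}
    \<le> measure (obs_law d P l) (euc d - A) + exp 1 * measure (obs_law d P l') A"
    using pos A(1) by (intro obs_law_likelihood_le_test[OF P']) auto
  also have "\<dots> \<le> E + 3 * E"
    using A exp_le by (intro add_mono mult_mono) (auto simp: E_def)
  finally show ?thesis by (simp add: E_def)
qed

text \<open>
  The integral in the density decreases in the precision, so only the normalization \<open>l powr (d / 2)\<close> can
  lose, and by at most \<open>(1 + 2 / d) powr (d / 2) \<le> exp 1\<close>. The bound is uniform in \<open>y\<close>.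
\<close>

lemma obs_density_round_down:
  assumes P: "prob_space P" "sets P = sets (lborel_euc d)" and "0 < l" "l \<le> l'" "(l' - l) * real d \<le> 2 * l"
  shows "obs_density d P l' y \<le> exp 1 * obs_density d P l y"
proof (cases "d = 0")
  case True
  have "0 \<le> obs_density d P l y" for l by (simp add: obs_density_def)
  moreover have "obs_density d P l' y = obs_density d P l y"
    using True assms by (simp add: obs_density_def edist_power2)
  ultimately show ?thesis using mult_right_mono[of 1 "exp 1" "obs_density d P l y"] by simp
next
  case False
  interpret prob_space P by fact
  have [measurable_cong]: "sets P = sets (lborel_euc d)" by fact
  have int: "integrable P (\<lambda>x. exp (- (k / 2) * (edist d x y)\<^sup>2))" if "0 < k" for k
    using that by (intro integrable_const_bound[where B = 1]) auto
  have "l' \<le> l * (1 + 2 / real d)" using assms False by (simp add: field_simps)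
  also have "\<dots> \<le> l * exp (2 / real d)" using \<open>0 < l\<close> by (intro mult_left_mono exp_ge_add_one_self) auto
  finally have "l' / (2 * pi) \<le> l / (2 * pi) * exp (2 / real d)" by (simp add: field_simps)
  then have "(l' / (2 * pi)) powr (real d / 2) \<le> (l / (2 * pi) * exp (2 / real d)) powr (real d / 2)"
    using assms by (intro powr_mono2) auto
  also have "\<dots> = (l / (2 * pi)) powr (real d / 2) * exp (2 / real d) powr (real d / 2)"
    by (subst powr_mult) (use assms in auto)
  also have "exp (2 / real d) powr (real d / 2) = exp 1"
    using False by (simp add: powr_def)
  finally have const: "(l' / (2 * pi)) powr (real d / 2) \<le> exp 1 * (l / (2 * pi)) powr (real d / 2)"
    by (simp add: mult.commute)
  have "(\<integral>x. exp (- (l' / 2) * (edist d x y)\<^sup>2) \<partial>P) \<le> (\<integral>x. exp (- (l / 2) * (edist d x y)\<^sup>2) \<partial>P)"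
    using assms by (intro integral_mono int) (auto intro!: mult_right_mono)
  then have "(l' / (2 * pi)) powr (real d / 2) * (\<integral>x. exp (- (l' / 2) * (edist d x y)\<^sup>2) \<partial>P)
    \<le> (exp 1 * (l / (2 * pi)) powr (real d / 2)) * (\<integral>x. exp (- (l / 2) * (edist d x y)\<^sup>2) \<partial>P)"
    using const by (intro mult_mono) auto
  then show ?thesis unfolding obs_density_def by (simp only: mult.assoc)
qed

lemma MLE_likelihood_ge:
  assumes P: "prob_space P" "sets P = sets (lborel_euc d)" and "\<Lambda> \<subseteq> {0<..}"
    and h: "is_MLE d P \<Lambda> h" and y: "y \<in> euc d" and l: "l \<in> \<Lambda>"
  shows "h y \<in> \<Lambda>" "obs_density d P l y \<le> obs_density d P (h y) y"
proof -
  have *: "is_arg_min (\<lambda>l. - ln (obs_density d P l y)) (\<lambda>l. l \<in> \<Lambda>) (h y)"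
    using h y by (auto simp: is_MLE_def)
  then show h\<Lambda>: "h y \<in> \<Lambda>" by (auto simp: is_arg_min_def)
  have "ln (obs_density d P l y) \<le> ln (obs_density d P (h y) y)"
    using * l by (auto simp: is_arg_min_def not_less)
  moreover have "0 < obs_density d P l y" "0 < obs_density d P (h y) y"
    using assms h\<Lambda> by (auto intro!: obs_density_pos[OF P])
  ultimately show "obs_density d P l y \<le> obs_density d P (h y) y" by simp
qed

text \<open>
  If the estimate is farther than \<open>\<delta>\<close> from the truth, then the grid point just below it is at least \<open>\<delta> / 2\<close>
  away from the truth and has a likelihood at least \<open>exp (- 1)\<close> times that of the truth.
\<close>

lemma MLE_deviation:
  assumes P: "P \<in> SLC d \<alpha>" and "0 < \<alpha>" "0 < d" "0 < lmin" "lmin < lmax"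
    and h: "is_MLE d P {lmin..lmax} h" and l: "l \<in> {lmin..lmax}"
    and \<delta>: "4 * lmin / real d \<le> \<delta>"
  shows "measure (obs_law d P l) {y \<in> euc d. \<delta> < \<bar>h y - l\<bar>}
    \<le> ((lmax - lmin) / (2 * lmin) + 1) * real d
      * (4 * exp (- (sep_const lmin lmax * (real d * (\<delta> / 2)\<^sup>2 / (1 + inverse \<alpha>)\<^sup>2))))"
proof -
  note P' = prob_space_SLC[OF P] sets_SLC[OF P]
  interpret L: prob_space "obs_law d P l" by (rule prob_space_obs_law[OF P'])
  define \<eta> where "\<eta> = 2 * lmin / real d"
  have "0 < \<eta>" using assms by (simp add: \<eta>_def)
  define g where "g j = lmin + real j * \<eta>" for j :: nat
  define J where "J = {j. g j \<le> lmax \<and> \<delta> / 2 \<le> \<bar>g j - l\<bar>}"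
  define N where "N = nat \<lfloor>(lmax - lmin) / \<eta>\<rfloor>"
  let ?G = "\<lambda>j. {y \<in> euc d. obs_density d P l y \<le> exp 1 * obs_density d P (g j) y}"
  let ?E = "exp (- (sep_const lmin lmax * (real d * (\<delta> / 2)\<^sup>2 / (1 + inverse \<alpha>)\<^sup>2)))"
  have "0 < \<delta>" using \<delta> assms by (smt (verit) divide_pos_pos mult_pos_pos of_nat_0_less_iff)
  have J_sub: "J \<subseteq> {..N}"
  proof
    fix j assume "j \<in> J"
    then have "real j \<le> (lmax - lmin) / \<eta>" using \<open>0 < \<eta>\<close> by (simp add: J_def g_def field_simps)
    then show "j \<in> {..N}" using le_nat_floor by (auto simp: N_def)
  qed
  then have fin: "finite J" by (rule finite_subset) simp
  have card: "real (card J) \<le> ((lmax - lmin) / (2 * lmin) + 1) * real d"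
  proof -
    have "real (card J) \<le> real (card {..N})" using J_sub by (intro of_nat_mono card_mono) auto
    also have "\<dots> = real N + 1" by simp
    also have "real N \<le> (lmax - lmin) / \<eta>" using assms \<open>0 < \<eta>\<close> by (simp add: N_def)
    also have "(lmax - lmin) / \<eta> + 1 \<le> ((lmax - lmin) / (2 * lmin) + 1) * real d"
      using assms by (simp add: \<eta>_def algebra_simps)
    finally show ?thesis by simp
  qed
  have G_sets: "?G j \<in> sets (obs_law d P l)" for j
  proof -
    note [measurable] = obs_density_measurable[OF P']
    have "{y \<in> space (lborel_euc d). obs_density d P l y \<le> exp 1 * obs_density d P (g j) y} \<in> sets (lborel_euc d)"
      by measurable
    then show ?thesis by (simp add: space_PiM)
  qed
  have sub: "{y \<in> euc d. \<delta> < \<bar>h y - l\<bar>} \<subseteq> (\<Union>j\<in>J. ?G j)"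
  proof
    fix y assume "y \<in> {y \<in> euc d. \<delta> < \<bar>h y - l\<bar>}"
    then have y: "y \<in> euc d" "\<delta> < \<bar>h y - l\<bar>" by auto
    have "{lmin..lmax} \<subseteq> {0<..}" using assms by auto
    note mle = MLE_likelihood_ge[OF P' this h y(1) l]
    define j where "j = nat \<lfloor>(h y - lmin) / \<eta>\<rfloor>"
    have q: "0 \<le> (h y - lmin) / \<eta>" using mle(1) \<open>0 < \<eta>\<close> by simp
    then have "real j \<le> (h y - lmin) / \<eta>" "(h y - lmin) / \<eta> < real j + 1"
      by (simp_all add: j_def)
    then have j: "g j \<le> h y" "h y - g j < \<eta>" using \<open>0 < \<eta>\<close> by (simp_all add: g_def field_simps)
    have g_ge: "lmin \<le> g j" using \<open>0 < \<eta>\<close> by (simp add: g_def)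
    have "2 * \<eta> \<le> \<delta>" using \<delta> by (simp add: \<eta>_def)
    then have "\<delta> / 2 \<le> \<bar>g j - l\<bar>" using y(2) j by linarith
    moreover have "g j \<le> lmax" using j mle(1) by simp
    ultimately have "j \<in> J" by (simp add: J_def)
    moreover have "obs_density d P (h y) y \<le> exp 1 * obs_density d P (g j) y"
    proof (rule obs_density_round_down[OF P'])
      have "(h y - g j) * real d \<le> \<eta> * real d" using j by (intro mult_right_mono) auto
      also have "\<dots> = 2 * lmin" using \<open>0 < d\<close> by (simp add: \<eta>_def)
      finally show "(h y - g j) * real d \<le> 2 * g j" using g_ge by simp
    qed (use j g_ge \<open>0 < lmin\<close> in auto)
    ultimately show "y \<in> (\<Union>j\<in>J. ?G j)" using y(1) mle(2) by force
  qed
  have each: "measure (obs_law d P l) (?G j) \<le> 4 * ?E" if "j \<in> J" for j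
  proof -
    have g: "g j \<in> {lmin..lmax}" "\<delta> / 2 \<le> \<bar>g j - l\<bar>"
      using that \<open>0 < \<eta>\<close> by (auto simp: J_def g_def)
    then have "l \<noteq> g j" using \<open>0 < \<delta>\<close> by auto
    have "measure (obs_law d P l) (?G j)
      \<le> 4 * exp (- (sep_const lmin lmax * (real d * (l - g j)\<^sup>2 / (1 + inverse \<alpha>)\<^sup>2)))"
      using assms g \<open>l \<noteq> g j\<close> by (intro likelihood_comparison_error) auto
    also have "\<dots> \<le> 4 * ?E"
    proof -
      have "(\<delta> / 2)\<^sup>2 \<le> (l - g j)\<^sup>2"
        using g \<open>0 < \<delta>\<close> by (intro abs_le_square_iff[THEN iffD1]) (simp add: abs_minus_commute)
      then have "sep_const lmin lmax * (real d * (\<delta> / 2)\<^sup>2 / (1 + inverse \<alpha>)\<^sup>2)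
        \<le> sep_const lmin lmax * (real d * (l - g j)\<^sup>2 / (1 + inverse \<alpha>)\<^sup>2)"
        using sep_const_pos[of lmin lmax] assms by (intro mult_left_mono divide_right_mono) auto
      then show ?thesis by simp
    qed
    finally show ?thesis .
  qed
  have "measure (obs_law d P l) {y \<in> euc d. \<delta> < \<bar>h y - l\<bar>} \<le> measure (obs_law d P l) (\<Union>j\<in>J. ?G j)"
    using sub fin G_sets by (intro L.finite_measure_mono) auto
  also have "\<dots> \<le> (\<Sum>j\<in>J. measure (obs_law d P l) (?G j))"
    using fin G_sets by (intro L.finite_measure_subadditive_finite) auto
  also have "\<dots> \<le> (\<Sum>j\<in>J. 4 * ?E)" by (intro sum_mono each)
  also have "\<dots> = real (card J) * (4 * ?E)" by simp
  also have "\<dots> \<le> ((lmax - lmin) / (2 * lmin) + 1) * real d * (4 * ?E)"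
    by (intro mult_right_mono card) auto
  finally show ?thesis .
qed

text \<open>
  The maximum is the constant in the squared deviation \<open>\<delta>\<^sup>2\<close>: its first argument makes the tail of order
  \<open>(2 * d) powr (- 2)\<close>, which absorbs the number of grid points, and its second argument keeps \<open>\<delta>\<close> above twice the mesh.
  The other summand bounds the contribution of larger deviations.
\<close>

definition mle_const :: "real \<Rightarrow> real \<Rightarrow> real" where
  "mle_const lmin lmax = max (8 / sep_const lmin lmax) (16 * lmin\<^sup>2 / ln 2)
    + (lmax - lmin)\<^sup>2 * ((lmax - lmin) / (2 * lmin) + 1) / ln 2"

lemma MLE_mse:
  assumes P: "P \<in> SLC d \<alpha>" and "0 < \<alpha>" "0 < d" "0 < lmin" "lmin < lmax"
    and h: "is_MLE d P {lmin..lmax} h" and l: "l \<in> {lmin..lmax}"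
  shows "mse d P l h \<le> ennreal (mle_const lmin lmax * ((1 + inverse \<alpha>)\<^sup>2 * ln (2 * real d) / real d))"
proof -
  note P' = prob_space_SLC[OF P] sets_SLC[OF P]
  interpret L: prob_space "obs_law d P l" by (rule prob_space_obs_law[OF P'])
  define K where "K = 1 + inverse \<alpha>"
  define D where "D = max (8 / sep_const lmin lmax) (16 * lmin\<^sup>2 / ln 2)"
  define R where "R = K\<^sup>2 * ln (2 * real d) / real d"
  define \<delta> where "\<delta> = sqrt (D * R)"
  define A where "A = (lmax - lmin) / (2 * lmin) + 1"
  have "1 \<le> K" using \<open>0 < \<alpha>\<close> by (simp add: K_def)
  then have K2: "1 \<le> K\<^sup>2" by (simp add: one_le_power)
  have d1: "1 \<le> real d" using \<open>0 < d\<close> by simp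
  have ln2: "0 < ln (2::real)" by simp
  have ln_d: "ln 2 \<le> ln (2 * real d)" using d1 by simp
  have c: "0 < sep_const lmin lmax" using assms by (intro sep_const_pos)
  then have D: "0 < D" "8 / sep_const lmin lmax \<le> D" "16 * lmin\<^sup>2 / ln 2 \<le> D"
    by (auto simp: D_def less_max_iff_disj)
  have "0 < A" using assms by (simp add: A_def add_nonneg_pos)
  have R_ge: "ln 2 / real d \<le> R"
  proof -
    have "1 * ln 2 \<le> K\<^sup>2 * ln (2 * real d)" using K2 ln_d ln2 by (intro mult_mono) auto
    then show ?thesis unfolding R_def using d1 by (intro divide_right_mono) auto
  qed
  then have "0 < R" using ln2 d1 by (smt (verit) divide_pos_pos)
  have \<delta>2: "\<delta>\<^sup>2 = D * R" using D \<open>0 < R\<close> by (simp add: \<delta>_def)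
  have \<delta>_ge: "4 * lmin / real d \<le> \<delta>"
  proof (rule power2_le_imp_le)
    have "(4 * lmin / real d)\<^sup>2 = (16 * lmin\<^sup>2) / real d / real d"
      by (simp add: power_divide power_mult_distrib power2_eq_square)
    also have "\<dots> \<le> (16 * lmin\<^sup>2) / real d / 1"
      using d1 by (intro divide_left_mono) auto
    also have "\<dots> = (16 * lmin\<^sup>2 / ln 2) * (ln 2 / real d)" using ln2 by simp
    also have "\<dots> \<le> D * R" using D R_ge ln2 d1 by (intro mult_mono) auto
    finally show "(4 * lmin / real d)\<^sup>2 \<le> \<delta>\<^sup>2" by (simp add: \<delta>2)
    show "0 \<le> \<delta>" using D \<open>0 < R\<close> by (simp add: \<delta>_def)
  qed
  define bad where "bad = {y \<in> euc d. \<delta> < \<bar>h y - l\<bar>}"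
  have small: "measure (obs_law d P l) bad \<le> A / real d"
  proof -
    have "sep_const lmin lmax * (real d * (\<delta> / 2)\<^sup>2 / K\<^sup>2) = sep_const lmin lmax * D / 4 * ln (2 * real d)"
      using d1 \<open>1 \<le> K\<close> by (simp add: power_divide \<delta>2 R_def)
    also have "\<dots> \<ge> 2 * ln (2 * real d)"
    proof (rule mult_right_mono)
      show "2 \<le> sep_const lmin lmax * D / 4" using D(2) c by (simp add: field_simps)
      show "0 \<le> ln (2 * real d)" using ln_d ln2 by linarith
    qed
    finally have "exp (- (sep_const lmin lmax * (real d * (\<delta> / 2)\<^sup>2 / K\<^sup>2))) \<le> exp (- (2 * ln (2 * real d)))"
      by simp
    also have "\<dots> = 1 / (2 * real d)\<^sup>2"
      using d1 by (simp add: exp_minus exp_double inverse_eq_divide)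
    finally have "A * real d * (4 * exp (- (sep_const lmin lmax * (real d * (\<delta> / 2)\<^sup>2 / K\<^sup>2))))
      \<le> A * real d * (4 * (1 / (2 * real d)\<^sup>2))"
      using \<open>0 < A\<close> by (intro mult_left_mono) auto
    also have "\<dots> = A / real d" using d1 by (simp add: power2_eq_square)
    finally show ?thesis
      using MLE_deviation[OF P assms(2-5) h l \<delta>_ge] unfolding A_def K_def bad_def by linarith
  qed
  have bad [measurable]: "bad \<in> sets (obs_law d P l)"
  proof -
    have [measurable]: "h \<in> borel_measurable (lborel_euc d)" using h by (simp add: is_MLE_def)
    have "{y \<in> space (lborel_euc d). \<delta> < \<bar>h y - l\<bar>} \<in> sets (lborel_euc d)" by measurable
    then show ?thesis by (simp add: space_PiM bad_def)
  qed
  have "mse d P l h \<le> (\<integral>\<^sup>+y. ennreal (\<delta>\<^sup>2) + ennreal ((lmax - lmin)\<^sup>2) * indicator bad y \<partial>obs_law d P l)"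
    unfolding mse_def
  proof (intro nn_integral_mono)
    fix y assume "y \<in> space (obs_law d P l)"
    then have y: "y \<in> euc d" by simp
    show "ennreal ((h y - l)\<^sup>2) \<le> ennreal (\<delta>\<^sup>2) + ennreal ((lmax - lmin)\<^sup>2) * indicator bad y"
    proof (cases "\<delta> < \<bar>h y - l\<bar>")
      case True
      have "{lmin..lmax} \<subseteq> {0<..}" using assms by auto
      from MLE_likelihood_ge(1)[OF P' this h y l] l have "\<bar>h y - l\<bar> \<le> \<bar>lmax - lmin\<bar>" by auto
      then have "(h y - l)\<^sup>2 \<le> (lmax - lmin)\<^sup>2" by (rule abs_le_square_iff[THEN iffD1])
      then have "ennreal ((h y - l)\<^sup>2) \<le> ennreal ((lmax - lmin)\<^sup>2)" by (rule ennreal_leI)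
      then show ?thesis using True y by (simp add: bad_def add_increasing)
    next
      case False
      then have "\<bar>h y - l\<bar> \<le> \<bar>\<delta>\<bar>" by auto
      then have "(h y - l)\<^sup>2 \<le> \<delta>\<^sup>2" by (rule abs_le_square_iff[THEN iffD1])
      then have "ennreal ((h y - l)\<^sup>2) \<le> ennreal (\<delta>\<^sup>2)" by (rule ennreal_leI)
      then show ?thesis by (simp add: add_increasing2)
    qed
  qed
  also have "\<dots> = ennreal (\<delta>\<^sup>2) + ennreal ((lmax - lmin)\<^sup>2) * emeasure (obs_law d P l) bad"
    using L.emeasure_space_1 by (subst nn_integral_add) (auto simp: nn_integral_cmult_indicator bad[unfolded sets_obs_law])
  also have "\<dots> = ennreal (\<delta>\<^sup>2 + (lmax - lmin)\<^sup>2 * measure (obs_law d P l) bad)"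
    by (simp add: L.emeasure_eq_measure ennreal_mult)
  also have "\<dots> \<le> ennreal (mle_const lmin lmax * R)"
  proof (rule ennreal_leI)
    have "(lmax - lmin)\<^sup>2 * measure (obs_law d P l) bad \<le> (lmax - lmin)\<^sup>2 * (A / real d)"
      by (intro mult_left_mono small) simp
    also have "\<dots> = (lmax - lmin)\<^sup>2 * A / ln 2 * (ln 2 / real d)" using ln2 by simp
    also have "\<dots> \<le> (lmax - lmin)\<^sup>2 * A / ln 2 * R"
      using R_ge \<open>0 < A\<close> ln2 by (intro mult_left_mono) auto
    finally show "\<delta>\<^sup>2 + (lmax - lmin)\<^sup>2 * measure (obs_law d P l) bad \<le> mle_const lmin lmax * R"
      by (simp add: mle_const_def \<delta>2 D_def A_def distrib_right)
  qed
  finally show ?thesis by (simp add: R_def K_def)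
qed

section \<open>The lower bound\<close>

definition gauss_law :: "nat \<Rightarrow> real \<Rightarrow> (nat \<Rightarrow> real) measure" where
  "gauss_law d s = density (lborel_euc d) (\<lambda>x. ennreal (\<Prod>i<d. normal_density 0 s (x i)))"

lemma prob_space_gauss_law: "0 < s \<Longrightarrow> prob_space (gauss_law d s)"
  unfolding gauss_law_def
  by (subst density_prod_eq_PiM) (auto simp: normal_density_nonneg intro!: prob_space_PiM prob_space_normal_density)

lemma sets_gauss_law [simp]: "sets (gauss_law d s) = sets (lborel_euc d)"
  by (simp add: gauss_law_def)

lemma nn_integral_gauss_density:
  assumes "0 < s"
  shows "(\<integral>\<^sup>+y. ennreal (\<Prod>i<d. normal_density 0 s (y i)) \<partial>lborel_euc d) = 1"
  using prob_space.emeasure_space_1[OF prob_space_gauss_law[OF assms, of d]]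
  by (simp add: gauss_law_def emeasure_density)

lemma partial_deriv_sq_norm:
  fixes x :: "nat \<Rightarrow> real"
  assumes "i < d"
  shows "((\<lambda>t. a / 2 * (\<Sum>j<d. ((x(i := t)) j)\<^sup>2)) has_real_derivative a * x i) (at (x i))"
proof -
  have "((\<lambda>t. ((x(i := t)) j)\<^sup>2) has_real_derivative (if j = i then 2 * x i else 0)) (at (x i))" for j
    by (auto intro!: derivative_eq_intros)
  then have "((\<lambda>t. a / 2 * (\<Sum>j<d. ((x(i := t)) j)\<^sup>2)) has_real_derivative
      a / 2 * (\<Sum>j<d. if j = i then 2 * x i else 0)) (at (x i))"
    by (intro DERIV_cmult DERIV_sum) auto
  also have "(\<Sum>j<d. if j = i then 2 * x i else 0) = 2 * x i"
    using assms by simp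
  also have "a / 2 * (2 * x i) = a * x i" by simp
  finally show ?thesis .
qed

lemma partial_deriv_coordinate:
  "((\<lambda>t. a * (x(i := t)) j) has_real_derivative (if i = j then a else 0)) (at (x i))" for a :: real
  by (cases "i = j") (auto intro!: derivative_eq_intros)

lemma gauss_law_in_SLC:
  assumes "0 < \<alpha>"
  shows "gauss_law d (1 / sqrt \<alpha>) \<in> SLC d \<alpha>"
proof -
  let ?s = "1 / sqrt \<alpha>"
  define V where "V x = \<alpha> / 2 * (\<Sum>i<d. (x i)\<^sup>2)" for x :: "nat \<Rightarrow> real"
  have pd: "partial_deriv i V = (\<lambda>x. \<alpha> * x i)" if "i < d" for i
    unfolding partial_deriv_def V_def
    by (intro ext DERIV_imp_deriv partial_deriv_sq_norm that)
  have pd2: "partial_deriv i (\<lambda>x. \<alpha> * x j) = (\<lambda>_. if i = j then \<alpha> else 0)" for i j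
    unfolding partial_deriv_def
    by (intro ext DERIV_imp_deriv partial_deriv_coordinate)
  have coord: "continuous_on (euc d) (\<lambda>x. x i)" for i
    by (rule continuous_on_product_then_coordinatewise[OF continuous_on_id])
  have C1V: "C1_euc d V"
    unfolding C1_euc_def
  proof (intro conjI allI impI ballI)
    show "continuous_on (euc d) V" unfolding V_def by (intro continuous_intros coord)
    fix i assume i: "i < d"
    show "(\<lambda>t. V (x(i := t))) differentiable at (x i)" for x
      unfolding V_def using partial_deriv_sq_norm[OF i] by (auto simp: real_differentiable_def)
    show "continuous_on (euc d) (partial_deriv i V)"
      unfolding pd[OF i] by (intro continuous_intros coord)
  qed
  have "C1_euc d (\<lambda>x. \<alpha> * x j)" for j
    unfolding C1_euc_def
  proof (intro conjI allI impI ballI)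
    show "continuous_on (euc d) (\<lambda>x. \<alpha> * x j)" by (intro continuous_intros coord)
    fix i assume i: "i < d"
    show "(\<lambda>t. \<alpha> * (x(i := t)) j) differentiable at (x i)" for x
      unfolding real_differentiable_def by (rule exI, rule partial_deriv_coordinate)
    show "continuous_on (euc d) (partial_deriv i (\<lambda>x. \<alpha> * x j))"
      unfolding pd2 by (intro continuous_intros)
  qed
  then have C2V: "C2_euc d V" using C1V pd by (simp add: C2_euc_def)
  have hess: "hessian_ge d V \<alpha>"
    unfolding hessian_ge_def
  proof (intro ballI)
    fix x v :: "nat \<Rightarrow> real"
    have "(\<Sum>i<d. \<Sum>j<d. v i * partial_deriv i (partial_deriv j V) x * v j)
      = (\<Sum>i<d. \<Sum>j<d. if i = j then \<alpha> * (v i)\<^sup>2 else 0)"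
      by (intro sum.cong refl) (simp add: pd pd2 power2_eq_square)
    also have "\<dots> = \<alpha> * (\<Sum>i<d. (v i)\<^sup>2)"
      by (simp add: sum_distrib_left)
    finally show "\<alpha> * (\<Sum>i<d. (v i)\<^sup>2) \<le> (\<Sum>i<d. \<Sum>j<d. v i * partial_deriv i (partial_deriv j V) x * v j)"
      by simp
  qed
  let ?n = "\<lambda>x. \<Prod>i<d. normal_density 0 ?s (x i)"
  define c where "c = sqrt (2 * pi / \<alpha>) ^ d"
  have "0 < c" using assms by (simp add: c_def)
  have expV: "exp (- V x) = c * ?n x" for x
  proof -
    have "exp (- V x) = (\<Prod>i<d. exp (- (\<alpha> * (x i)\<^sup>2) / 2))"
      by (simp add: V_def sum_distrib_left exp_sum sum_negf[symmetric])
    also have "\<dots> = (\<Prod>i<d. sqrt (2 * pi / \<alpha>) * normal_density 0 ?s (x i))"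
      using assms by (intro prod.cong refl) (simp add: normal_density_def power_divide)
    finally show ?thesis by (simp add: prod.distrib c_def)
  qed
  have "(\<integral>x. ?n x \<partial>lborel_euc d) = 1"
    using nn_integral_gauss_density[of ?s d] assms
    by (subst integral_eq_nn_integral) (auto intro!: AE_I2 prod_nonneg simp: normal_density_nonneg)
  then have Z: "(\<integral>x. exp (- V x) \<partial>lborel_euc d) = c" by (simp add: expV)
  have "gauss_law d ?s = density (lborel_euc d) (\<lambda>x. ennreal (exp (- V x) / (\<integral>x. exp (- V x) \<partial>lborel_euc d)))"
    unfolding Z gauss_law_def using \<open>0 < c\<close> by (simp add: expV)
  then show ?thesis
    unfolding SLC_def Let_def using prob_space_gauss_law[of ?s d] C2V hess assms by auto
qed

text \<open>
  Normal laws are closed under convolution, coordinate by coordinate.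
\<close>

lemma obs_law_gauss_law:
  assumes "0 < s" "0 < l"
  shows "obs_law d (gauss_law d s) l = gauss_law d (sqrt (1 / l + s\<^sup>2))"
proof -
  interpret L: product_sigma_finite "\<lambda>_::nat. lborel :: real measure" ..
  define \<sigma> where "\<sigma> = l powr (- 1 / 2)"
  note P = prob_space_gauss_law[OF \<open>0 < s\<close>, of d] sets_gauss_law[of d s]
  have \<sigma>: "0 < \<sigma>" "\<sigma>\<^sup>2 = 1 / l"
    using \<open>0 < l\<close> by (simp_all add: \<sigma>_def powr_minus_divide powr_half_sqrt power_divide)
  have shift: "normal_density 0 \<sigma> (y - t) = normal_density t \<sigma> y" for t y
    by (simp add: normal_density_def)
  have conv: "(\<integral>\<^sup>+t. ennreal (normal_density 0 s t * normal_density t \<sigma> y) \<partial>lborel)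
    = ennreal (normal_density 0 (sqrt (1 / l + s\<^sup>2)) y)" for y
    using fun_cong[OF conv_normal_density_zero_mean[OF \<sigma>(1) \<open>0 < s\<close>], of y]
    by (simp add: shift \<sigma>(2) mult.commute)
  have "ennreal (obs_density d (gauss_law d s) l y) = ennreal (\<Prod>i<d. normal_density 0 (sqrt (1 / l + s\<^sup>2)) (y i))" for y
  proof -
    have "ennreal (obs_density d (gauss_law d s) l y)
      = (\<integral>\<^sup>+x. ennreal (\<Prod>i<d. normal_density 0 s (x i)) * ennreal (\<Prod>i<d. normal_density (x i) \<sigma> (y i)) \<partial>lborel_euc d)"
      unfolding obs_density_eq_nn_integral[OF P \<open>0 < l\<close>, folded \<sigma>_def]
      unfolding gauss_law_def normal_density_def by (rule nn_integral_density) measurable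
    also have "\<dots> = (\<integral>\<^sup>+x. (\<Prod>i<d. ennreal (normal_density 0 s (x i) * normal_density (x i) \<sigma> (y i))) \<partial>lborel_euc d)"
      by (intro nn_integral_cong)
        (simp add: prod_ennreal normal_density_nonneg prod_nonneg ennreal_mult[symmetric] prod.distrib)
    also have "\<dots> = (\<Prod>i<d. \<integral>\<^sup>+t. ennreal (normal_density 0 s t * normal_density t \<sigma> (y i)) \<partial>lborel)"
      unfolding normal_density_def by (intro L.product_nn_integral_prod) auto
    finally show ?thesis by (simp add: conv prod_ennreal normal_density_nonneg)
  qed
  then show ?thesis
    unfolding obs_law_eq_density[OF P \<open>0 < l\<close>] by (simp add: gauss_law_def)
qed

text \<open>
  The geometric mean of two centered normal densities is proportional to a third one, the factor being the
  Hellinger affinity.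
\<close>

lemma sqrt_normal_density_mult:
  assumes "0 < a" "0 < b"
  defines "q \<equiv> sqrt (2 * a * b / (a\<^sup>2 + b\<^sup>2))" and "s \<equiv> sqrt 2 * a * b / sqrt (a\<^sup>2 + b\<^sup>2)"
  shows "sqrt (normal_density 0 a y * normal_density 0 b y) = q * normal_density 0 s y"
proof (rule real_sqrt_unique)
  have S: "0 < a\<^sup>2 + b\<^sup>2" using assms by (simp add: add_pos_pos)
  have s2: "s\<^sup>2 = 2 * a\<^sup>2 * b\<^sup>2 / (a\<^sup>2 + b\<^sup>2)"
    using S by (simp add: s_def power_divide power_mult_distrib)
  have q2: "q\<^sup>2 = 2 * a * b / (a\<^sup>2 + b\<^sup>2)" using assms S by (simp add: q_def)
  have "0 < s" using assms S by (simp add: s_def)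
  have "(q * normal_density 0 s y)\<^sup>2 = q\<^sup>2 / (2 * pi * s\<^sup>2) * exp (- y\<^sup>2 / s\<^sup>2)"
    by (simp add: normal_density_def power_mult_distrib power_divide exp_double[symmetric])
  also have "q\<^sup>2 = s\<^sup>2 / (a * b)"
  proof -
    have "2 * a * b / t = 2 * a\<^sup>2 * b\<^sup>2 / t / (a * b)" for t
      using assms(1,2) by (cases "t = 0") (simp_all add: power2_eq_square field_simps)
    then show ?thesis unfolding q2 s2 .
  qed
  also have "s\<^sup>2 / (a * b) / (2 * pi * s\<^sup>2) = 1 / (2 * pi * a * b)"
    using \<open>0 < s\<close> by simp
  also have "- y\<^sup>2 / s\<^sup>2 = - y\<^sup>2 / (2 * a\<^sup>2) + - y\<^sup>2 / (2 * b\<^sup>2)"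
    unfolding s2 using assms(1,2) S by (simp add: field_simps)
  also have "1 / (2 * pi * a * b) * exp (- y\<^sup>2 / (2 * a\<^sup>2) + - y\<^sup>2 / (2 * b\<^sup>2))
    = normal_density 0 a y * normal_density 0 b y"
  proof -
    have nd: "normal_density 0 c y = exp (- y\<^sup>2 / (2 * c\<^sup>2)) / (sqrt (2 * pi) * c)" if "0 < c" for c
      unfolding normal_density_def using that by (simp add: real_sqrt_mult)
    have "2 * pi * a * b = (sqrt (2 * pi) * sqrt (2 * pi)) * a * b" by simp
    also have "\<dots> = (sqrt (2 * pi) * a) * (sqrt (2 * pi) * b)" by (simp only: mult_ac)
    finally show ?thesis unfolding nd[OF assms(1)] nd[OF assms(2)] exp_add by simp
  qed
  finally show "(q * normal_density 0 s y)\<^sup>2 = normal_density 0 a y * normal_density 0 b y" .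
  show "0 \<le> q * normal_density 0 s y" using assms S by (simp add: q_def normal_density_nonneg)
qed

lemma gauss_law_affinity:
  assumes "0 < a" "0 < b"
  shows "(\<integral>\<^sup>+y. ennreal (sqrt ((\<Prod>i<d. normal_density 0 a (y i)) * (\<Prod>i<d. normal_density 0 b (y i)))) \<partial>lborel_euc d)
    = ennreal (sqrt (2 * a * b / (a\<^sup>2 + b\<^sup>2)) ^ d)"
proof -
  let ?q = "sqrt (2 * a * b / (a\<^sup>2 + b\<^sup>2))" and ?s = "sqrt 2 * a * b / sqrt (a\<^sup>2 + b\<^sup>2)"
  have "0 < a\<^sup>2 + b\<^sup>2" using assms by (simp add: add_pos_pos)
  then have "0 < ?s" using assms by simp
  have sqrt_prod: "sqrt (\<Prod>i<n. f i) = (\<Prod>i<n. sqrt (f i))" for f :: "nat \<Rightarrow> real" and n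
    by (induction n) (simp_all add: real_sqrt_mult)
  have "sqrt ((\<Prod>i<d. normal_density 0 a (y i)) * (\<Prod>i<d. normal_density 0 b (y i)))
    = ?q ^ d * (\<Prod>i<d. normal_density 0 ?s (y i))" for y
    unfolding prod.distrib[symmetric] sqrt_prod sqrt_normal_density_mult[OF assms] by (simp add: prod.distrib)
  then have "(\<integral>\<^sup>+y. ennreal (sqrt ((\<Prod>i<d. normal_density 0 a (y i)) * (\<Prod>i<d. normal_density 0 b (y i)))) \<partial>lborel_euc d)
    = (\<integral>\<^sup>+y. ennreal (?q ^ d) * ennreal (\<Prod>i<d. normal_density 0 ?s (y i)) \<partial>lborel_euc d)"
    using assms by (simp add: ennreal_mult prod_nonneg normal_density_nonneg)
  also have "\<dots> = ennreal (?q ^ d)"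
    using nn_integral_gauss_density[OF \<open>0 < ?s\<close>, of d] by (subst nn_integral_cmult) auto
  finally show ?thesis .
qed

text \<open>
  The sum of the two losses is at least \<open>(b - a)\<^sup>2 / 2\<close> whatever the estimate, so only the overlap of \<open>f\<close> and \<open>g\<close>
  matters. The affinity bounds the overlap through \<open>sqrt (u * v) \<le> min u v + (u + v) / 4\<close>.
\<close>

lemma two_point_lower_bound:
  fixes f g h :: "'a \<Rightarrow> real"
  assumes [measurable]: "f \<in> borel_measurable M" "g \<in> borel_measurable M" "h \<in> borel_measurable M"
    and nonneg: "\<And>y. 0 \<le> f y" "\<And>y. 0 \<le> g y"
    and mass: "(\<integral>\<^sup>+y. ennreal (f y) \<partial>M) = 1" "(\<integral>\<^sup>+y. ennreal (g y) \<partial>M) = 1"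
    and aff: "ennreal (3 / 4) \<le> (\<integral>\<^sup>+y. ennreal (sqrt (f y * g y)) \<partial>M)"
    and risk: "(\<integral>\<^sup>+y. ennreal (f y) * ennreal ((h y - a)\<^sup>2) \<partial>M) \<le> R"
      "(\<integral>\<^sup>+y. ennreal (g y) * ennreal ((h y - b)\<^sup>2) \<partial>M) \<le> R"
  shows "ennreal ((b - a)\<^sup>2 / 16) \<le> R"
proof -
  let ?m = "\<lambda>y. min (f y) (g y)"
  have "sqrt (u * v) \<le> min u v + 1 / 4 * (u + v)" if "0 \<le> u" "0 \<le> v" for u v :: real
  proof -
    have "u * v = min u v * max u v" by (auto simp: min_def max_def)
    also have "\<dots> \<le> (min u v + 1 / 4 * max u v)\<^sup>2"
      using zero_le_power2[of "min u v - 1 / 4 * max u v"] by (simp add: power2_eq_square algebra_simps)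
    finally have "sqrt (u * v) \<le> min u v + 1 / 4 * max u v"
      using that by (intro real_le_lsqrt) auto
    also have "\<dots> \<le> min u v + 1 / 4 * (u + v)"
      using that by (intro add_left_mono mult_left_mono) auto
    finally show ?thesis .
  qed
  then have "ennreal (sqrt (f y * g y)) \<le> ennreal (?m y) + ennreal (1/4) * (ennreal (f y) + ennreal (g y))" for y
    using nonneg[of y] by (simp add: ennreal_mult[symmetric] ennreal_plus[symmetric] del: ennreal_plus)
  then have "(\<integral>\<^sup>+y. ennreal (sqrt (f y * g y)) \<partial>M)
    \<le> (\<integral>\<^sup>+y. ennreal (?m y) + ennreal (1/4) * (ennreal (f y) + ennreal (g y)) \<partial>M)"
    by (intro nn_integral_mono)
  also have "\<dots> = (\<integral>\<^sup>+y. ennreal (?m y) \<partial>M) + ennreal (1/4) * ((\<integral>\<^sup>+y. ennreal (f y) \<partial>M) + (\<integral>\<^sup>+y. ennreal (g y) \<partial>M))"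
    by (simp add: nn_integral_add nn_integral_cmult)
  also have "\<dots> = (\<integral>\<^sup>+y. ennreal (?m y) \<partial>M) + ennreal (1/4) * ennreal 2"
    by (simp add: mass)
  also have "\<dots> = (\<integral>\<^sup>+y. ennreal (?m y) \<partial>M) + ennreal (1/2)"
    by (simp add: ennreal_mult[symmetric] del: ennreal_numeral)
  finally have "ennreal (3 / 4) \<le> (\<integral>\<^sup>+y. ennreal (?m y) \<partial>M) + ennreal (1 / 2)"
    by (rule order_trans[OF aff])
  then have overlap: "ennreal (1 / 4) \<le> (\<integral>\<^sup>+y. ennreal (?m y) \<partial>M)"
  proof (cases "\<integral>\<^sup>+y. ennreal (?m y) \<partial>M")
    case (real r)
    assume "ennreal (3 / 4) \<le> (\<integral>\<^sup>+y. ennreal (?m y) \<partial>M) + ennreal (1 / 2)"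
    also have "\<dots> = ennreal (r + 1 / 2)" unfolding real by (rule ennreal_plus[symmetric]) (use real in auto)
    finally have "3 / 4 \<le> r + 1 / 2" using real(1) by (subst (asm) ennreal_le_iff) auto
    then show ?thesis unfolding real by (intro ennreal_leI) simp
  qed simp
  have loss: "(b - a)\<^sup>2 / 2 * min u v \<le> u * (t - a)\<^sup>2 + v * (t - b)\<^sup>2" if "0 \<le> u" "0 \<le> v" for u v t
  proof -
    have "2 * ((t - a)\<^sup>2 + (t - b)\<^sup>2) = (b - a)\<^sup>2 + ((t - a) + (t - b))\<^sup>2"
      by (simp add: power2_eq_square algebra_simps)
    moreover have "x / 2 \<le> y" if "2 * y = x + z" "0 \<le> z" for x y z :: real
      using that by linarith
    ultimately have "(b - a)\<^sup>2 / 2 \<le> (t - a)\<^sup>2 + (t - b)\<^sup>2"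
      by (metis zero_le_power2)
    then have "(b - a)\<^sup>2 / 2 * min u v \<le> ((t - a)\<^sup>2 + (t - b)\<^sup>2) * min u v"
      using that by (intro mult_right_mono) auto
    also have "\<dots> = min u v * (t - a)\<^sup>2 + min u v * (t - b)\<^sup>2" by (simp add: algebra_simps)
    also have "\<dots> \<le> u * (t - a)\<^sup>2 + v * (t - b)\<^sup>2" by (intro add_mono mult_right_mono) auto
    finally show ?thesis .
  qed
  have "ennreal ((b - a)\<^sup>2 / 2) * ennreal (1/4) \<le> ennreal ((b - a)\<^sup>2 / 2) * (\<integral>\<^sup>+y. ennreal (?m y) \<partial>M)"
    by (intro mult_left_mono overlap) simp
  also have "\<dots> = (\<integral>\<^sup>+y. ennreal ((b - a)\<^sup>2 / 2) * ennreal (?m y) \<partial>M)"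
    by (rule nn_integral_cmult[symmetric]) measurable
  also have "\<dots> \<le> (\<integral>\<^sup>+y. ennreal (f y) * ennreal ((h y - a)\<^sup>2) + ennreal (g y) * ennreal ((h y - b)\<^sup>2) \<partial>M)"
    using loss nonneg
    by (intro nn_integral_mono) (simp add: ennreal_mult[symmetric] ennreal_plus[symmetric] del: ennreal_plus)
  also have "\<dots> = (\<integral>\<^sup>+y. ennreal (f y) * ennreal ((h y - a)\<^sup>2) \<partial>M) + (\<integral>\<^sup>+y. ennreal (g y) * ennreal ((h y - b)\<^sup>2) \<partial>M)"
    by (rule nn_integral_add) measurable
  also have "\<dots> \<le> R + R" by (intro add_mono risk)
  finally have "ennreal ((b - a)\<^sup>2 / 8) \<le> R + R" by (simp add: ennreal_mult[symmetric])
  then show ?thesis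
    by (cases R) (auto simp: ennreal_plus[symmetric] ennreal_le_iff simp del: ennreal_plus)
qed

text \<open>
  With \<open>\<epsilon> = (a\<^sup>2 - b\<^sup>2) / (a\<^sup>2 + b\<^sup>2)\<close> the one-dimensional affinity \<open>q\<close> satisfies \<open>q ^ 4 = 1 - \<epsilon>\<^sup>2\<close>, so Bernoulli's
  inequality applies to \<open>q ^ d \<ge> (1 - \<epsilon>\<^sup>2) ^ d\<close>.
\<close>

lemma affinity_power_ge:
  fixes a b :: real
  assumes "0 < a" "0 < b" and gap: "real d * ((a\<^sup>2 - b\<^sup>2) / (a\<^sup>2 + b\<^sup>2))\<^sup>2 \<le> 1 / 4"
  shows "3 / 4 \<le> sqrt (2 * a * b / (a\<^sup>2 + b\<^sup>2)) ^ d"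
proof -
  define q where "q = sqrt (2 * a * b / (a\<^sup>2 + b\<^sup>2))"
  define e where "e = (a\<^sup>2 - b\<^sup>2) / (a\<^sup>2 + b\<^sup>2)"
  have S: "0 < a\<^sup>2 + b\<^sup>2" using assms by (simp add: add_pos_pos)
  have q2: "q\<^sup>2 = 2 * a * b / (a\<^sup>2 + b\<^sup>2)" using assms S by (simp add: q_def)
  have "0 \<le> q" using assms S by (simp add: q_def)
  have "q\<^sup>2 \<le> 1" unfolding q2 using S sum_squares_bound[of a b] by simp
  then have "q \<le> 1" using \<open>0 \<le> q\<close> by (simp add: power_le_one_iff)
  have "q ^ 4 = (q\<^sup>2)\<^sup>2" by simp
  also have "\<dots> = 1 - e\<^sup>2"
  proof -
    have "(2 * a * b)\<^sup>2 = (a\<^sup>2 + b\<^sup>2)\<^sup>2 - (a\<^sup>2 - b\<^sup>2)\<^sup>2"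
      by (simp add: power2_eq_square algebra_simps)
    moreover have T: "(a\<^sup>2 + b\<^sup>2)\<^sup>2 \<noteq> 0" using S by (metis less_irrefl power_eq_0_iff)
    ultimately show ?thesis unfolding q2 e_def power_divide by (simp only: diff_divide_distrib divide_self[OF T])
  qed
  finally have q4: "q ^ 4 = 1 - e\<^sup>2" .
  have "q ^ 4 \<le> q ^ 1" using \<open>0 \<le> q\<close> \<open>q \<le> 1\<close> by (intro power_decreasing) auto
  then have "1 - e\<^sup>2 \<le> q" using q4 by simp
  have "0 \<le> 1 - e\<^sup>2" using q4 \<open>0 \<le> q\<close> by (metis zero_le_power)
  have "3 / 4 \<le> 1 + real d * (- e\<^sup>2)" using gap by (simp add: e_def)
  also have "\<dots> \<le> (1 + - e\<^sup>2) ^ d" using \<open>0 \<le> 1 - e\<^sup>2\<close> by (intro Bernoulli_inequality) simp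
  also have "\<dots> \<le> q ^ d" using \<open>1 - e\<^sup>2 \<le> q\<close> \<open>0 \<le> 1 - e\<^sup>2\<close> by (intro power_mono) auto
  finally show ?thesis by (simp add: q_def)
qed

text \<open>
  The squared ratio \<open>k\<close> of \<open>\<delta>\<close> to the target separation in \<open>risk_gauss_law_ge\<close>, over the \<open>16\<close> of
  \<open>two_point_lower_bound\<close>.
\<close>

definition lower_const :: "real \<Rightarrow> real \<Rightarrow> real" where
  "lower_const lmin lmax = (min 1 (min 1 (1 / lmax) * lmin\<^sup>2))\<^sup>2 / 16"

text \<open>
  The precisions \<open>lmin\<close> and \<open>lmin + \<delta>\<close> are compared. The variances of an observed coordinate differ by at most
  \<open>\<delta> / lmin\<^sup>2\<close> and their sum is at least of order \<open>1 + 1 / \<alpha>\<close>; the factor \<open>k\<close> in \<open>\<delta>\<close> makes the relative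
  difference at most \<open>1 / (2 * sqrt d)\<close>.
\<close>

lemma risk_gauss_law_ge:
  assumes "0 < \<alpha>" "1 \<le> d" and lim: "0 < lmin" "lmin < lmax"
  shows "ennreal (lower_const lmin lmax * rate \<alpha> d lmin lmax) \<le> risk d (gauss_law d (1 / sqrt \<alpha>)) {lmin..lmax}"
  unfolding risk_def
proof (rule INF_greatest)
  fix h assume h: "h \<in> estimators d {lmin..lmax}"
  then have [measurable]: "h \<in> borel_measurable (lborel_euc d)"
    unfolding estimators_def by (rule measurable_restrict_space2_iff[THEN iffD1, THEN conjunct1])
  define c where "c = min 1 (1 / lmax)"
  define k where "k = min 1 (c * lmin\<^sup>2)"
  define K where "K = 1 + inverse \<alpha>"
  define \<delta> where "\<delta> = k * min (lmax - lmin) (K / sqrt (real d))"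
  have "0 < c" "c \<le> 1" "c \<le> 1 / lmax" using lim by (auto simp: c_def)
  then have k: "0 < k" "k \<le> 1" "k \<le> c * lmin\<^sup>2" using lim by (auto simp: k_def)
  have "1 \<le> K" using \<open>0 < \<alpha>\<close> by (simp add: K_def)
  have d: "0 < sqrt (real d)" using \<open>1 \<le> d\<close> by simp
  have "0 < \<delta>" using k lim \<open>1 \<le> K\<close> d by (simp add: \<delta>_def)
  have "\<delta> \<le> 1 * (lmax - lmin)" unfolding \<delta>_def using k lim \<open>1 \<le> K\<close> d by (intro mult_mono) auto
  then have \<delta>_lmax: "lmin + \<delta> \<le> lmax" by simp
  have \<delta>_K: "\<delta> \<le> c * lmin\<^sup>2 * (K / sqrt (real d))"
    unfolding \<delta>_def using k lim \<open>1 \<le> K\<close> d by (intro mult_mono) auto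
  define a where "a = sqrt (1 / lmin + (1 / sqrt \<alpha>)\<^sup>2)"
  define b where "b = sqrt (1 / (lmin + \<delta>) + (1 / sqrt \<alpha>)\<^sup>2)"
  have inv: "(1 / sqrt \<alpha>)\<^sup>2 = inverse \<alpha>" using \<open>0 < \<alpha>\<close> by (simp add: power_divide inverse_eq_divide)
  have pos: "0 < a" "0 < b" using lim \<open>0 < \<delta>\<close> \<open>0 < \<alpha>\<close> by (auto simp: a_def b_def inv add_pos_pos)
  have sq: "a\<^sup>2 = 1 / lmin + inverse \<alpha>" "b\<^sup>2 = 1 / (lmin + \<delta>) + inverse \<alpha>"
    using lim \<open>0 < \<delta>\<close> \<open>0 < \<alpha>\<close> by (auto simp: a_def b_def inv)
  have eps: "(a\<^sup>2 - b\<^sup>2) / (a\<^sup>2 + b\<^sup>2) \<le> 1 / (2 * sqrt (real d))" "0 \<le> (a\<^sup>2 - b\<^sup>2) / (a\<^sup>2 + b\<^sup>2)"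
  proof -
    have diff: "a\<^sup>2 - b\<^sup>2 = \<delta> / (lmin * (lmin + \<delta>))"
      unfolding sq using lim \<open>0 < \<delta>\<close> by (simp add: field_simps)
    also have "\<dots> \<le> \<delta> / lmin\<^sup>2"
      using lim \<open>0 < \<delta>\<close> by (intro divide_left_mono) (auto simp: power2_eq_square)
    also have "\<dots> \<le> c * (K / sqrt (real d))" using \<delta>_K lim by (simp add: field_simps)
    finally have num: "a\<^sup>2 - b\<^sup>2 \<le> c * (K / sqrt (real d))" .
    have nonneg: "0 \<le> a\<^sup>2 - b\<^sup>2" unfolding diff using lim \<open>0 < \<delta>\<close> by simp
    have "c * K = c + c * inverse \<alpha>" by (simp add: K_def algebra_simps)
    also have "\<dots> \<le> 1 / lmax + 1 * inverse \<alpha>"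
      using \<open>c \<le> 1 / lmax\<close> \<open>c \<le> 1\<close> \<open>0 < \<alpha>\<close> by (intro add_mono mult_right_mono) auto
    finally have cK: "c * K \<le> 1 / lmax + inverse \<alpha>" by simp
    have "1 / lmax \<le> 1 / lmin" "1 / lmax \<le> 1 / (lmin + \<delta>)"
      using lim \<delta>_lmax \<open>0 < \<delta>\<close> by (auto intro!: divide_left_mono)
    then have den: "2 * (c * K) \<le> a\<^sup>2 + b\<^sup>2" using cK unfolding sq by linarith
    have "(a\<^sup>2 - b\<^sup>2) / (a\<^sup>2 + b\<^sup>2) \<le> (c * (K / sqrt (real d))) / (2 * (c * K))"
      using num nonneg den \<open>0 < c\<close> \<open>1 \<le> K\<close> by (intro frac_le) auto
    also have "\<dots> = 1 / (2 * sqrt (real d))" using \<open>0 < c\<close> \<open>1 \<le> K\<close> by simp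
    finally show "(a\<^sup>2 - b\<^sup>2) / (a\<^sup>2 + b\<^sup>2) \<le> 1 / (2 * sqrt (real d))" .
    show "0 \<le> (a\<^sup>2 - b\<^sup>2) / (a\<^sup>2 + b\<^sup>2)" using nonneg by simp
  qed
  have "real d * ((a\<^sup>2 - b\<^sup>2) / (a\<^sup>2 + b\<^sup>2))\<^sup>2 \<le> real d * (1 / (2 * sqrt (real d)))\<^sup>2"
    using eps by (intro mult_left_mono power_mono) auto
  also have "\<dots> = 1 / 4" using \<open>1 \<le> d\<close> by (simp add: power_divide power_mult_distrib)
  finally have aff: "3 / 4 \<le> sqrt (2 * a * b / (a\<^sup>2 + b\<^sup>2)) ^ d"
    by (rule affinity_power_ge[OF pos])
  let ?P = "gauss_law d (1 / sqrt \<alpha>)"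
  let ?f = "\<lambda>s y. \<Prod>i<d. normal_density 0 s (y i)"
  have mse: "mse d ?P l h = (\<integral>\<^sup>+y. ennreal (?f (sqrt (1 / l + (1 / sqrt \<alpha>)\<^sup>2)) y) * ennreal ((h y - l)\<^sup>2) \<partial>lborel_euc d)"
    if "0 < l" for l
    unfolding mse_def using that \<open>0 < \<alpha>\<close>
    by (subst obs_law_gauss_law) (auto simp: gauss_law_def intro!: nn_integral_density)
  define R where "R = (SUP l\<in>{lmin..lmax}. mse d ?P l h)"
  have "ennreal ((lmin + \<delta> - lmin)\<^sup>2 / 16) \<le> R"
  proof (rule two_point_lower_bound[where M = "lborel_euc d" and f = "?f a" and g = "?f b" and h = h])
    show "(\<integral>\<^sup>+y. ennreal (?f a y) * ennreal ((h y - lmin)\<^sup>2) \<partial>lborel_euc d) \<le> R"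
      unfolding a_def mse[OF lim(1), symmetric] R_def using lim by (intro SUP_upper) auto
    have "0 < lmin + \<delta>" using lim \<open>0 < \<delta>\<close> by simp
    then show "(\<integral>\<^sup>+y. ennreal (?f b y) * ennreal ((h y - (lmin + \<delta>))\<^sup>2) \<partial>lborel_euc d) \<le> R"
      unfolding b_def mse[symmetric] R_def using \<open>0 < \<delta>\<close> \<delta>_lmax by (subst mse[symmetric]) (auto intro!: SUP_upper)
    show "ennreal (3 / 4) \<le> (\<integral>\<^sup>+y. ennreal (sqrt (?f a y * ?f b y)) \<partial>lborel_euc d)"
      unfolding gauss_law_affinity[OF pos] using aff by (rule ennreal_leI)
    show "(\<integral>\<^sup>+y. ennreal (?f a y) \<partial>lborel_euc d) = 1"
      by (rule nn_integral_gauss_density[OF pos(1)])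
    show "(\<integral>\<^sup>+y. ennreal (?f b y) \<partial>lborel_euc d) = 1"
      by (rule nn_integral_gauss_density[OF pos(2)])
  qed (auto intro!: prod_nonneg simp: normal_density_nonneg)
  also have "(lmin + \<delta> - lmin)\<^sup>2 / 16 = lower_const lmin lmax * rate \<alpha> d lmin lmax"
  proof -
    have "(min u v)\<^sup>2 = min (u\<^sup>2) (v\<^sup>2)" if "0 \<le> u" "0 \<le> v" for u v :: real
      using that by (auto simp: min_def power2_le_iff_abs_le abs_le_square_iff[symmetric])
    then have "(min (lmax - lmin) (K / sqrt (real d)))\<^sup>2 = rate \<alpha> d lmin lmax"
      using lim \<open>1 \<le> K\<close> by (simp add: rate_def K_def power_divide)
    then show ?thesis by (simp add: \<delta>_def power_mult_distrib lower_const_def k_def c_def)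
  qed
  finally show "ennreal (lower_const lmin lmax * rate \<alpha> d lmin lmax) \<le> (SUP l\<in>{lmin..lmax}. mse d ?P l h)"
    by (simp add: R_def)
qed

section \<open>The minimax rate\<close>

lemma norm_bound_le_rate:
  fixes \<alpha> :: real
  assumes "0 < \<alpha>" "0 < lmin" "0 < d"
  shows "lmax ^ 4 / real d * (4 / \<alpha>\<^sup>2 + 4 / (\<alpha> * lmin) + 2 / lmin\<^sup>2)
    \<le> lmax ^ 4 * (4 + 4 / lmin + 2 / lmin\<^sup>2) * ((1 + inverse \<alpha>)\<^sup>2 / real d)"
proof -
  define u where "u = inverse \<alpha>"
  have "0 < u" using assms by (simp add: u_def)
  then have "u\<^sup>2 \<le> (1 + u)\<^sup>2" "u \<le> (1 + u)\<^sup>2" "1 \<le> (1 + u)\<^sup>2"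
    by (auto simp: power2_eq_square algebra_simps)
  then have "4 * u\<^sup>2 + 4 / lmin * u + 2 / lmin\<^sup>2 * 1
    \<le> 4 * (1 + u)\<^sup>2 + 4 / lmin * (1 + u)\<^sup>2 + 2 / lmin\<^sup>2 * (1 + u)\<^sup>2"
    using assms by (intro add_mono mult_left_mono) auto
  also have "\<dots> = (4 + 4 / lmin + 2 / lmin\<^sup>2) * (1 + u)\<^sup>2" by (simp add: algebra_simps)
  also have "4 * u\<^sup>2 + 4 / lmin * u + 2 / lmin\<^sup>2 * 1 = 4 / \<alpha>\<^sup>2 + 4 / (\<alpha> * lmin) + 2 / lmin\<^sup>2"
    by (simp add: u_def divide_inverse power_inverse mult.commute)
  finally have "lmax ^ 4 / real d * (4 / \<alpha>\<^sup>2 + 4 / (\<alpha> * lmin) + 2 / lmin\<^sup>2)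
    \<le> lmax ^ 4 / real d * ((4 + 4 / lmin + 2 / lmin\<^sup>2) * (1 + u)\<^sup>2)"
    by (intro mult_left_mono) auto
  then show ?thesis by (simp add: u_def)
qed

lemma ennreal_le_mult_minI:
  fixes C D x :: real
  assumes "M \<le> ennreal D" "M \<le> ennreal (C * x)" "1 \<le> C" "0 \<le> D"
  shows "M \<le> ennreal (C * min D x)"
proof (cases "D \<le> x")
  case True
  have "ennreal D \<le> ennreal (C * D)" using assms(3,4) by (intro ennreal_leI) (simp add: mult_le_cancel_right1)
  then show ?thesis using assms(1) True by (simp add: min_def order_trans)
next
  case False
  then show ?thesis using assms(2) by (simp add: min_def)
qed

theorem theorem3p2:
  fixes lmin lmax :: real
  assumes "0 < lmin" and "lmin < lmax"
  shows "\<exists>c C :: real. c > 0 \<and> C > 0 \<and>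
    (\<forall>(d::nat) (\<alpha>::real). d \<ge> 1 \<longrightarrow> \<alpha> > 0 \<longrightarrow>
      ennreal (c * rate \<alpha> d lmin lmax) \<le> risk_SLC d \<alpha> {lmin..lmax}
    \<and> (\<forall>P\<in>SLC d \<alpha>.
         (SUP l\<in>{lmin..lmax}. mse d P l (norm_estimator d P lmin lmax))
           \<le> ennreal (min ((lmax - lmin)\<^sup>2)
                (lmax ^ 4 / real d * (4 / \<alpha>\<^sup>2 + 4 / (\<alpha> * lmin) + 2 / lmin\<^sup>2))))
    \<and> (\<forall>P\<in>SLC d \<alpha>. \<forall>h. is_MLE d P {lmin..lmax} h \<longrightarrow>
         (SUP l\<in>{lmin..lmax}. mse d P l h)
           \<le> ennreal (C * min ((lmax - lmin)\<^sup>2)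
                ((1 + inverse \<alpha>)\<^sup>2 * ln (2 * real d) / real d)))
    \<and> ennreal (c * rate \<alpha> d lmin lmax) \<le> risk_SLC d \<alpha> {lmin..lmax}
    \<and> risk_SLC d \<alpha> {lmin..lmax} \<le> ennreal (C * rate \<alpha> d lmin lmax))"
proof -
  define Cn where "Cn = lmax ^ 4 * (4 + 4 / lmin + 2 / lmin\<^sup>2)"
  define C where "C = max 1 (max Cn (mle_const lmin lmax))"
  have C: "1 \<le> C" "Cn \<le> C" "mle_const lmin lmax \<le> C" by (auto simp: C_def)
  have c: "0 < lower_const lmin lmax" unfolding lower_const_def using assms
    by (intro divide_pos_pos zero_less_power) (simp_all add: min_less_iff_conj)
  have lower: "ennreal (lower_const lmin lmax * rate \<alpha> d lmin lmax) \<le> risk_SLC d \<alpha> {lmin..lmax}"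
    if "1 \<le> d" "0 < \<alpha>" for d \<alpha>
    unfolding risk_SLC_def
    using risk_gauss_law_ge[OF that(2,1) assms] gauss_law_in_SLC[OF that(2)] by (rule SUP_upper2[rotated])
  have range: "mse d P l h \<le> ennreal ((lmax - lmin)\<^sup>2)"
    if "P \<in> SLC d \<alpha>" "l \<in> {lmin..lmax}" "\<And>y. y \<in> euc d \<Longrightarrow> h y \<in> {lmin..lmax}" for d P \<alpha> l h
    using that by (intro mse_le_range prob_space_SLC sets_SLC)
  have norm: "(SUP l\<in>{lmin..lmax}. mse d P l (norm_estimator d P lmin lmax))
      \<le> ennreal (min ((lmax - lmin)\<^sup>2) (lmax ^ 4 / real d * (4 / \<alpha>\<^sup>2 + 4 / (\<alpha> * lmin) + 2 / lmin\<^sup>2)))"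
    if "1 \<le> d" "0 < \<alpha>" "P \<in> SLC d \<alpha>" for d \<alpha> P
  proof (intro SUP_least)
    fix l assume l: "l \<in> {lmin..lmax}"
    show "mse d P l (norm_estimator d P lmin lmax)
      \<le> ennreal (min ((lmax - lmin)\<^sup>2) (lmax ^ 4 / real d * (4 / \<alpha>\<^sup>2 + 4 / (\<alpha> * lmin) + 2 / lmin\<^sup>2)))"
      using norm_estimator_mse[OF that(3,2,1) assms l] range[OF that(3) l norm_estimator_range[OF assms]]
      unfolding min_def by presburger
  qed
  have mle: "(SUP l\<in>{lmin..lmax}. mse d P l h)
      \<le> ennreal (C * min ((lmax - lmin)\<^sup>2) ((1 + inverse \<alpha>)\<^sup>2 * ln (2 * real d) / real d))"
    if "1 \<le> d" "0 < \<alpha>" "P \<in> SLC d \<alpha>" "is_MLE d P {lmin..lmax} h" for d \<alpha> P h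
  proof (intro SUP_least ennreal_le_mult_minI C(1))
    fix l assume l: "l \<in> {lmin..lmax}"
    have "{lmin..lmax} \<subseteq> {0<..}" using assms by auto
    from MLE_likelihood_ge(1)[OF prob_space_SLC[OF that(3)] sets_SLC[OF that(3)] this that(4) _ l]
    show "mse d P l h \<le> ennreal ((lmax - lmin)\<^sup>2)" by (rule range[OF that(3) l])
    have "mse d P l h \<le> ennreal (mle_const lmin lmax * ((1 + inverse \<alpha>)\<^sup>2 * ln (2 * real d) / real d))"
      using that(1) by (intro MLE_mse[OF that(3,2) _ assms that(4) l]) simp
    also have "\<dots> \<le> ennreal (C * ((1 + inverse \<alpha>)\<^sup>2 * ln (2 * real d) / real d))"
      using that(1) C(3) by (intro ennreal_leI mult_right_mono) auto
    finally show "mse d P l h \<le> ennreal (C * ((1 + inverse \<alpha>)\<^sup>2 * ln (2 * real d) / real d))" .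
  qed simp
  have upper: "risk_SLC d \<alpha> {lmin..lmax} \<le> ennreal (C * rate \<alpha> d lmin lmax)"
    if "1 \<le> d" "0 < \<alpha>" for d \<alpha>
    unfolding risk_SLC_def
  proof (intro SUP_least)
    fix P assume P: "P \<in> SLC d \<alpha>"
    let ?B = "lmax ^ 4 / real d * (4 / \<alpha>\<^sup>2 + 4 / (\<alpha> * lmin) + 2 / lmin\<^sup>2)"
    let ?h = "norm_estimator d P lmin lmax"
    have "risk d P {lmin..lmax} \<le> (SUP l\<in>{lmin..lmax}. mse d P l ?h)"
      unfolding risk_def by (rule INF_lower[OF norm_estimator_in_estimators[OF assms]])
    note risk_le = order_trans[OF this norm[OF that P]]
    show "risk d P {lmin..lmax} \<le> ennreal (C * rate \<alpha> d lmin lmax)"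
      unfolding rate_def
    proof (rule ennreal_le_mult_minI[OF _ _ C(1)])
      show "risk d P {lmin..lmax} \<le> ennreal ((lmax - lmin)\<^sup>2)"
        by (rule order_trans[OF risk_le]) (rule ennreal_leI, simp)
      have "?B \<le> Cn * ((1 + inverse \<alpha>)\<^sup>2 / real d)"
        unfolding Cn_def using that assms by (intro norm_bound_le_rate) auto
      also have "\<dots> \<le> C * ((1 + inverse \<alpha>)\<^sup>2 / real d)"
        using C(2) by (intro mult_right_mono) auto
      finally have "min ((lmax - lmin)\<^sup>2) ?B \<le> C * ((1 + inverse \<alpha>)\<^sup>2 / real d)" by linarith
      then show "risk d P {lmin..lmax} \<le> ennreal (C * ((1 + inverse \<alpha>)\<^sup>2 / real d))"
        by (intro order_trans[OF risk_le] ennreal_leI)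
    qed simp
  qed
  show ?thesis
    using c C(1) lower norm mle upper
    by (intro exI[of _ "lower_const lmin lmax"] exI[of _ C] conjI allI impI ballI) auto
qed

end
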